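(* Let $n\ge2$, $k_1\ge1$, $k_2\ge0$ and $0\le\alpha\le n-1$. The number of NBC bases of the gain graph $K_n^{[1-k_2,k_1+k_2]}$ with activity $\alpha$ equals the number of $(k_1,k_2)$-non-increasing $(k_1+k_2)$-colored rooted trees on $[n]$ having exactly $\alpha$ edges of the form $(n,i)$ colored $1$. In particular, the number of bounded regions of the arrangement associated with $K_n^{[1-k_2,k_1+k_2]}$ (taken in the hyperplane $x_1+\cdots+x_n=0$) equals the number of such trees with no edge of the form $(n,i)$ colored $1$. (For $k_1=1,k_2=0$ this is the Linial arrangement $x_j-x_i=1$, $1\le i<j\le n$, and the trees are uncolored.)
   Context: For integers $a\le b$, $K_n^{[a,b]}$ is the gain graph (over $\mathbb Z$) with vertex set $[n]$ and, for every $1\le i<j\le n$ and every integer $g\in[a,b]$, one edge from $i$ to $j$ with gain $g$ (gain $-g$ in the reverse direction), corresponding to the hyperplane $x_j-x_i=g$ in $\mathbb R^n$; the associated arrangement consists of all these hyperplanes. A circle is balanced if the sum of the gains along it, in a fixed direction, is $0$. Fix a linear order on the edges. A broken circuit is a balanced circle minus its smallest edge. An NBC set is an edge set forming a forest of the underlying multigraph (no circles, no two parallel edges) containing no broken circuit; an NBC basis is an NBC set which is a spanning tree. For an NBC basis $B$, $e\in B$ is active if $e$ is the smallest edge among all $f$ with $(B\setminus\{e\})\cup\{f\}$ a spanning tree; the activity of $B$ is the number of active edges (the counts do not depend on the order). A $k$-colored rooted tree on $[n]$ is a set of $n-1$ triples $(u,w,c)$, $u\neq w\in[n]$, $c\in[k]$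 (edge from parent $u$ to child $w$ with color $c$), each vertex a child at most once, with no cycle. For a vertex $v$ with at least one child let $c_v$ be the minimal color of edges from $v$ to its children. With $k=k_1+k_2$, the tree is $(k_1,k_2)$-non-increasing if for every vertex $v$ with a child and $c_v\le k_1$, at least one child $w$ joined to $v$ by an edge of color $c_v$ satisfies $w<v$. An edge of the form $(n,i)$ is one whose parent is $n$. *)

theory Defs
  imports "HOL-Analysis.Analysis"
begin

section \<open>Gain graphs K_n^{[a,b]}\<close>

text \<open>An edge is a triple (i,j,g) with i<j: directed from i to j with gain g
  (gain -g in the reverse direction); it corresponds to the hyperplane x_j - x_i = g.\<close>
type_synonym gedge = "nat \<times> nat \<times> int"

definition gain_edges :: "nat \<Rightarrow> int \<Rightarrow> int \<Rightarrow> gedge set" where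
  "gain_edges n a b = {(i, j, g). 1 \<le> i \<and> i < j \<and> j \<le> n \<and> a \<le> g \<and> g \<le> b}"

definition ends :: "gedge \<Rightarrow> nat set" where
  "ends e = {fst e, fst (snd e)}"

definition gain :: "gedge \<Rightarrow> int" where
  "gain e = snd (snd e)"

text \<open>gain of e when traversed starting at vertex u\<close>
definition dgain :: "gedge \<Rightarrow> nat \<Rightarrow> int" where
  "dgain e u = (if u = fst e then gain e else - gain e)"

text \<open>A closed walk along distinct vertices vs!0, ..., vs!(m-1) using distinct edges
  es!k joining vs!k and vs!((k+1) mod m); m = 2 covers two parallel edges.\<close>
definition circle_walk :: "nat list \<Rightarrow> gedge list \<Rightarrow> bool" where
  "circle_walk vs es \<longleftrightarrow> length vs = length es \<and> 2 \<le> length vs \<and> distinct vs \<and> distinct es \<and>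
     (\<forall>k < length vs. ends (es ! k) = {vs ! k, vs ! ((k + 1) mod length vs)})"

definition is_circle :: "gedge set \<Rightarrow> bool" where
  "is_circle C \<longleftrightarrow> (\<exists>vs es. circle_walk vs es \<and> C = set es)"

definition balanced_circle :: "gedge set \<Rightarrow> bool" where
  "balanced_circle C \<longleftrightarrow> (\<exists>vs es. circle_walk vs es \<and> C = set es \<and>
      (\<Sum>k < length vs. dgain (es ! k) (vs ! k)) = 0)"

definition is_forest :: "gedge set \<Rightarrow> bool" where
  "is_forest F \<longleftrightarrow> \<not> (\<exists>C. C \<subseteq> F \<and> is_circle C)"

definition adj :: "gedge set \<Rightarrow> (nat \<times> nat) set" where
  "adj F = {(u, w). \<exists>e\<in>F. ends e = {u, w}}"

definition spanning_tree :: "nat \<Rightarrow> int \<Rightarrow> int \<Rightarrow> gedge set \<Rightarrow> bool" where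
  "spanning_tree n a b T \<longleftrightarrow> T \<subseteq> gain_edges n a b \<and> is_forest T \<and>
     (\<forall>u\<in>{1..n}. \<forall>w\<in>{1..n}. (u, w) \<in> (adj T)\<^sup>*)"

text \<open>The linear order on the edges is given by an injective ranking r.\<close>
definition broken_circuit_in :: "(gedge \<Rightarrow> nat) \<Rightarrow> nat \<Rightarrow> int \<Rightarrow> int \<Rightarrow> gedge set \<Rightarrow> bool" where
  "broken_circuit_in r n a b F \<longleftrightarrow> (\<exists>C e. C \<subseteq> gain_edges n a b \<and> balanced_circle C \<and>
      e \<in> C \<and> (\<forall>f\<in>C. r e \<le> r f) \<and> C - {e} \<subseteq> F)"

definition nbc_set :: "(gedge \<Rightarrow> nat) \<Rightarrow> nat \<Rightarrow> int \<Rightarrow> int \<Rightarrow> gedge set \<Rightarrow> bool" where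
  "nbc_set r n a b F \<longleftrightarrow> F \<subseteq> gain_edges n a b \<and> is_forest F \<and> \<not> broken_circuit_in r n a b F"

definition nbc_basis :: "(gedge \<Rightarrow> nat) \<Rightarrow> nat \<Rightarrow> int \<Rightarrow> int \<Rightarrow> gedge set \<Rightarrow> bool" where
  "nbc_basis r n a b B \<longleftrightarrow> nbc_set r n a b B \<and> spanning_tree n a b B"

definition active_edge :: "(gedge \<Rightarrow> nat) \<Rightarrow> nat \<Rightarrow> int \<Rightarrow> int \<Rightarrow> gedge set \<Rightarrow> gedge \<Rightarrow> bool" where
  "active_edge r n a b B e \<longleftrightarrow> e \<in> B \<and>
     (\<forall>f \<in> gain_edges n a b. spanning_tree n a b ((B - {e}) \<union> {f}) \<longrightarrow> r e \<le> r f)"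

definition activity :: "(gedge \<Rightarrow> nat) \<Rightarrow> nat \<Rightarrow> int \<Rightarrow> int \<Rightarrow> gedge set \<Rightarrow> nat" where
  "activity r n a b B = card {e \<in> B. active_edge r n a b B e}"

section \<open>The associated arrangement, restricted to x_1 + ... + x_n = 0\<close>

text \<open>Points of R^n are functions nat => real vanishing outside {1..n} (product topology).\<close>
definition sum_zero_space :: "nat \<Rightarrow> (nat \<Rightarrow> real) set" where
  "sum_zero_space n = {x. (\<forall>i. i \<notin> {1..n} \<longrightarrow> x i = 0) \<and> (\<Sum>i=1..n. x i) = 0}"

definition hyperplane_of :: "gedge \<Rightarrow> (nat \<Rightarrow> real) set" where
  "hyperplane_of e = {x. x (fst (snd e)) - x (fst e) = real_of_int (gain e)}"

definition arr_complement :: "nat \<Rightarrow> int \<Rightarrow> int \<Rightarrow> (nat \<Rightarrow> real) set" where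
  "arr_complement n a b = sum_zero_space n - (\<Union>e \<in> gain_edges n a b. hyperplane_of e)"

definition regions :: "nat \<Rightarrow> int \<Rightarrow> int \<Rightarrow> (nat \<Rightarrow> real) set set" where
  "regions n a b = {connected_component_set (arr_complement n a b) x | x. x \<in> arr_complement n a b}"

definition bounded_region :: "nat \<Rightarrow> (nat \<Rightarrow> real) set \<Rightarrow> bool" where
  "bounded_region n R \<longleftrightarrow> (\<exists>M. \<forall>x\<in>R. \<forall>i\<in>{1..n}. \<bar>x i\<bar> \<le> M)"

section \<open>Colored rooted trees\<close>

text \<open>A triple (u,w,c): edge from parent u to child w with color c.\<close>
definition colored_rooted_tree :: "nat \<Rightarrow> nat \<Rightarrow> (nat \<times> nat \<times> nat) set \<Rightarrow> bool" where
  "colored_rooted_tree n k T \<longleftrightarrow>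
     T \<subseteq> {1..n} \<times> {1..n} \<times> {1..k} \<and> (\<forall>(u, w, c) \<in> T. u \<noteq> w) \<and>
     card T = n - 1 \<and>
     (\<forall>t\<in>T. \<forall>t'\<in>T. fst (snd t) = fst (snd t') \<longrightarrow> t = t') \<and>
     acyclic {(u, w). \<exists>c. (u, w, c) \<in> T}"

definition min_child_color :: "(nat \<times> nat \<times> nat) set \<Rightarrow> nat \<Rightarrow> nat" where
  "min_child_color T v = Min {c. \<exists>w. (v, w, c) \<in> T}"

definition non_increasing :: "nat \<Rightarrow> (nat \<times> nat \<times> nat) set \<Rightarrow> bool" where
  "non_increasing k1 T \<longleftrightarrow> (\<forall>v. (\<exists>w c. (v, w, c) \<in> T) \<and> min_child_color T v \<le> k1 \<longrightarrow>
      (\<exists>w. (v, w, min_child_color T v) \<in> T \<and> w < v))"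

definition num_root_edges_col1 :: "nat \<Rightarrow> (nat \<times> nat \<times> nat) set \<Rightarrow> nat" where
  "num_root_edges_col1 n T = card {t \<in> T. fst t = n \<and> snd (snd t) = 1}"

end

theory Submission
  imports Defs
begin

text \<open>Both sides are compared as polynomials. The NBC sets are partitioned by the intervals
  [B - act B, B] over the NBC bases B, so the generating function of activity is, up to a change of
  variable, the alternating sum over NBC sets. Toggling the least edge of a flat shows that for all
  large q this alternating sum counts the proper colorings modulo q. Reading such a coloring around
  the circle turns it into a permutation with prescribed gaps, hence into a sum of binomial
  coefficients over permutations that involves only the number of ascents.

  On the other side the condition at each vertex of a colored tree is resolved by
  inclusion-exclusion. The remaining sum over rooted trees, in which an edge is weighted by its
  parent and by whether it goes up or down, is a product, as contracting the edge above the largest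
  vertex shows. The resulting signed sum of products equals the same sum over permutations, by a
  computation with shift operators in which ordered set partitions appear on both sides.

  For the bounded regions, deletion and restriction computes the alternating sum over the central
  edge sets, boundedness of a cell being strong connectivity of its constraint digraph; comparing flat
  by flat, this sum agrees with the one over the NBC sets.\<close>

section \<open>Connectivity and circles\<close>

text \<open>No bijection is built: both counts become polynomials in 1 - q, and it suffices that
  they agree for all large integers q. The value 1 - q arises because y = -q makes the activity
  weight 1 + y equal to 1 - q. Vertex n has a special role on both sides. For colorings, x n = 0
  removes translations and turns the edges at n into bounds on the other x i. In a tree every child
  of n is smaller than n, so the condition at n always holds and its edges are free to carry the
  variable. What remains lives on the m = n - 1 other vertices. The obstacle is that the factors of
  the signed tree sum depend on the positions of the vertices, while the coloring count sees only
  ascents. They meet through the geometric sum: if T is the shift z - 1 and W = 1 + T + ... + T^K,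
  then T^(K+1) = 1 - W (1 - T), and 1 - T lowers the degree of a binomial coefficient. Thus a shift
  by K + 1 per ascent is traded for powers of W. For regions, deletion passes through arrangements
  with lineality; boundedness is therefore measured only on the functionals present, and restriction
  is recorded by a set F of equations.\<close>

definition conn :: "gedge set \<Rightarrow> (nat \<times> nat) set" where
  "conn F = (adj F)\<^sup>*"

lemma adj_insert: "adj (insert (i, j, g) F) = insert (i, j) (insert (j, i) (adj F))"
  by (auto simp: adj_def ends_def doubleton_eq_iff)

lemma conn_refl [simp]: "(u, u) \<in> conn F"
  by (simp add: conn_def)

lemma conn_sym: "(u, w) \<in> conn F \<Longrightarrow> (w, u) \<in> conn F"
proof -
  have "sym (adj F)"
    by (auto simp: sym_def adj_def insert_commute)
  then show "(u, w) \<in> conn F \<Longrightarrow> (w, u) \<in> conn F"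
    unfolding conn_def by (meson sym_rtrancl symD)
qed

lemma conn_trans: "(u, v) \<in> conn F \<Longrightarrow> (v, w) \<in> conn F \<Longrightarrow> (u, w) \<in> conn F"
  unfolding conn_def by (rule rtrancl_trans)

lemma conn_mono: "F \<subseteq> G \<Longrightarrow> conn F \<subseteq> conn G"
  unfolding conn_def by (rule rtrancl_mono) (auto simp: adj_def)

lemma conn_edge: "e \<in> F \<Longrightarrow> ends e = {u, w} \<Longrightarrow> (u, w) \<in> conn F"
  unfolding conn_def by (rule r_into_rtrancl) (auto simp: adj_def)

text \<open>A walk needs the new edge at most once, in one of its two directions.\<close>

lemma conn_insert:
  "conn (insert (i, j, g) F) = {(u, w). (u, w) \<in> conn F \<or>
     (u, i) \<in> conn F \<and> (j, w) \<in> conn F \<or> (u, j) \<in> conn F \<and> (i, w) \<in> conn F}"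
proof -
  have "conn (insert (i, j, g) F) \<subseteq> {(u, w). (u, w) \<in> conn F \<or>
     (u, i) \<in> conn F \<and> (j, w) \<in> conn F \<or> (u, j) \<in> conn F \<and> (i, w) \<in> conn F}"
    unfolding conn_def adj_insert rtrancl_insert by (auto intro: rtrancl_trans)
  moreover have "conn F \<subseteq> conn (insert (i, j, g) F)"
    by (rule conn_mono) auto
  moreover have "(i, j) \<in> conn (insert (i, j, g) F)"
    by (rule conn_edge[of "(i, j, g)"]) (auto simp: ends_def)
  ultimately show ?thesis
    by (auto; meson conn_trans conn_sym subsetD)
qed

lemma conn_insert_connected:
  "(i, j) \<in> conn F \<Longrightarrow> conn (insert (i, j, g) F) = conn F"
  unfolding conn_insert by (auto; meson conn_trans conn_sym)

lemma conn_subset_conn: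
  assumes "\<And>e u w. e \<in> F \<Longrightarrow> ends e = {u, w} \<Longrightarrow> (u, w) \<in> conn G"
  shows "conn F \<subseteq> conn G"
proof -
  have "adj F \<subseteq> (adj G)\<^sup>*"
    using assms by (auto simp: adj_def conn_def)
  then have "(adj F)\<^sup>* \<subseteq> ((adj G)\<^sup>*)\<^sup>*"
    by (rule rtrancl_mono)
  then show ?thesis
    by (simp add: conn_def)
qed

lemma conn_closed:
  assumes "(u, w) \<in> conn F" "u \<in> C"
    and "\<And>e u w. e \<in> F \<Longrightarrow> ends e = {u, w} \<Longrightarrow> u \<in> C \<Longrightarrow> w \<in> C"
  shows "w \<in> C"
  using assms(1) unfolding conn_def
  by (induction rule: rtrancl_induct) (use assms in \<open>auto simp: adj_def\<close>)

text \<open>The walk is shortened while it is built: on reaching a vertex already visited, the path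
  is cut back to that vertex.\<close>

lemma simple_path_exists:
  assumes "(u, w) \<in> conn F"
  shows "\<exists>vs es. length vs = Suc (length es) \<and> distinct vs \<and> vs ! 0 = u \<and> vs ! length es = w \<and>
     set es \<subseteq> F \<and> (\<forall>k<length es. ends (es ! k) = {vs ! k, vs ! Suc k})"
  using assms unfolding conn_def
proof (induction rule: rtrancl_induct)
  case base
  show ?case
    by (rule exI[of _ "[u]"], rule exI[of _ "[]"]) auto
next
  case (step y z)
  then obtain vs es where p: "length vs = Suc (length es)" "distinct vs" "vs ! 0 = u"
    "vs ! length es = y" "set es \<subseteq> F" "\<forall>k<length es. ends (es ! k) = {vs ! k, vs ! Suc k}"
    by blast
  obtain e where e: "e \<in> F" "ends e = {y, z}"
    using step.hyps by (auto simp: adj_def)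
  show ?case
  proof (cases "z \<in> set vs")
    case True
    then obtain l where l: "l < length vs" "vs ! l = z"
      by (auto simp: in_set_conv_nth)
    show ?thesis
      by (rule exI[of _ "take (Suc l) vs"], rule exI[of _ "take l es"])
        (use p l in \<open>auto dest: in_set_takeD simp: min_def le_Suc_eq less_Suc_eq_le\<close>)
  next
    case False
    show ?thesis
      by (rule exI[of _ "vs @ [z]"], rule exI[of _ "es @ [e]"])
        (use p e False in \<open>auto simp: nth_append less_Suc_eq\<close>)
  qed
qed

lemma circle_through_edge:
  assumes "(u, w) \<in> conn F" "ends e = {u, w}" "u \<noteq> w" "e \<notin> F"
  obtains C where "is_circle C" "e \<in> C" "C - {e} \<subseteq> F"
proof -
  obtain vs es where p: "length vs = Suc (length es)" "distinct vs" "vs ! 0 = u"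
    "vs ! length es = w" "set es \<subseteq> F" "\<forall>k<length es. ends (es ! k) = {vs ! k, vs ! Suc k}"
    using simple_path_exists[OF assms(1)] by blast
  have pos: "es \<noteq> []"
    using p assms(3) by auto
  \<comment> \<open>Since the vertices are distinct, the pair \<open>{vs ! k, vs ! Suc k}\<close>
    determines \<open>k\<close>. The closing edge is new by \<open>e \<notin> F\<close>, which also
    covers the circle formed by two parallel edges.\<close>
  have "k = l" if "k < length es" "l < length es" "es ! k = es ! l" for k l
  proof -
    have "{vs ! k, vs ! Suc k} = {vs ! l, vs ! Suc l}"
      using p(6) that by metis
    then have "k = l \<or> k = Suc l \<and> Suc k = l"
      using p(1,2) that by (auto simp: doubleton_eq_iff nth_eq_iff_index_eq)
    then show ?thesis by auto
  qed
  then have "distinct es"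
    by (auto simp: distinct_conv_nth)
  then have "circle_walk vs (es @ [e])"
    unfolding circle_walk_def using p pos assms
    by (auto simp: nth_append Suc_le_eq less_Suc_eq mod_Suc)
  then have "is_circle (set (es @ [e]))"
    unfolding is_circle_def by blast
  then show ?thesis
    using that p(5) by auto
qed

text \<open>The other edges form the way around: starting behind position \<open>k\<close> of
  \<open>e\<close>, the indices \<open>(k + Suc t) mod m\<close> with \<open>Suc t < m\<close> never
  return to \<open>k\<close>.\<close>

lemma circle_walk_conn:
  assumes "circle_walk vs es" "e \<in> set es" "ends e = {u, w}"
  shows "(u, w) \<in> conn (set es - {e})"
proof -
  define m where "m = length vs"
  have w: "length es = m" "2 \<le> m" "distinct es"
    "\<And>k. k < m \<Longrightarrow> ends (es ! k) = {vs ! k, vs ! (Suc k mod m)}"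
    using assms(1) by (auto simp: circle_walk_def m_def)
  obtain k where k: "k < m" "e = es ! k"
    using assms(2) w(1) by (metis in_set_conv_nth)
  have "(vs ! ((k + 1) mod m), vs ! ((k + Suc t) mod m)) \<in> conn (set es - {e})" if "t < m" for t
    using that
  proof (induction t)
    case (Suc t)
    let ?l = "(k + Suc t) mod m"
    have l: "?l < m" using w(2) by simp
    have "?l \<noteq> k"
    proof
      assume "?l = k"
      then have "(k + Suc t) mod m = k mod m" using k by simp
      then have "m dvd Suc t"
        by (metis mod_eq_dvd_iff_nat le_add1 add_diff_cancel_left')
      then show False using Suc.prems by (auto dest: dvd_imp_le)
    qed
    then have "es ! ?l \<in> set es - {e}"
      using w k l by (auto simp: nth_eq_iff_index_eq)
    moreover have "ends (es ! ?l) = {vs ! ?l, vs ! ((k + Suc (Suc t)) mod m)}"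
      using w(4)[OF l] by (simp add: mod_Suc_eq)
    ultimately have "(vs ! ?l, vs ! ((k + Suc (Suc t)) mod m)) \<in> conn (set es - {e})"
      by (rule conn_edge)
    then show ?case
      using Suc by (meson Suc_lessD conn_trans)
  qed simp
  from this[of "m - 1"] have "(vs ! (Suc k mod m), vs ! k) \<in> conn (set es - {e})"
    using w(2) k by simp
  moreover have "{u, w} = {vs ! k, vs ! (Suc k mod m)}"
    using w(4)[OF k(1)] k(2) assms(3) by simp
  ultimately show ?thesis
    by (auto simp: doubleton_eq_iff intro: conn_sym)
qed

lemma circle_conn:
  "is_circle C \<Longrightarrow> e \<in> C \<Longrightarrow> ends e = {u, w} \<Longrightarrow> (u, w) \<in> conn (C - {e})"
  unfolding is_circle_def by (metis circle_walk_conn)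

lemma balanced_circle_is_circle: "balanced_circle C \<Longrightarrow> is_circle C"
  by (auto simp: balanced_circle_def is_circle_def)

lemma is_forest_mono: "is_forest F \<Longrightarrow> G \<subseteq> F \<Longrightarrow> is_forest G"
  by (auto simp: is_forest_def)

lemma is_forest_empty [simp]: "is_forest {}"
  by (auto simp: is_forest_def is_circle_def circle_walk_def)

lemma is_forest_insert:
  assumes "is_forest F" "(i, j, g) \<notin> F" "i \<noteq> j"
  shows "is_forest (insert (i, j, g) F) \<longleftrightarrow> (i, j) \<notin> conn F"
proof
  assume f: "is_forest (insert (i, j, g) F)"
  show "(i, j) \<notin> conn F"
  proof
    assume "(i, j) \<in> conn F"
    then obtain C where "is_circle C" "C - {(i, j, g)} \<subseteq> F"
      using circle_through_edge[of i j F "(i, j, g)"] assms(2,3) by (metis ends_def fst_conv snd_conv)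
    then have "C \<subseteq> insert (i, j, g) F" by blast
    with \<open>is_circle C\<close> show False using f by (simp add: is_forest_def)
  qed
next
  assume n: "(i, j) \<notin> conn F"
  show "is_forest (insert (i, j, g) F)"
    unfolding is_forest_def
  proof (rule notI, elim exE conjE)
    fix C assume C: "C \<subseteq> insert (i, j, g) F" "is_circle C"
    then have "(i, j, g) \<in> C"
      using assms(1) unfolding is_forest_def by blast
    then have "(i, j) \<in> conn (C - {(i, j, g)})"
      using C(2) circle_conn[of C "(i, j, g)" i j] by (simp add: ends_def)
    moreover have "C - {(i, j, g)} \<subseteq> F"
      using C(1) by blast
    ultimately show False
      using n conn_mono by blast
  qed
qed

lemma is_forest_remove:
  assumes "is_forest F" "(i, j, g) \<in> F" "i \<noteq> j"
  shows "(i, j) \<notin> conn (F - {(i, j, g)})"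
proof -
  have "is_forest (F - {(i, j, g)})"
    using assms(1) by (rule is_forest_mono) auto
  moreover have "insert (i, j, g) (F - {(i, j, g)}) = F"
    using assms(2) by blast
  ultimately show ?thesis
    using is_forest_insert[of "F - {(i, j, g)}" i j g] assms by auto
qed

section \<open>Counting components\<close>

lemma finite_gain_edges [simp]: "finite (gain_edges n a b)"
proof -
  have "gain_edges n a b \<subseteq> {0..n} \<times> {0..n} \<times> {a..b}"
    by (auto simp: gain_edges_def)
  then show ?thesis
    by (rule finite_subset) auto
qed

lemma gain_edges_iff:
  "(i, j, g) \<in> gain_edges n a b \<longleftrightarrow> 1 \<le> i \<and> i < j \<and> j \<le> n \<and> a \<le> g \<and> g \<le> b"
  by (simp add: gain_edges_def)

definition comps :: "nat \<Rightarrow> gedge set \<Rightarrow> nat set set" where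
  "comps n F = (\<lambda>v. conn F `` {v}) ` {1..n}"

lemma finite_comps [simp]: "finite (comps n F)"
  by (simp add: comps_def)

lemma conn_class_eq_iff: "conn F `` {u} = conn F `` {w} \<longleftrightarrow> (u, w) \<in> conn F"
  by (auto intro: conn_trans conn_sym)

lemma comps_insert_connected:
  "(i, j) \<in> conn F \<Longrightarrow> comps n (insert (i, j, g) F) = comps n F"
  by (simp add: comps_def conn_insert_connected)

lemma card_comps_insert:
  assumes "i \<in> {1..n}" "j \<in> {1..n}" "(i, j) \<notin> conn F"
  shows "card (comps n F) = Suc (card (comps n (insert (i, j, g) F)))"
proof -
  let ?I = "conn F `` {i}" and ?J = "conn F `` {j}"
  have cls: "conn (insert (i, j, g) F) `` {v} =
      (if v \<in> ?I \<union> ?J then ?I \<union> ?J else conn F `` {v})" for v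
    unfolding conn_insert by (auto; meson conn_trans conn_sym)
  have ne: "?I \<noteq> ?J"
    using assms(3) by (simp add: conn_class_eq_iff)
  have disj: "v \<in> ?I \<union> ?J \<longleftrightarrow> conn F `` {v} \<in> {?I, ?J}" for v
    by (auto simp: conn_class_eq_iff intro: conn_sym)
  have new: "comps n (insert (i, j, g) F) = insert (?I \<union> ?J) (comps n F - {?I, ?J})"
  proof (intro equalityI subsetI)
    fix X assume "X \<in> comps n (insert (i, j, g) F)"
    then obtain v where v: "v \<in> {1..n}" "X = conn (insert (i, j, g) F) `` {v}"
      by (auto simp: comps_def)
    then show "X \<in> insert (?I \<union> ?J) (comps n F - {?I, ?J})"
      using cls[of v] disj[of v] by (auto simp: comps_def split: if_splits)
  next
    fix X assume "X \<in> insert (?I \<union> ?J) (comps n F - {?I, ?J})"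
    then consider "X = ?I \<union> ?J" | v where "v \<in> {1..n}" "X = conn F `` {v}" "X \<notin> {?I, ?J}"
      unfolding comps_def by blast
    then show "X \<in> comps n (insert (i, j, g) F)"
    proof cases
      case 1
      then show ?thesis
        using cls[of i] assms(1) by (auto simp: comps_def)
    next
      case 2
      then show ?thesis
        using cls[of v] disj[of v] unfolding comps_def by (metis imageI)
    qed
  qed
  have notin: "?I \<union> ?J \<notin> comps n F"
  proof
    assume "?I \<union> ?J \<in> comps n F"
    then obtain v where "?I \<union> ?J = conn F `` {v}"
      by (auto simp: comps_def)
    moreover have "i \<in> ?I \<union> ?J" "j \<in> ?I \<union> ?J"
      by simp_all
    ultimately have "(v, i) \<in> conn F" "(v, j) \<in> conn F"
      by blast+
    then show False
      using assms(3) by (meson conn_trans conn_sym)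
  qed
  have "{?I, ?J} \<subseteq> comps n F"
    using assms by (auto simp: comps_def)
  then have "card (comps n F - {?I, ?J}) = card (comps n F) - 2" "card (comps n F) \<ge> 2"
    using ne card_mono[of "comps n F" "{?I, ?J}"] by (simp_all add: card_Diff_subset)
  then show ?thesis
    using notin by (simp add: new)
qed

text \<open>Each edge added to a forest merges two components, starting from n singletons. This rank
  formula is behind every exponent \<open>n - 1 - card F\<close> below.\<close>

lemma forest_card_comps:
  assumes "F \<subseteq> gain_edges n a b" "is_forest F"
  shows "card F + card (comps n F) = n"
proof -
  have "finite F"
    using assms finite_subset finite_gain_edges by blast
  then show ?thesis
    using assms
  proof (induction F)
    case empty
    have "conn {} = Id"
      by (auto simp: conn_def adj_def)
    then have "comps n {} = (\<lambda>v. {v}) ` {1..n}"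
      by (auto simp: comps_def)
    then show ?case
      by (simp add: card_image)
  next
    case (insert e F)
    obtain i j g where e: "e = (i, j, g)" by (cases e)
    have F: "is_forest F"
      using insert.prems by (auto intro: is_forest_mono)
    have ij: "1 \<le> i" "i < j" "j \<le> n"
      using insert.prems e by (auto simp: gain_edges_iff)
    have "(i, j) \<notin> conn F"
      using is_forest_insert[of F i j g] insert e F ij by auto
    then have "card (comps n F) = Suc (card (comps n (insert e F)))"
      unfolding e using ij by (intro card_comps_insert) auto
    then show ?case
      using insert F by simp
  qed
qed

lemma card_comps_connected:
  assumes "1 \<le> n" "\<forall>u\<in>{1..n}. \<forall>w\<in>{1..n}. (u, w) \<in> conn F"
  shows "card (comps n F) = 1"
proof -
  have "comps n F = {conn F `` {1}}"
  proof (intro equalityI subsetI)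
    fix X assume "X \<in> comps n F"
    then obtain v where "v \<in> {1..n}" "X = conn F `` {v}"
      by (auto simp: comps_def)
    then show "X \<in> {conn F `` {1}}"
      using assms by (simp add: conn_class_eq_iff)
  next
    fix X assume "X \<in> {conn F `` {1}}"
    then show "X \<in> comps n F"
      using assms(1) by (auto simp: comps_def)
  qed
  then show ?thesis by simp
qed

lemma connected_if_card_comps:
  assumes "card (comps n F) = 1" "u \<in> {1..n}" "w \<in> {1..n}"
  shows "(u, w) \<in> conn F"
proof -
  obtain X where "comps n F = {X}"
    using assms(1) by (auto simp: card_1_singleton_iff)
  then have "conn F `` {u} = conn F `` {w}"
    using assms(2,3) unfolding comps_def by (metis imageI singletonD)
  then show ?thesis
    by (simp add: conn_class_eq_iff)
qed

section \<open>No-broken-circuit bases and activity\<close>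

lemma finite_nbc_sets [simp]: "finite {F. nbc_set r n a b F}"
  by (rule finite_subset[of _ "Pow (gain_edges n a b)"]) (auto simp: nbc_set_def)

lemma finite_nbc_bases [simp]: "finite {B. nbc_basis r n a b B}"
  by (rule finite_subset[of _ "{F. nbc_set r n a b F}"]) (auto simp: nbc_basis_def)

lemma nbc_set_mono: "nbc_set r n a b F \<Longrightarrow> G \<subseteq> F \<Longrightarrow> nbc_set r n a b G"
  unfolding nbc_set_def broken_circuit_in_def by (meson is_forest_mono subset_trans)

text \<open>A circle has at least two distinct edges, so a broken circuit is never empty.\<close>

lemma nbc_set_empty: "nbc_set r n a b {}"
proof -
  have False if C: "balanced_circle C" "e \<in> C" "C - {e} \<subseteq> {}" for C e
  proof -
    have "C = {e}" using C by auto
    then obtain vs es where "circle_walk vs es" "set es = {e}"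
      using C(1) unfolding balanced_circle_def by metis
    then show False
      using distinct_card[of es] by (auto simp: circle_walk_def)
  qed
  then show ?thesis
    unfolding nbc_set_def broken_circuit_in_def by auto
qed

lemma sum_Pow_power_card:
  fixes y :: "'a :: comm_ring_1"
  assumes "finite A"
  shows "(\<Sum>D\<in>Pow A. y ^ card D) = (1 + y) ^ card A"
  using prod_add[OF assms, of "\<lambda>_. y" "\<lambda>_. 1"] by (simp add: add.commute)

locale gain_graph =
  fixes n :: nat and a b :: int and r :: "gedge \<Rightarrow> nat"
  assumes n2: "2 \<le> n" and ab: "a \<le> b" and inj_r: "inj_on r (gain_edges n a b)"
begin

abbreviation "E \<equiv> gain_edges n a b"

lemma E_ne: "(i, j, g) \<in> E \<Longrightarrow> i \<noteq> j"
  by (auto simp: gain_edges_iff)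

lemma E_verts: "(i, j, g) \<in> E \<Longrightarrow> i \<in> {1..n} \<and> j \<in> {1..n}"
  by (auto simp: gain_edges_iff)

lemma spanning_tree_iff:
  "spanning_tree n a b T \<longleftrightarrow> T \<subseteq> E \<and> is_forest T \<and> card (comps n T) = 1"
  using card_comps_connected[of n T] connected_if_card_comps[of n T] n2
  by (auto simp: spanning_tree_def conn_def[symmetric])

lemma card_spanning_tree: "spanning_tree n a b T \<Longrightarrow> card T = n - 1"
  using forest_card_comps[of T n a b] by (auto simp: spanning_tree_iff)

text \<open>By the rank formula \<open>B - {e}\<close> has exactly two components, and the new edge
  runs between them.\<close>

lemma exchange:
  assumes "spanning_tree n a b B" "e \<in> B" "(i, j, g) \<in> E" "(i, j) \<notin> conn (B - {e})"
  shows "spanning_tree n a b ((B - {e}) \<union> {(i, j, g)})"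
proof -
  have B: "B \<subseteq> E" "is_forest B"
    using assms(1) by (auto simp: spanning_tree_iff)
  have F: "is_forest (B - {e})"
    using B(2) by (rule is_forest_mono) auto
  have "card (B - {e}) + card (comps n (B - {e})) = n"
    using F B by (intro forest_card_comps[of _ n a b]) auto
  moreover have "card (B - {e}) = n - 2"
    using assms(2) card_spanning_tree[OF assms(1)] by simp
  ultimately have "card (comps n (B - {e})) = 2"
    using n2 by simp
  then have "card (comps n (insert (i, j, g) (B - {e}))) = 1"
    using card_comps_insert[of i n j "B - {e}" g] E_verts[OF assms(3)] assms(4) by simp
  moreover have "(i, j, g) \<notin> B - {e}"
    using assms(4) conn_edge[of "(i, j, g)" "B - {e}" i j] by (auto simp: ends_def)
  then have "is_forest (insert (i, j, g) (B - {e}))"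
    using is_forest_insert[OF F] E_ne[OF assms(3)] assms(4) by simp
  ultimately show ?thesis
    using B(1) assms(3) unfolding spanning_tree_iff by auto
qed

text \<open>In \<open>C - {f}\<close> the ends of \<open>f\<close> are still joined, whereas in
  \<open>B - {f}\<close> they are not; only \<open>e\<close> can make the difference, so
  \<open>e\<close> crosses the cut opened by removing \<open>f\<close>.\<close>

lemma circle_exchange:
  assumes "spanning_tree n a b B" "is_circle C" "C \<subseteq> E" "e \<in> C" "C - {e} \<subseteq> B" "f \<in> C - {e}"
  shows "spanning_tree n a b ((B - {f}) \<union> {e})"
proof -
  obtain i j g i' j' g' where e: "e = (i, j, g)" and f: "f = (i', j', g')"
    by (metis prod_cases3)
  have "(i', j') \<notin> conn (B - {f})"
    using is_forest_remove[of B i' j' g'] assms E_ne[of i' j' g'] f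
    by (auto simp: spanning_tree_iff)
  moreover have "(i', j') \<in> conn (C - {f})"
    using circle_conn[OF assms(2), of f i' j'] assms(6) f by (simp add: ends_def)
  then have "(i', j') \<in> conn (insert e (B - {f}))"
    using conn_mono[of "C - {f}" "insert e (B - {f})"] assms(5) by blast
  ultimately have "(i, j) \<notin> conn (B - {f})"
    using conn_insert_connected[of i j "B - {f}" g] e by auto
  then show ?thesis
    using exchange[OF assms(1), of f i j g] assms e by auto
qed

lemma spanning_tree_extension:
  assumes "F \<subseteq> E" "is_forest F"
  shows "\<exists>B. spanning_tree n a b B \<and> F \<subseteq> B"
proof -
  let ?P = "\<lambda>G. G \<subseteq> E \<and> is_forest G \<and> F \<subseteq> G"
  have fin: "finite {G. ?P G}"
    by (rule finite_subset[of _ "Pow E"]) auto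
  have "{G. ?P G} \<noteq> {}"
    using assms by blast
  from finite_has_maximal[OF fin this] obtain G where G: "?P G"
    and max: "\<And>H. ?P H \<Longrightarrow> G \<subseteq> H \<Longrightarrow> H = G"
    by (metis (mono_tags, lifting) mem_Collect_eq)
  have "(u, w) \<in> conn G" if "u \<in> {1..n}" "w \<in> {1..n}" "u < w" for u w
  proof (rule ccontr)
    assume c: "(u, w) \<notin> conn G"
    then have "(u, w, a) \<notin> G"
      using conn_edge[of "(u, w, a)" G u w] by (auto simp: ends_def)
    moreover have "is_forest (insert (u, w, a) G)"
      using is_forest_insert[of G u w a] G c that \<open>(u, w, a) \<notin> G\<close> by auto
    moreover have "(u, w, a) \<in> E"
      using that ab by (auto simp: gain_edges_iff)
    ultimately show False
      using max[of "insert (u, w, a) G"] G by blast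
  qed
  then have "(u, w) \<in> conn G" if "u \<in> {1..n}" "w \<in> {1..n}" for u w
    using that by (metis conn_refl conn_sym linorder_neqE_nat)
  then have "card (comps n G) = 1"
    using n2 by (intro card_comps_connected) auto
  then show ?thesis
    using G by (auto simp: spanning_tree_iff)
qed

definition act :: "gedge set \<Rightarrow> gedge set" where
  "act B = {e \<in> B. active_edge r n a b B e}"

lemma card_act: "card (act B) = activity r n a b B"
  by (simp add: act_def activity_def)

text \<open>A spanning tree of least total rank among those containing F admits no improving exchange
  outside F.\<close>

lemma active_completion_exists:
  assumes "F \<subseteq> E" "is_forest F"
  shows "\<exists>B. spanning_tree n a b B \<and> F \<subseteq> B \<and> B - act B \<subseteq> F"
proof -
  obtain B0 where "spanning_tree n a b B0 \<and> F \<subseteq> B0"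
    using spanning_tree_extension[OF assms] by blast
  from ex_has_least_nat[of "\<lambda>T. spanning_tree n a b T \<and> F \<subseteq> T", OF this, of "sum r"]
  obtain B where B: "spanning_tree n a b B" "F \<subseteq> B"
    and min: "\<And>T. spanning_tree n a b T \<Longrightarrow> F \<subseteq> T \<Longrightarrow> sum r B \<le> sum r T"
    by blast
  have fin: "finite B"
    using B(1) finite_subset[OF _ finite_gain_edges] by (auto simp: spanning_tree_def)
  have "active_edge r n a b B e" if "e \<in> B" "e \<notin> F" for e
    unfolding active_edge_def
  proof (intro conjI ballI impI)
    fix f assume f: "f \<in> E" "spanning_tree n a b ((B - {e}) \<union> {f})"
    show "r e \<le> r f"
    \<comment> \<open>If \<open>f\<close> already lies in \<open>B - {e}\<close>, the exchange only
      loses an edge, and a spanning tree always has n - 1 of them.\<close>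
    proof (cases "f \<in> B - {e}")
      case True
      then have "(B - {e}) \<union> {f} = B - {e}" by blast
      then have "card (B - {e}) = card B"
        using card_spanning_tree f(2) B(1) by metis
      then show ?thesis
        using that fin by (metis card_Diff1_less less_irrefl)
    next
      case False
      have "sum r B \<le> sum r ((B - {e}) \<union> {f})"
        using min[OF f(2)] B(2) that by blast
      also have "\<dots> = r f + sum r (B - {e})"
        using False fin by simp
      finally show ?thesis
        using sum.remove[OF fin that(1), of r] by simp
    qed
  qed (use that in auto)
  then show ?thesis
    using B by (auto simp: act_def)
qed

text \<open>An edge \<open>e\<close> of \<open>B\<close> outside \<open>B'\<close> closes a circle
  with \<open>B'\<close>, and some other edge \<open>f\<close> of that circle crosses the cut of
  \<open>B - {e}\<close>. Both edges lie outside \<open>F\<close>, so \<open>e\<close> is active in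
  \<open>B\<close> and \<open>f\<close> in \<open>B'\<close>. Each can be exchanged for the other,
  so each is at most the other in rank, which forces \<open>e = f\<close>.\<close>

lemma active_completion_unique:
  assumes B: "spanning_tree n a b B" "F \<subseteq> B" "B - act B \<subseteq> F"
    and B': "spanning_tree n a b B'" "F \<subseteq> B'" "B' - act B' \<subseteq> F"
  shows "B = B'"
proof (rule ccontr)
  assume neq: "B \<noteq> B'"
  have sub: "B \<subseteq> E" "B' \<subseteq> E" "finite B'"
    using B(1) B'(1) finite_subset[OF _ finite_gain_edges] by (auto simp: spanning_tree_def)
  have "\<not> B \<subseteq> B'"
    using neq card_subset_eq[OF sub(3), of B] card_spanning_tree B(1) B'(1) by metis
  then obtain e where e: "e \<in> B" "e \<notin> B'" by blast
  obtain i j g where eq: "e = (i, j, g)" by (cases e)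
  have ij: "i \<noteq> j"
    using E_ne[of i j g] e eq sub by blast
  have "(i, j) \<in> conn B'"
    using connected_if_card_comps[of n B' i j] B'(1) E_verts[of i j g] e eq sub
    by (auto simp: spanning_tree_iff)
  then obtain C where C: "is_circle C" "e \<in> C" "C - {e} \<subseteq> B'"
    using circle_through_edge[of i j B' e] e(2) ij eq by (metis ends_def fst_conv snd_conv)
  have sep: "(i, j) \<notin> conn (B - {e})"
    using is_forest_remove[of B i j g] B(1) e eq E_ne[of i j g] sub by (auto simp: spanning_tree_iff)
  have "(i, j) \<in> conn (C - {e})"
    using circle_conn[OF C(1,2), of i j] eq by (simp add: ends_def)
  then obtain f u w where f: "f \<in> C - {e}" "ends f = {u, w}" "(u, w) \<notin> conn (B - {e})"
    using conn_subset_conn[of "C - {e}" "B - {e}"] sep by blast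
  obtain i' j' g' where feq: "f = (i', j', g')" by (cases f)
  have nc: "(i', j') \<notin> conn (B - {e})"
    using f(2,3) feq conn_sym by (auto simp: ends_def doubleton_eq_iff)
  have fE: "f \<in> E" "f \<in> B'"
    using f(1) C(3) sub by auto
  have fB: "f \<notin> B"
  proof
    assume "f \<in> B"
    then have "f \<in> B - {e}" using f(1) by blast
    from conn_edge[OF this f(2)] show False
      using f(3) by simp
  qed
  have "spanning_tree n a b ((B - {e}) \<union> {f})"
    using exchange[OF B(1) e(1)] fE(1) nc unfolding feq by simp
  moreover have "e \<in> act B" using e B'(2) B(3) by blast
  ultimately have 1: "r e \<le> r f"
    using fE(1) by (auto simp: act_def active_edge_def)
  have "C \<subseteq> E" using C(3) sub e by blast
  then have "spanning_tree n a b ((B' - {f}) \<union> {e})"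
    using circle_exchange[OF B'(1) C(1) _ C(2,3) f(1)] by simp
  moreover have "f \<in> act B'" using fE fB B(2) B'(3) by blast
  ultimately have "r f \<le> r e"
    using e sub by (auto simp: act_def active_edge_def)
  then have "e = f"
    using 1 inj_r e fE sub by (auto dest: inj_onD)
  then show False using f(1) by simp
qed

text \<open>A broken circuit inside \<open>B\<close> cannot lie inside \<open>F\<close>, so it
  contains an edge \<open>f\<close> of \<open>act B\<close>. The least edge of the circle can
  replace \<open>f\<close> and has smaller rank, against activity.\<close>

lemma active_completion_nbc:
  assumes "nbc_set r n a b F" "spanning_tree n a b B" "B - act B \<subseteq> F"
  shows "nbc_basis r n a b B"
proof -
  have B: "B \<subseteq> E" "is_forest B"
    using assms(2) by (auto simp: spanning_tree_def)
  have "\<not> broken_circuit_in r n a b B"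
  proof
    assume "broken_circuit_in r n a b B"
    then obtain C e where C: "C \<subseteq> E" "balanced_circle C" "e \<in> C" "\<forall>f\<in>C. r e \<le> r f" "C - {e} \<subseteq> B"
      unfolding broken_circuit_in_def by blast
    have "\<not> C - {e} \<subseteq> F"
      using C assms(1) unfolding nbc_set_def broken_circuit_in_def by blast
    then obtain f where f: "f \<in> C - {e}" "f \<notin> F" by blast
    have "f \<in> act B" using f C(5) assms(3) by blast
    moreover have "spanning_tree n a b ((B - {f}) \<union> {e})"
      using circle_exchange[OF assms(2) balanced_circle_is_circle[OF C(2)] C(1,3,5) f(1)] .
    ultimately have "r f \<le> r e"
      using C by (auto simp: act_def active_edge_def)
    then have "r e = r f" using C(4) f(1) by (simp add: order_antisym)
    then have "e = f" using inj_r C f(1) by (auto dest: inj_onD)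
    then show False using f(1) by simp
  qed
  then show ?thesis
    using B assms(2) by (simp add: nbc_basis_def nbc_set_def)
qed

text \<open>The intervals [B - act B, B] over the NBC bases B partition the NBC sets.\<close>

theorem nbc_sets_sum_activity:
  fixes y :: "'a :: comm_ring_1"
  shows "(\<Sum>F | nbc_set r n a b F. y ^ (n - 1 - card F)) =
         (\<Sum>B | nbc_basis r n a b B. (1 + y) ^ activity r n a b B)"
proof -
  let ?I = "\<lambda>B. {F. B - act B \<subseteq> F \<and> F \<subseteq> B}"
  let ?NB = "{B. nbc_basis r n a b B}"
  have finB: "finite B" if "B \<in> ?NB" for B
    using that finite_subset[OF _ finite_gain_edges, of B] by (auto simp: nbc_basis_def nbc_set_def)
  have union: "{F. nbc_set r n a b F} = (\<Union>B\<in>?NB. ?I B)"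
  proof (intro equalityI subsetI)
    fix F assume "F \<in> {F. nbc_set r n a b F}"
    then have F: "nbc_set r n a b F" by simp
    then obtain B where "spanning_tree n a b B" "F \<subseteq> B" "B - act B \<subseteq> F"
      using active_completion_exists[of F] by (auto simp: nbc_set_def)
    then show "F \<in> (\<Union>B\<in>?NB. ?I B)"
      using active_completion_nbc[OF F] by blast
  next
    fix F assume "F \<in> (\<Union>B\<in>?NB. ?I B)"
    then show "F \<in> {F. nbc_set r n a b F}"
      using nbc_set_mono by (auto simp: nbc_basis_def)
  qed
  have disj: "?I B \<inter> ?I B' = {}" if "B \<in> ?NB" "B' \<in> ?NB" "B \<noteq> B'" for B B'
    using active_completion_unique[of B _ B'] that by (auto simp: nbc_basis_def)
  have finI: "finite (?I B)" if "B \<in> ?NB" for B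
    by (rule finite_subset[of _ "Pow B"]) (use finB[OF that] in auto)
  have fibre: "(\<Sum>F\<in>?I B. y ^ (n - 1 - card F)) = (1 + y) ^ activity r n a b B" if "B \<in> ?NB" for B
  proof -
    have sub: "act B \<subseteq> B" by (auto simp: act_def)
    \<comment> \<open>A set in the interval is determined by the active edges \<open>D\<close> that
      it omits, and the exponent \<open>n - 1 - card F\<close> counts exactly these.\<close>
    have "bij_betw (\<lambda>D. B - D) (Pow (act B)) (?I B)"
      by (rule bij_betw_byWitness[where f' = "\<lambda>F. B - F"]) (use sub in auto)
    then have "(\<Sum>F\<in>?I B. y ^ (n - 1 - card F)) = (\<Sum>D\<in>Pow (act B). y ^ (n - 1 - card (B - D)))"
      by (rule sum.reindex_bij_betw[symmetric])
    also have "\<dots> = (\<Sum>D\<in>Pow (act B). y ^ card D)"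
    proof (rule sum.cong[OF refl])
      fix D assume "D \<in> Pow (act B)"
      then have "D \<subseteq> B" using sub by auto
      moreover have "card B = n - 1"
        using that card_spanning_tree by (auto simp: nbc_basis_def)
      moreover have "card (B - D) + card D = card B"
        using finB[OF that] \<open>D \<subseteq> B\<close> by (metis card_Diff_subset card_mono finite_subset le_add_diff_inverse2)
      ultimately show "y ^ (n - 1 - card (B - D)) = y ^ card D"
        by (metis add_diff_cancel_left')
    qed
    also have "\<dots> = (1 + y) ^ activity r n a b B"
      using sum_Pow_power_card[of "act B" y] finite_subset[OF sub finB[OF that]]
      by (simp add: card_act)
    finally show ?thesis .
  qed
  have "(\<Sum>F | nbc_set r n a b F. y ^ (n - 1 - card F)) =
      (\<Sum>B\<in>?NB. \<Sum>F\<in>?I B. y ^ (n - 1 - card F))"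
    unfolding union using disj finI by (intro sum.UNION_disjoint) auto
  also have "\<dots> = (\<Sum>B\<in>?NB. (1 + y) ^ activity r n a b B)"
    by (rule sum.cong[OF refl]) (rule fibre)
  finally show ?thesis .
qed

section \<open>Alternating sums over NBC subsets of a flat\<close>

text \<open>Inserting the least edge \<open>e0\<close> of \<open>X\<close> keeps the NBC property. A
  new circle through \<open>e0\<close> would lie in \<open>X\<close>, hence be balanced by
  \<open>bal\<close>, and \<open>F\<close> would already contain it without its least edge
  \<open>e0\<close>. A new broken circuit uses \<open>e0\<close> as a non-least edge of a circle
  whose least edge is in \<open>X\<close> by \<open>closed\<close>, hence of rank at least that of
  \<open>e0\<close>. So subsets with and without \<open>e0\<close> cancel in pairs.\<close>

lemma nbc_alternating_zero:
  assumes X: "X \<subseteq> E" "X \<noteq> {}"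
    and bal: "\<And>C. C \<subseteq> X \<Longrightarrow> is_circle C \<Longrightarrow> balanced_circle C"
    and closed: "\<And>C e. C \<subseteq> E \<Longrightarrow> balanced_circle C \<Longrightarrow> e \<in> C \<Longrightarrow> C - {e} \<subseteq> X \<Longrightarrow> e \<in> X"
  shows "(\<Sum>F | nbc_set r n a b F \<and> F \<subseteq> X. (-1 :: 'a :: comm_ring_1) ^ card F) = 0"
proof -
  obtain e0 where e0: "e0 \<in> X" "\<And>f. f \<in> X \<Longrightarrow> r e0 \<le> r f"
    using ex_has_least_nat[of "\<lambda>e. e \<in> X" _ r] X(2) by blast
  let ?S = "{F. nbc_set r n a b F \<and> F \<subseteq> X}"
  let ?N = "{F \<in> ?S. e0 \<notin> F}"
  have finS: "finite ?S"
    by (rule finite_subset[OF _ finite_nbc_sets[of r n a b]]) auto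
  have toggle: "insert e0 F \<in> ?S" if "F \<in> ?S" for F
  proof -
    have F: "nbc_set r n a b F" "F \<subseteq> X" using that by auto
    have "\<not> broken_circuit_in r n a b (insert e0 F)"
    proof
      assume "broken_circuit_in r n a b (insert e0 F)"
      then obtain C e where C: "C \<subseteq> E" "balanced_circle C" "e \<in> C" "\<forall>f\<in>C. r e \<le> r f"
        "C - {e} \<subseteq> insert e0 F"
        unfolding broken_circuit_in_def by blast
      then have "e \<in> X"
        using closed F(2) e0(1) by blast
      have "e0 \<in> C - {e}"
        using C F(1) unfolding nbc_set_def broken_circuit_in_def by blast
      then have "r e = r e0"
        using C(4) e0(2)[OF \<open>e \<in> X\<close>] by (simp add: order_antisym)
      then have "e = e0"
        using inj_r \<open>e \<in> X\<close> e0(1) X(1) by (meson inj_onD subsetD)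
      then show False using \<open>e0 \<in> C - {e}\<close> by simp
    qed
    moreover have "is_forest (insert e0 F)"
      unfolding is_forest_def
    proof (rule notI, elim exE conjE)
      fix C assume C: "C \<subseteq> insert e0 F" "is_circle C"
      have "e0 \<in> C"
        using C F(1) unfolding nbc_set_def is_forest_def by blast
      moreover have "C \<subseteq> X" using C F(2) e0(1) by blast
      moreover have "balanced_circle C" using bal[OF \<open>C \<subseteq> X\<close> C(2)] .
      ultimately have "broken_circuit_in r n a b F"
        using C(1) X(1) e0(2) unfolding broken_circuit_in_def by blast
      then show False using F(1) by (simp add: nbc_set_def)
    qed
    ultimately show ?thesis
      using F e0(1) X(1) unfolding nbc_set_def by blast
  qed
  have split: "?S = ?N \<union> insert e0 ` ?N"
  proof (intro equalityI subsetI)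
    fix F assume F: "F \<in> ?S"
    show "F \<in> ?N \<union> insert e0 ` ?N"
    proof (cases "e0 \<in> F")
      case True
      then have "F - {e0} \<in> ?N" "F = insert e0 (F - {e0})"
        using F nbc_set_mono[of r n a b F "F - {e0}"] by auto
      then show ?thesis by blast
    qed (use F in auto)
  qed (use toggle in auto)
  have finF: "finite F" if "F \<in> ?N" for F
    using that finite_subset[OF _ finite_gain_edges, of F] by (auto simp: nbc_set_def)
  have "inj_on (insert e0) ?N"
    by (auto simp: inj_on_def)
  then have "(\<Sum>F\<in>insert e0 ` ?N. (-1 :: 'a) ^ card F) = (\<Sum>F\<in>?N. (-1) ^ card (insert e0 F))"
    by (simp add: sum.reindex)
  also have "\<dots> = (\<Sum>F\<in>?N. - ((-1) ^ card F))"
    by (rule sum.cong[OF refl]) (use finF in auto)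
  finally have "(\<Sum>F\<in>insert e0 ` ?N. (-1 :: 'a) ^ card F) = - (\<Sum>F\<in>?N. (-1) ^ card F)"
    by (simp add: sum_negf)
  moreover have "(\<Sum>F\<in>?S. (-1 :: 'a) ^ card F) =
      (\<Sum>F\<in>?N. (-1) ^ card F) + (\<Sum>F\<in>insert e0 ` ?N. (-1) ^ card F)"
    using finS by (subst split, intro sum.union_disjoint) auto
  ultimately show ?thesis by simp
qed

end

section \<open>Counting solutions modulo q\<close>

text \<open>The ring is left open because the same algebra is used twice: over the integers modulo q
  for colorings, and over the reals, where divisibility by 0 means vanishing, for the
  arrangement.\<close>

definition lval :: "(nat \<Rightarrow> 'a :: comm_ring_1) \<Rightarrow> gedge \<Rightarrow> 'a" where
  "lval x e = x (fst (snd e)) - x (fst e) - of_int (gain e)"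

text \<open>The differences of \<open>x\<close> telescope around the circle and leave only the
  gains.\<close>

lemma circle_walk_lval_sum:
  fixes x :: "nat \<Rightarrow> 'a :: comm_ring_1"
  assumes cw: "circle_walk vs es" and ne: "\<And>e. e \<in> set es \<Longrightarrow> fst e \<noteq> fst (snd e)"
  shows "(\<Sum>k<length vs. (if vs ! k = fst (es ! k) then 1 else -1) * lval x (es ! k)) =
         - of_int (\<Sum>k<length vs. dgain (es ! k) (vs ! k))"
proof -
  define m where "m = length vs"
  have w: "length es = m" "2 \<le> m"
    "\<And>k. k < m \<Longrightarrow> ends (es ! k) = {vs ! k, vs ! (Suc k mod m)}"
    using cw by (auto simp: circle_walk_def m_def)
  have step: "(if vs ! k = fst (es ! k) then 1 else -1) * lval x (es ! k) =
      x (vs ! (Suc k mod m)) - x (vs ! k) - of_int (dgain (es ! k) (vs ! k))" if k: "k < m" for k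
  proof -
    have "es ! k \<in> set es"
      using k w(1) by simp
    then have neq: "fst (es ! k) \<noteq> fst (snd (es ! k))"
      by (rule ne)
    consider "vs ! k = fst (es ! k)" "vs ! (Suc k mod m) = fst (snd (es ! k))"
      | "vs ! k = fst (snd (es ! k))" "vs ! (Suc k mod m) = fst (es ! k)"
      using w(3)[OF k] unfolding ends_def doubleton_eq_iff by metis
    then show ?thesis
    proof cases
      case 1
      then show ?thesis
        by (simp only: dgain_def lval_def simp_thms if_True mult_1)
    next
      case 2
      then show ?thesis
        using neq by (simp add: dgain_def lval_def)
    qed
  qed
  obtain p where p: "m = Suc p" using w(2) by (cases m) auto
  have "(\<Sum>k<m. x (vs ! (Suc k mod m))) = (\<Sum>k<p. x (vs ! Suc k)) + x (vs ! 0)"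
    by (simp add: p)
  also have "\<dots> = (\<Sum>k<m. x (vs ! k))"
    unfolding p sum.lessThan_Suc_shift by (simp add: add.commute)
  finally have cyc: "(\<Sum>k<m. x (vs ! (Suc k mod m))) = (\<Sum>k<m. x (vs ! k))" .
  have "(\<Sum>k<m. (if vs ! k = fst (es ! k) then 1 else -1) * lval x (es ! k)) =
      (\<Sum>k<m. x (vs ! (Suc k mod m)) - x (vs ! k) - of_int (dgain (es ! k) (vs ! k)))"
    by (rule sum.cong) (use step in auto)
  also have "\<dots> = - of_int (\<Sum>k<m. dgain (es ! k) (vs ! k))"
    by (simp add: sum_subtractf cyc)
  finally show ?thesis
    by (simp add: m_def)
qed

context gain_graph
begin

lemma E_ends_ne: "e \<in> E \<Longrightarrow> fst e \<noteq> fst (snd e)"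
  by (auto simp: gain_edges_def)

lemma balanced_circle_lval_dvd:
  fixes q :: "'a :: comm_ring_1"
  assumes "C \<subseteq> E" "balanced_circle C" "e \<in> C" "\<forall>f\<in>C - {e}. q dvd lval x f"
  shows "q dvd lval x e"
proof -
  obtain vs es where w: "circle_walk vs es" "C = set es"
    and s0: "(\<Sum>k<length vs. dgain (es ! k) (vs ! k)) = 0"
    using assms(2) by (auto simp: balanced_circle_def)
  define s :: "nat \<Rightarrow> 'a" where "s k = (if vs ! k = fst (es ! k) then 1 else -1)" for k
  have len: "length es = length vs" "distinct es"
    using w(1) by (auto simp: circle_walk_def)
  obtain k where k: "k < length vs" "e = es ! k"
    using assms(3) w(2) len(1) by (metis in_set_conv_nth)
  have "(\<Sum>l<length vs. s l * lval x (es ! l)) = 0"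
    unfolding s_def using circle_walk_lval_sum[OF w(1), of x] E_ends_ne assms(1) w(2) s0 by auto
  then have "s k * lval x e = - (\<Sum>l\<in>{..<length vs} - {k}. s l * lval x (es ! l))"
    using k sum.remove[of "{..<length vs}" k "\<lambda>l. s l * lval x (es ! l)"]
    by (simp add: eq_neg_iff_add_eq_0)
  moreover have "q dvd (\<Sum>l\<in>{..<length vs} - {k}. s l * lval x (es ! l))"
  proof (rule dvd_sum)
    fix l assume l: "l \<in> {..<length vs} - {k}"
    then have "es ! l \<in> C - {e}"
      using len k w(2) by (auto simp: nth_eq_iff_index_eq)
    then show "q dvd s l * lval x (es ! l)"
      using assms(4) by simp
  qed
  ultimately have "q dvd s k * lval x e"
    by simp
  then show ?thesis
    by (auto simp: s_def split: if_splits)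
qed

text \<open>The hypothesis \<open>small\<close> says that q divides no nonzero integer in the range
  of circle gains: a circle has at most n edges, each of gain at most
  \<open>\<bar>a\<bar> + \<bar>b\<bar>\<close> in absolute value.\<close>

lemma circle_balanced_if_dvd:
  fixes q :: "'a :: comm_ring_1"
  assumes "C \<subseteq> E" "is_circle C" "\<forall>f\<in>C. q dvd lval x f"
    and small: "\<And>s :: int. q dvd of_int s \<Longrightarrow> \<bar>s\<bar> \<le> int n * (\<bar>a\<bar> + \<bar>b\<bar>) \<Longrightarrow> s = 0"
  shows "balanced_circle C"
proof -
  obtain vs es where w: "circle_walk vs es" "C = set es"
    using assms(2) by (auto simp: is_circle_def)
  let ?s = "\<Sum>k<length vs. dgain (es ! k) (vs ! k)"
  have len: "length es = length vs" "distinct vs"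
    using w(1) by (auto simp: circle_walk_def)
  have edge: "es ! k \<in> E" if "k < length vs" for k
    using that w(2) len(1) assms(1) by auto
  have "q dvd (\<Sum>k<length vs. (if vs ! k = fst (es ! k) then 1 else -1) * lval x (es ! k))"
    by (rule dvd_sum) (use assms(3) w(2) len(1) in auto)
  moreover have "(\<Sum>k<length vs. (if vs ! k = fst (es ! k) then 1 else -1) * lval x (es ! k)) = - of_int ?s"
    by (rule circle_walk_lval_sum[OF w(1)]) (use E_ends_ne assms(1) w(2) in blast)
  ultimately have "q dvd of_int ?s"
    by (simp only: dvd_minus_iff)
  moreover have "\<bar>?s\<bar> \<le> int n * (\<bar>a\<bar> + \<bar>b\<bar>)"
  proof -
    have "set vs \<subseteq> {1..n}"
    proof
      fix v assume "v \<in> set vs"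
      then obtain k where k: "k < length vs" "v = vs ! k"
        by (metis in_set_conv_nth)
      then have "v \<in> ends (es ! k)"
        using w(1) by (auto simp: circle_walk_def)
      then show "v \<in> {1..n}"
        using edge[OF k(1)] by (auto simp: ends_def gain_edges_def)
    qed
    then have "length vs \<le> n"
      using distinct_card[OF len(2)] card_mono[of "{1..n}" "set vs"] by simp
    have "\<bar>?s\<bar> \<le> (\<Sum>k<length vs. \<bar>dgain (es ! k) (vs ! k)\<bar>)"
      by (rule sum_abs)
    also have "\<dots> \<le> (\<Sum>k<length vs. \<bar>a\<bar> + \<bar>b\<bar>)"
    proof (rule sum_mono)
      fix k assume "k \<in> {..<length vs}"
      then have "a \<le> gain (es ! k)" "gain (es ! k) \<le> b"
        using edge[of k] by (auto simp: gain_def gain_edges_def)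
      then show "\<bar>dgain (es ! k) (vs ! k)\<bar> \<le> \<bar>a\<bar> + \<bar>b\<bar>"
        by (simp add: dgain_def)
    qed
    also have "\<dots> \<le> int n * (\<bar>a\<bar> + \<bar>b\<bar>)"
      using \<open>length vs \<le> n\<close> by (simp add: mult_right_mono)
    finally show ?thesis .
  qed
  ultimately have "?s = 0"
    by (rule small)
  then show ?thesis
    using w by (auto simp: balanced_circle_def)
qed

text \<open>The edges that hold at every point of \<open>Z\<close>. Colorings use it with a single
  point and the modulus q; the comparison of central sets uses a whole solution space over the reals
  with \<open>q = 0\<close>.\<close>

definition flat :: "'a :: comm_ring_1 \<Rightarrow> (nat \<Rightarrow> 'a) set \<Rightarrow> gedge set" where
  "flat q Z = {e \<in> E. \<forall>x\<in>Z. q dvd lval x e}"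

lemma nbc_alternating_flat:
  fixes q :: "'a :: comm_ring_1"
  assumes "Z \<noteq> {}"
    and small: "\<And>s :: int. q dvd of_int s \<Longrightarrow> \<bar>s\<bar> \<le> int n * (\<bar>a\<bar> + \<bar>b\<bar>) \<Longrightarrow> s = 0"
  shows "(\<Sum>F | nbc_set r n a b F \<and> F \<subseteq> flat q Z. (-1 :: int) ^ card F) =
         (if flat q Z = {} then 1 else 0)"
proof (cases "flat q Z = {}")
  case True
  then have "{F. nbc_set r n a b F \<and> F \<subseteq> flat q Z} = {{}}"
    using nbc_set_empty by auto
  then show ?thesis
    using True by simp
next
  case False
  obtain x where x: "x \<in> Z" using assms(1) by blast
  have "(\<Sum>F | nbc_set r n a b F \<and> F \<subseteq> flat q Z. (-1 :: int) ^ card F) = 0"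
  proof (rule nbc_alternating_zero)
    show "flat q Z \<subseteq> E" "flat q Z \<noteq> {}"
      using False by (auto simp: flat_def)
    show "balanced_circle C" if C: "C \<subseteq> flat q Z" "is_circle C" for C
    proof (rule circle_balanced_if_dvd[OF _ C(2) _ small])
      show "C \<subseteq> E" "\<forall>f\<in>C. q dvd lval x f"
        using C(1) x by (auto simp: flat_def)
    qed
    show "e \<in> flat q Z" if C: "C \<subseteq> E" "balanced_circle C" "e \<in> C" "C - {e} \<subseteq> flat q Z" for C e
    proof -
      have "q dvd lval y e" if "y \<in> Z" for y
        by (rule balanced_circle_lval_dvd[OF C(1-3)]) (use C(4) that in \<open>auto simp: flat_def\<close>)
      then show ?thesis
        using C by (auto simp: flat_def)
    qed
  qed
  then show ?thesis
    using False by simp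
qed

text \<open>Colorings modulo q up to translation: the coordinate at n is pinned to 0, so n - 1 of
  them are free.\<close>

definition box :: "int \<Rightarrow> (nat \<Rightarrow> int) set" where
  "box q = {x. \<forall>i. (i \<in> {1..<n} \<longrightarrow> x i \<in> {0..<q}) \<and> (i \<notin> {1..<n} \<longrightarrow> x i = 0)}"

definition sols :: "int \<Rightarrow> gedge set \<Rightarrow> (nat \<Rightarrow> int) set" where
  "sols q F = {x \<in> box q. \<forall>e\<in>F. q dvd lval x e}"

lemma finite_box [simp]: "finite (box q)"
  unfolding box_def by (rule finite_set_of_finite_funs) auto

lemma card_box: "card (box q) = nat q ^ (n - 1)"
proof -
  have "bij_betw (\<lambda>g i. if i \<in> {1..<n} then g i else 0) (PiE {1..<n} (\<lambda>_. {0..<q})) (box q)"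
    by (rule bij_betw_byWitness[where f' = "\<lambda>x. restrict x {1..<n}"])
      (auto simp: box_def fun_eq_iff PiE_def extensional_def)
  then have "card (box q) = card (PiE {1..<n} (\<lambda>_. {0..<q}))"
    by (rule bij_betw_same_card[symmetric])
  then show ?thesis
    by (simp add: card_PiE)
qed

lemma conn_verts:
  assumes "F \<subseteq> E" "(u, w) \<in> conn F" "u \<in> {1..n}"
  shows "w \<in> {1..n}"
proof -
  have "w \<in> {1..n}" if "e \<in> F" "ends e = {u, w}" for e u w
  proof -
    have "w \<in> ends e" "e \<in> E"
      using that assms(1) by auto
    then show ?thesis
      by (auto simp: ends_def gain_edges_def)
  qed
  then show ?thesis
    using conn_closed[OF assms(2,3)] by blast
qed

text \<open>A new forest edge joins two components of \<open>F\<close>. Translating one of them by t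
  modulo q preserves the equations of \<open>F\<close> and moves the value at the new edge through
  all residues, so the new equation selects one solution in q.\<close>

lemma card_sols:
  assumes q: "0 < q" and "F \<subseteq> E" "is_forest F"
  shows "card (sols q F) = nat q ^ (n - 1 - card F)"
proof -
  have "finite F"
    using assms finite_subset finite_gain_edges by blast
  then show ?thesis
    using assms(2,3)
  proof (induction F)
    case empty
    then show ?case
      by (simp add: sols_def card_box)
  next
    case (insert e F)
    obtain i j g where e: "e = (i, j, g)" by (cases e)
    have F: "is_forest F" "F \<subseteq> E" and eE: "(i, j, g) \<in> E"
      using insert.prems e by (auto intro: is_forest_mono)
    have nc: "(i, j) \<notin> conn F"
      using is_forest_insert[of F i j g] insert e F E_ne[OF eE] by auto
    \<comment> \<open>The translated component must avoid n, where the coordinate is fixed at 0. At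
      most one of the two components contains n, and \<epsilon> records the sign with which the
      value at \<open>e\<close> then changes.\<close>
    define C where "C = (if (i, n) \<in> conn F then conn F `` {j} else conn F `` {i})"
    define \<epsilon> :: int where "\<epsilon> = (if (i, n) \<in> conn F then 1 else -1)"
    have Cn: "n \<notin> C"
      unfolding C_def using nc by (auto dest: conn_sym conn_trans)
    have Cv: "C \<subseteq> {1..n}"
      unfolding C_def using conn_verts[OF F(2)] E_verts[OF eE] by auto
    have C1: "C \<subseteq> {1..<n}"
    proof
      fix v assume "v \<in> C"
      then have "v \<in> {1..n}" "v \<noteq> n"
        using Cv Cn by auto
      then show "v \<in> {1..<n}" by auto
    qed
    have CF: "i' \<in> C \<longleftrightarrow> j' \<in> C" if "(i', j', g') \<in> F" for i' j' g'
    proof -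
      have "(i', j') \<in> conn F"
        using that by (intro conn_edge[of "(i', j', g')"]) (auto simp: ends_def)
      then have "(v, i') \<in> conn F \<longleftrightarrow> (v, j') \<in> conn F" for v
        by (meson conn_sym conn_trans)
      then show ?thesis
        by (simp add: C_def)
    qed
    have Ce: "(if j \<in> C then 1 else 0) - (if i \<in> C then 1 else 0) = \<epsilon>"
      unfolding C_def \<epsilon>_def using nc conn_sym by auto
    define sh where "sh t x v = (if v \<in> C then (x v + t) mod q else x v)" for t :: int and x :: "nat \<Rightarrow> int" and v
    have sh_cong: "q dvd sh t x v - (x v + t * (if v \<in> C then 1 else 0))" for t x v
      by (auto simp: sh_def mod_eq_dvd_iff[symmetric])
    have sh_lval: "q dvd lval (sh t x) f - (lval x f + t *
        ((if fst (snd f) \<in> C then 1 else 0) - (if fst f \<in> C then 1 else 0)))" for t x f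
      using dvd_diff[OF sh_cong[of t x "fst (snd f)"] sh_cong[of t x "fst f"]]
      by (simp add: lval_def algebra_simps)
    have sh_F: "q dvd lval (sh t x) f \<longleftrightarrow> q dvd lval x f" if "f \<in> F" for t x f
    proof -
      have "fst (snd f) \<in> C \<longleftrightarrow> fst f \<in> C"
        using that CF by (cases f) auto
      then have "q dvd lval (sh t x) f - lval x f"
        using sh_lval[of t x f] by (auto split: if_splits)
      then show ?thesis
        by (metis dvd_add_right_iff diff_add_cancel)
    qed
    have sh_e: "q dvd lval (sh t x) e - (lval x e + \<epsilon> * t)" for t x
      using sh_lval[of t x e] Ce unfolding e by (simp add: mult.commute)
    have sh_box: "sh t x \<in> box q" if "x \<in> box q" for t x
      using that C1 q by (auto simp: box_def sh_def)
    have sh_inv: "sh (- t) (sh t x) = x" if "x \<in> box q" for t x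
    proof
      fix v
      have "x v \<in> {0..<q}" if "v \<in> C"
        using \<open>x \<in> box q\<close> that C1 by (auto simp: box_def)
      then show "sh (- t) (sh t x) v = x v"
        by (auto simp: sh_def mod_diff_left_eq)
    qed
    have sq: "\<epsilon> * \<epsilon> = 1" by (simp add: \<epsilon>_def)
    let ?T = "\<lambda>y. (\<epsilon> * lval y e) mod q"
    \<comment> \<open>The inverse reads off the translation as \<open>?T y\<close>, the residue by
      which \<open>y\<close> misses the equation of \<open>e\<close>, corrected by the sign
      \<epsilon>.\<close>
    have "bij_betw (\<lambda>(x, t). sh t x) (sols q (insert e F) \<times> {0..<q}) (sols q F)"
    proof (rule bij_betw_byWitness[where f' = "\<lambda>y. (sh (- ?T y) y, ?T y)"])
      show "\<forall>p\<in>sols q (insert e F) \<times> {0..<q}.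
          (\<lambda>y. (sh (- ?T y) y, ?T y)) ((\<lambda>(x, t). sh t x) p) = p"
      proof
        fix p assume "p \<in> sols q (insert e F) \<times> {0..<q}"
        then obtain x t where p: "p = (x, t)" and x: "x \<in> sols q (insert e F)" and t: "t \<in> {0..<q}"
          by blast
        have "q dvd lval (sh t x) e - \<epsilon> * t"
          using dvd_add[OF sh_e[of t x], of "lval x e"] x by (simp add: sols_def)
        then have "q dvd \<epsilon> * (lval (sh t x) e - \<epsilon> * t)"
          by simp
        also have "\<epsilon> * (lval (sh t x) e - \<epsilon> * t) = \<epsilon> * lval (sh t x) e - t"
          using sq by (simp add: algebra_simps flip: mult.assoc)
        finally have "?T (sh t x) = t"
          using t by (simp add: mod_eq_dvd_iff[symmetric])
        then show "(\<lambda>y. (sh (- ?T y) y, ?T y)) ((\<lambda>(x, t). sh t x) p) = p"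
          using sh_inv[of x t] x by (simp add: sols_def p)
      qed
      show "\<forall>y\<in>sols q F. (\<lambda>(x, t). sh t x) ((\<lambda>y. (sh (- ?T y) y, ?T y)) y) = y"
        using sh_inv[of _ "- ?T _"] by (auto simp: sols_def)
      show "(\<lambda>(x, t). sh t x) ` (sols q (insert e F) \<times> {0..<q}) \<subseteq> sols q F"
        using sh_box sh_F by (auto simp: sols_def)
      show "(\<lambda>y. (sh (- ?T y) y, ?T y)) ` sols q F \<subseteq> sols q (insert e F) \<times> {0..<q}"
      proof (rule image_subsetI)
        fix y assume y: "y \<in> sols q F"
        have "q dvd \<epsilon> * lval y e - ?T y"
          by (simp add: minus_mod_eq_mult_div)
        then have "q dvd \<epsilon> * (\<epsilon> * lval y e - ?T y)"
          by simp
        also have "\<epsilon> * (\<epsilon> * lval y e - ?T y) = lval y e + \<epsilon> * (- ?T y)"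
          using sq by (simp add: algebra_simps flip: mult.assoc)
        finally have "q dvd lval y e + \<epsilon> * (- ?T y)" .
        then have "q dvd lval (sh (- ?T y) y) e"
          using sh_e[of "- ?T y" y] by (metis dvd_add_right_iff diff_add_cancel)
        then have "sh (- ?T y) y \<in> sols q (insert e F)"
          using y sh_box[of y] sh_F[of _ "- ?T y" y] by (auto simp: sols_def)
        then show "(sh (- ?T y) y, ?T y) \<in> sols q (insert e F) \<times> {0..<q}"
          using q by simp
      qed
    qed
    then have "card (sols q (insert e F)) * nat q = card (sols q F)"
      by (metis bij_betw_same_card card_cartesian_product card_atLeastLessThan_int diff_zero)
    also have "\<dots> = nat q ^ (n - 1 - card F)"
      using insert F by simp
    also have "n - 1 - card F = Suc (n - 1 - card (insert e F))"
    proof -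
      have "card (comps n (insert e F)) \<ge> 1"
        using n2 by (simp add: Suc_le_eq card_gt_0_iff comps_def)
      then have "card (insert e F) \<le> n - 1"
        using forest_card_comps[OF insert.prems] by linarith
      then show ?thesis
        using insert.hyps by simp
    qed
    finally show ?case
      using q by simp
  qed
qed

text \<open>The finite field method; q need not be prime, only so large that a circle which is
  balanced modulo q is balanced.\<close>

theorem proper_count_nbc:
  assumes q: "int n * (\<bar>a\<bar> + \<bar>b\<bar>) < q"
  shows "int (card {x \<in> box q. \<forall>e\<in>E. \<not> q dvd lval x e}) =
         (\<Sum>F | nbc_set r n a b F. (-1) ^ card F * q ^ (n - 1 - card F))"
proof -
  have q0: "0 < q"
    using q by (smt (verit) mult_nonneg_nonneg of_nat_0_le_iff)
  have small: "s = 0" if "q dvd of_int s" "\<bar>s\<bar> \<le> int n * (\<bar>a\<bar> + \<bar>b\<bar>)" for s :: int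
    using that q zdvd_imp_le[of q "\<bar>s\<bar>"] by (cases "s = 0") auto
  have "int (card {x \<in> box q. \<forall>e\<in>E. \<not> q dvd lval x e}) =
      (\<Sum>x\<in>box q. if \<forall>e\<in>E. \<not> q dvd lval x e then 1 else 0)"
    by (simp add: sum.If_cases Collect_conj_eq)
  \<comment> \<open>The indicator of a proper coloring becomes the alternating sum over NBC subsets
    of its flat; after exchanging the sums, the inner count is the number of solutions of a
    forest.\<close>
  also have "\<dots> = (\<Sum>x\<in>box q. \<Sum>F | nbc_set r n a b F \<and> F \<subseteq> flat q {x}. (-1) ^ card F)"
  proof (rule sum.cong[OF refl])
    fix x
    have "flat q {x} = {} \<longleftrightarrow> (\<forall>e\<in>E. \<not> q dvd lval x e)"
      by (auto simp: flat_def)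
    moreover have "(\<Sum>F | nbc_set r n a b F \<and> F \<subseteq> flat q {x}. (-1 :: int) ^ card F) =
        (if flat q {x} = {} then 1 else 0)"
      by (rule nbc_alternating_flat) (use small in auto)
    ultimately show "(if \<forall>e\<in>E. \<not> q dvd lval x e then 1 else 0) =
        (\<Sum>F | nbc_set r n a b F \<and> F \<subseteq> flat q {x}. (-1 :: int) ^ card F)"
      by presburger
  qed
  also have "\<dots> = (\<Sum>F | nbc_set r n a b F. \<Sum>x | x \<in> box q \<and> F \<subseteq> flat q {x}. (-1) ^ card F)"
    using sum.swap_restrict[of "box q" "{F. nbc_set r n a b F}" "\<lambda>x F. (-1 :: int) ^ card F"
        "\<lambda>x F. F \<subseteq> flat q {x}"] by simp
  also have "\<dots> = (\<Sum>F | nbc_set r n a b F. (-1) ^ card F * q ^ (n - 1 - card F))"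
  proof (rule sum.cong[OF refl])
    fix F assume "F \<in> {F. nbc_set r n a b F}"
    then have F: "F \<subseteq> E" "is_forest F" by (auto simp: nbc_set_def)
    have "{x. x \<in> box q \<and> F \<subseteq> flat q {x}} = sols q F"
      using F(1) by (auto simp: sols_def flat_def)
    then show "(\<Sum>x | x \<in> box q \<and> F \<subseteq> flat q {x}. (-1) ^ card F) =
        (-1) ^ card F * q ^ (n - 1 - card F)"
      using card_sols[OF q0 F] q0 by simp
  qed
  finally show ?thesis .
qed

text \<open>The sign \<open>(-1) ^ (n - 1)\<close> turns each term into a power of -q, so the
  activity expansion applies with y = -q and produces 1 - q.\<close>

corollary proper_count_activity:
  assumes q: "int n * (\<bar>a\<bar> + \<bar>b\<bar>) < q"
  shows "(-1) ^ (n - 1) * int (card {x \<in> box q. \<forall>e\<in>E. \<not> q dvd lval x e}) =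
         (\<Sum>B | nbc_basis r n a b B. (1 - q) ^ activity r n a b B)"
proof -
  have "(-1) ^ (n - 1) * ((-1) ^ card F * q ^ (n - 1 - card F)) = (- q) ^ (n - 1 - card F)"
    if "F \<in> {F. nbc_set r n a b F}" for F
  proof -
    have "F \<subseteq> E" "is_forest F" using that by (auto simp: nbc_set_def)
    from forest_card_comps[OF this] have "card F + card (comps n F) = n" .
    moreover have "card (comps n F) \<ge> 1"
      using n2 by (simp add: Suc_le_eq card_gt_0_iff comps_def)
    ultimately obtain k where k: "n - 1 = card F + k" "n - 1 - card F = k"
      by (metis add_diff_cancel_left' le_Suc_ex Nat.add_diff_assoc)
    have "(-1 :: int) ^ (n - 1) * (-1) ^ card F = (-1) ^ k"
      unfolding k(1) by (simp add: power_add flip: power_mult_distrib)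
    then show ?thesis
      unfolding k(2) by (metis (no_types) mult.assoc power_minus)
  qed
  then have "(-1) ^ (n - 1) * int (card {x \<in> box q. \<forall>e\<in>E. \<not> q dvd lval x e}) =
      (\<Sum>F | nbc_set r n a b F. (- q) ^ (n - 1 - card F))"
    unfolding proper_count_nbc[OF q] sum_distrib_left by (rule sum.cong[OF refl])
  then show ?thesis
    using nbc_sets_sum_activity[of "- q"] by simp
qed

end

section \<open>Permutations by ascents\<close>

fun asc :: "nat list \<Rightarrow> nat" where
  "asc [] = 0"
| "asc [u] = 0"
| "asc (u # v # w) = (if u < v then 1 else 0) + asc (v # w)"

definition arr :: "nat \<Rightarrow> nat list set" where
  "arr m = {w. distinct w \<and> set w = {1..m}}"

lemma finite_arr [simp]: "finite (arr m)"
  by (rule finite_subset[OF _ finite_subset_distinct[of "{1..m}"]]) (auto simp: arr_def)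

lemma length_arr: "w \<in> arr m \<Longrightarrow> length w = m"
  using distinct_card[of w] by (simp add: arr_def)

lemma asc_le: "asc w \<le> length w - 1"
  by (induction w rule: asc.induct) auto

text \<open>Inserting a maximum in front, or inside an ascent, keeps the number of ascents; inside a
  descent, or at the end, it adds one. Keeping \<open>h\<close> arbitrary gives the Eulerian
  recursion for any weight.\<close>

lemma sum_asc_insert_max:
  fixes h :: "nat \<Rightarrow> real"
  assumes "\<forall>u\<in>set w. u < N"
  shows "(\<Sum>p\<le>length w. h (asc (take p w @ N # drop p w))) =
         (real (asc w) + 1) * h (asc w) + (real (length w) - real (asc w)) * h (asc w + 1)"
  using assms
proof (induction w arbitrary: h rule: asc.induct)
  case (3 u v w)
  let ?i = "\<lambda>p. take p (v # w) @ N # drop p (v # w)"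
  define h' where "h' c = h ((if u < v then 1 else 0) + c)" for c
  have tail: "asc (u # ?i (Suc p)) = (if u < v then 1 else 0) + asc (?i (Suc p))" for p
    by simp
  have IH: "(\<Sum>p\<le>length (v # w). h' (asc (?i p))) =
      (real (asc (v # w)) + 1) * h' (asc (v # w)) +
      (real (length (v # w)) - real (asc (v # w))) * h' (asc (v # w) + 1)"
    using 3 by (intro "3.IH") auto
  have "N > u" "N > v" using 3 by auto
  have "(\<Sum>p\<le>length (u # v # w). h (asc (take p (u # v # w) @ N # drop p (u # v # w)))) =
      h (asc (N # u # v # w)) + (\<Sum>p\<le>length (v # w). h (asc (u # ?i p)))"
    by (simp add: sum.atMost_Suc_shift del: sum.atMost_Suc asc.simps)
  also have "(\<Sum>p\<le>length (v # w). h (asc (u # ?i p))) =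
      h (asc (u # ?i 0)) + (\<Sum>p\<le>length w. h (asc (u # ?i (Suc p))))"
    by (simp add: sum.atMost_Suc_shift del: sum.atMost_Suc asc.simps)
  also have "(\<Sum>p\<le>length w. h (asc (u # ?i (Suc p)))) = (\<Sum>p\<le>length w. h' (asc (?i (Suc p))))"
    by (simp only: tail h'_def)
  also have "(\<Sum>p\<le>length w. h' (asc (?i (Suc p)))) =
      (\<Sum>p\<le>length (v # w). h' (asc (?i p))) - h' (asc (?i 0))"
    by (simp add: sum.atMost_Suc_shift del: sum.atMost_Suc asc.simps)
  finally show ?case
    unfolding IH using \<open>N > u\<close> \<open>N > v\<close>
    by (auto simp: h'_def algebra_simps)
qed auto

lemma bij_betw_insert_max:
  "bij_betw (\<lambda>(w, p). take p w @ Suc m # drop p w) (arr m \<times> {..m}) (arr (Suc m))"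
proof -
  let ?dn = "\<lambda>w. (remove1 (Suc m) w, length (takeWhile (\<lambda>u. u \<noteq> Suc m) w))"
  let ?up = "\<lambda>(w, p). take p w @ Suc m # drop p w"
  have take_ne: "x \<noteq> Suc m" if "w \<in> arr m" "x \<in> set (take p w)" for w p x
    using that by (auto simp: arr_def dest!: in_set_takeD)
  show ?thesis
  proof (rule bij_betw_byWitness[where f' = ?dn])
    show "\<forall>wp\<in>arr m \<times> {..m}. ?dn (?up wp) = wp"
    proof
      fix wp assume "wp \<in> arr m \<times> {..m}"
      then obtain w p where wp: "wp = (w, p)" "w \<in> arr m" "p \<le> m" by auto
      have "Suc m \<notin> set (take p w)" using take_ne[OF wp(2)] by blast
      moreover have "takeWhile (\<lambda>u. u \<noteq> Suc m) (take p w @ Suc m # drop p w) = take p w"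
        using take_ne[OF wp(2)] by (subst takeWhile_append2) auto
      ultimately show "?dn (?up wp) = wp"
        using wp length_arr[OF wp(2)] by (simp add: remove1_append)
    qed
    show "\<forall>w\<in>arr (Suc m). ?up (?dn w) = w"
    proof
      fix w assume w: "w \<in> arr (Suc m)"
      then have "Suc m \<in> set w" by (auto simp: arr_def)
      then obtain ys zs where s: "w = ys @ Suc m # zs" "Suc m \<notin> set ys"
        by (meson split_list_first)
      then have "takeWhile (\<lambda>u. u \<noteq> Suc m) w = ys"
        unfolding s(1) using s(2) by (subst takeWhile_append2) auto
      then show "?up (?dn w) = w"
        using s by (simp add: remove1_append)
    qed
    show "?up ` (arr m \<times> {..m}) \<subseteq> arr (Suc m)"
    proof (rule image_subsetI)
      fix wp assume "wp \<in> arr m \<times> {..m}"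
      then obtain w p where wp: "wp = (w, p)" "w \<in> arr m" by auto
      have d: "distinct (take p w @ drop p w)" and s: "set (take p w @ drop p w) = {1..m}"
        using wp(2) unfolding arr_def by (simp_all only: append_take_drop_id mem_Collect_eq)
      have "Suc m \<notin> set (take p w @ drop p w)"
        unfolding s by simp
      with d have "distinct (take p w @ Suc m # drop p w)"
        by (simp del: append_take_drop_id)
      moreover have "set (take p w @ Suc m # drop p w) = insert (Suc m) (set (take p w @ drop p w))"
        by (simp del: append_take_drop_id)
      then have "set (take p w @ Suc m # drop p w) = {1..Suc m}"
        unfolding s by (simp add: atLeastAtMostSuc_conv)
      ultimately show "?up wp \<in> arr (Suc m)"
        by (simp add: wp(1) arr_def del: set_append)
    qed
    show "?dn ` arr (Suc m) \<subseteq> arr m \<times> {..m}"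
    proof (rule image_subsetI)
      fix w assume w: "w \<in> arr (Suc m)"
      have "{1..Suc m} - {Suc m} = {1..m}" by auto
      then have "remove1 (Suc m) w \<in> arr m"
        using w by (simp add: arr_def)
      moreover have "length (takeWhile (\<lambda>u. u \<noteq> Suc m) w) < length w"
      proof -
        have "Suc m \<in> set w" using w by (simp add: arr_def)
        then obtain ys zs where s: "w = ys @ Suc m # zs" "Suc m \<notin> set ys"
          by (meson split_list_first)
        have "takeWhile (\<lambda>u. u \<noteq> Suc m) w = ys"
          unfolding s(1) using s(2) by (subst takeWhile_append2) auto
        then show ?thesis by (simp add: s(1))
      qed
      ultimately show "(remove1 (Suc m) w, length (takeWhile (\<lambda>u. u \<noteq> Suc m) w)) \<in> arr m \<times> {..m}"
        using length_arr[OF w] by simp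
    qed
  qed
qed

lemma sum_asc_arr_Suc:
  fixes h :: "nat \<Rightarrow> real"
  shows "(\<Sum>w\<in>arr (Suc m). h (asc w)) =
         (\<Sum>w\<in>arr m. (real (asc w) + 1) * h (asc w) + (real m - real (asc w)) * h (asc w + 1))"
proof -
  have "(\<Sum>w\<in>arr (Suc m). h (asc w)) =
      (\<Sum>(w, p)\<in>arr m \<times> {..m}. h (asc (take p w @ Suc m # drop p w)))"
    by (subst sum.reindex_bij_betw[OF bij_betw_insert_max, symmetric]) (simp add: case_prod_beta)
  also have "\<dots> = (\<Sum>w\<in>arr m. \<Sum>p\<le>m. h (asc (take p w @ Suc m # drop p w)))"
    by (simp add: sum.cartesian_product)
  also have "\<dots> = (\<Sum>w\<in>arr m. (real (asc w) + 1) * h (asc w) + (real m - real (asc w)) * h (asc w + 1))"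
  proof (rule sum.cong[OF refl])
    fix w assume w: "w \<in> arr m"
    have "\<forall>u\<in>set w. u < Suc m" using w by (auto simp: arr_def)
    from sum_asc_insert_max[OF this, of h]
    show "(\<Sum>p\<le>m. h (asc (take p w @ Suc m # drop p w))) =
        (real (asc w) + 1) * h (asc w) + (real m - real (asc w)) * h (asc w + 1)"
      by (simp add: length_arr[OF w])
  qed
  finally show ?thesis .
qed

text \<open>Equivalently, the number of ordered set partitions of [m] into m - j blocks.\<close>

definition marked_asc :: "nat \<Rightarrow> nat \<Rightarrow> real" where
  "marked_asc m j = (\<Sum>w\<in>arr m. real (asc w choose j))"

lemma marked_asc_0: "marked_asc 0 j = (if j = 0 then 1 else 0)"
proof -
  have "arr 0 = {[]}" by (auto simp: arr_def)
  then show ?thesis by (simp add: marked_asc_def)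
qed

lemma marked_asc_Suc_0: "marked_asc (Suc m) 0 = (real m + 1) * marked_asc m 0"
  unfolding marked_asc_def
  by (subst sum_asc_arr_Suc[of "\<lambda>c. real (c choose 0)"]) (simp add: sum_distrib_left)

text \<open>For ordered set partitions into m - j blocks this is the usual recursion: the element m
  + 1 joins one of m - j blocks, or forms a block of its own at one of m - j positions. Marking an
  ascent glues its two letters into one block.\<close>

lemma marked_asc_Suc_Suc:
  "marked_asc (Suc m) (Suc j) = (real m - real j) * (marked_asc m (Suc j) + marked_asc m j)"
proof -
  have step: "(real c + 1) * real (c choose Suc j) + (real m - real c) * real ((c + 1) choose Suc j) =
      (real m - real j) * (real (c choose Suc j) + real (c choose j))" for c
  proof -
    have "real (Suc j * (c choose Suc j) + j * (c choose j)) = real (c * (c choose j))"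
    proof (cases "j \<le> c")
      case True
      have "Suc j * (c choose Suc j) = (c - j) * (c choose j)"
        by (simp only: binomial_absorb_comp binomial_absorption)
      then show ?thesis
        using True by (simp only:) (simp add: of_nat_diff algebra_simps)
    qed (simp add: binomial_eq_0)
    then show ?thesis
      by (simp add: algebra_simps)
  qed
  show ?thesis
    unfolding marked_asc_def
    by (subst sum_asc_arr_Suc[of "\<lambda>c. real (c choose Suc j)"])
      (simp only: step sum_distrib_left[symmetric] sum.distrib)
qed

lemma marked_asc_eq_0: "m < j \<Longrightarrow> marked_asc m j = 0"
proof -
  assume "m < j"
  have "real (asc w choose j) = 0" if "w \<in> arr m" for w
    using asc_le[of w] length_arr[OF that] \<open>m < j\<close> by (simp add: binomial_eq_0)
  then show ?thesis
    unfolding marked_asc_def by (intro sum.neutral) blast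
qed

section \<open>The signed sum over vertex choices\<close>

text \<open>With S the shift z + 1 and W a formal commuting symbol, this is the coefficient of W^l
  when the operator z (S + W (1 - S)) is applied m times to 1. One such factor arises from each
  vertex.\<close>

fun theta :: "nat \<Rightarrow> nat \<Rightarrow> real \<Rightarrow> real" where
  "theta 0 l z = (if l = 0 then 1 else 0)"
| "theta (Suc m) 0 z = z * theta m 0 (z + 1)"
| "theta (Suc m) (Suc l) z = z * theta m (Suc l) (z + 1) + z * (theta m l z - theta m l (z + 1))"

lemma theta_eq_0: "m < l \<Longrightarrow> theta m l z = 0"
  by (induction m l z rule: theta.induct) auto

text \<open>The binomial is the rising factorial of z of length m - l divided by (m - l)!. Its
  difference under z + 1 is given by Pascal's rule and the factor z is taken in by absorption, so
  the coefficients obey the recursion of ordered set partitions.\<close>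

lemma theta_eq:
  "theta m l z = (-1) ^ l * marked_asc m l * ((z + real m - real l - 1) gchoose (m - l))"
proof (induction m l z rule: theta.induct)
  case (1 l z)
  then show ?case by (simp add: marked_asc_0)
next
  case (2 m z)
  have "z * ((z + real m) gchoose m) = (real m + 1) * ((z + real m) gchoose Suc m)"
    using gbinomial_mult_1[of "z + real m" m] by (simp add: algebra_simps)
  moreover have "theta (Suc m) 0 z = marked_asc m 0 * (z * ((z + real m) gchoose m))"
    using 2 by (simp add: algebra_simps)
  ultimately show ?case
    by (simp add: marked_asc_Suc_0 algebra_simps)
next
  case (3 m l z)
  show ?case
  \<comment> \<open>The degenerate range, where \<open>m - l\<close> is truncated to 0. For m = l
    the binomial is the constant 1, so the difference vanishes; for m < l all terms are 0.\<close>
  proof (cases "m \<le> l")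
    case True
    have "theta m l z = theta m l (z + 1)"
    proof (cases "m = l")
      case True
      show ?thesis
        using "3.IH"(2,3) by (simp only: True diff_self_eq_0 gbinomial_0)
    qed (use True in \<open>simp add: theta_eq_0\<close>)
    moreover have "theta m (Suc l) (z + 1) = 0"
      using True by (simp add: theta_eq_0)
    moreover have "marked_asc (Suc m) (Suc l) = 0"
      using True marked_asc_eq_0[of m l] by (cases "m = l") (simp_all add: marked_asc_Suc_Suc marked_asc_eq_0)
    ultimately show ?thesis by simp
  next
    case False
    then obtain d where d: "m = Suc (l + d)"
      by (metis less_iff_Suc_add not_le)
    have pascal: "((z + real d + 1) gchoose Suc d) - ((z + real d) gchoose Suc d) = ((z + real d) gchoose d)"
      using gbinomial_Suc_Suc[of "z + real d" d] by simp
    have absorb: "z * ((z + real d) gchoose d) = (real d + 1) * ((z + real d) gchoose Suc d)"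
      using gbinomial_mult_1[of "z + real d" d] by (simp add: algebra_simps)
    have IH: "theta m l z = (-1) ^ l * marked_asc m l * ((z + real d) gchoose Suc d)"
      "theta m l (z + 1) = (-1) ^ l * marked_asc m l * ((z + real d + 1) gchoose Suc d)"
      "theta m (Suc l) (z + 1) = (-1) ^ Suc l * marked_asc m (Suc l) * ((z + real d) gchoose d)"
    proof -
      have eqs: "z + real m - real l - 1 = z + real d" "z + 1 + real m - real l - 1 = z + real d + 1"
        "z + 1 + real m - real (Suc l) - 1 = z + real d" "m - l = Suc d" "m - Suc l = d"
        by (simp_all add: d)
      show "theta m l z = (-1) ^ l * marked_asc m l * ((z + real d) gchoose Suc d)"
        "theta m l (z + 1) = (-1) ^ l * marked_asc m l * ((z + real d + 1) gchoose Suc d)"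
        "theta m (Suc l) (z + 1) = (-1) ^ Suc l * marked_asc m (Suc l) * ((z + real d) gchoose d)"
        using "3.IH" unfolding eqs by simp_all
    qed
    have "theta (Suc m) (Suc l) z =
        z * ((-1) ^ Suc l * marked_asc m (Suc l) * ((z + real d) gchoose d)) +
        z * ((-1) ^ l * marked_asc m l *
          (((z + real d) gchoose Suc d) - ((z + real d + 1) gchoose Suc d)))"
      by (simp only: theta.simps IH right_diff_distrib)
    also have "\<dots> = (-1) ^ Suc l * (marked_asc m (Suc l) + marked_asc m l) * (z * ((z + real d) gchoose d))"
      unfolding pascal[symmetric] by (simp add: algebra_simps)
    also have "\<dots> = (-1) ^ Suc l * marked_asc (Suc m) (Suc l) * ((z + real d) gchoose Suc d)"
      unfolding absorb marked_asc_Suc_Suc d by (simp add: algebra_simps)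
    finally show ?thesis
      by (simp add: d algebra_simps)
  qed
qed

section \<open>The operator W and its powers\<close>

primrec wsum :: "nat \<Rightarrow> nat \<Rightarrow> (real \<Rightarrow> real) \<Rightarrow> real \<Rightarrow> real" where
  "wsum K 0 g z = g z"
| "wsum K (Suc l) g z = (\<Sum>j\<le>K. wsum K l g (z - real j))"

lemma wsum_add: "wsum K l (\<lambda>z. f z + g z) z = wsum K l f z + wsum K l g z"
  by (induction l arbitrary: z) (simp_all add: sum.distrib)

lemma wsum_diff: "wsum K l (\<lambda>z. f z - g z) z = wsum K l f z - wsum K l g z"
  by (induction l arbitrary: z) (simp_all add: sum_subtractf)

lemma wsum_cmult: "wsum K l (\<lambda>z. c * g z) z = c * wsum K l g z"
  by (induction l arbitrary: z) (simp_all add: sum_distrib_left)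

lemma wsum_shift: "wsum K l (\<lambda>z. g (z - c)) z = wsum K l g (z - c)"
  by (induction l arbitrary: z) (simp_all add: algebra_simps)

lemma wsum_sum: "finite I \<Longrightarrow> wsum K l (\<lambda>z. \<Sum>i\<in>I. g i z) z = (\<Sum>i\<in>I. wsum K l (g i) z)"
proof (induction I rule: finite_induct)
  case empty
  then show ?case by (induction l arbitrary: z) simp_all
qed (simp add: wsum_add)

lemma wsum_zero [simp]: "wsum K l (\<lambda>z. 0) z = 0"
  by (induction l arbitrary: z) simp_all

text \<open>The index set of an inclusion-exclusion over the least color at a vertex, with a flag
  for excluding smaller children. The pair (0,1) is absent because colors above K carry no
  demand.\<close>

definition choices :: "nat \<Rightarrow> (nat \<times> nat) set" where
  "choices K = {0..K} \<times> {0} \<union> {1..K} \<times> {1}"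

lemma finite_choices [simp]: "finite (choices K)"
  by (simp add: choices_def)

text \<open>The absent pair (0,1) is added and subtracted so that both flags run over the full range
  from 0 to K, which is what makes W appear.\<close>

lemma sum_choices:
  fixes \<phi> :: "nat \<Rightarrow> nat \<Rightarrow> real"
  shows "(\<Sum>(j, e)\<in>choices K. (-1) ^ e * \<phi> j e) = (\<Sum>j\<le>K. \<phi> j 0 - \<phi> j 1) + \<phi> 0 1"
proof -
  have "(\<Sum>(j, e)\<in>choices K. (-1) ^ e * \<phi> j e) =
      (\<Sum>(j, e)\<in>{0..K} \<times> {0}. (-1) ^ e * \<phi> j e) + (\<Sum>(j, e)\<in>{1..K} \<times> {1}. (-1) ^ e * \<phi> j e)"
    unfolding choices_def by (rule sum.union_disjoint) auto
  also have "\<dots> = (\<Sum>j\<in>{0..K}. \<phi> j 0) - (\<Sum>j\<in>{1..K}. \<phi> j 1)"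
    by (simp add: sum.cartesian_product[symmetric] sum_negf)
  also have "(\<Sum>j\<in>{0..K}. \<phi> j 1) = \<phi> 0 1 + (\<Sum>j\<in>{1..K}. \<phi> j 1)"
    by (simp add: sum.atLeast_Suc_atMost)
  then have "(\<Sum>j\<in>{1..K}. \<phi> j 1) = (\<Sum>j\<in>{0..K}. \<phi> j 1) - \<phi> 0 1"
    by simp
  finally show ?thesis
    by (simp add: sum_subtractf atMost_atLeast0)
qed

text \<open>The parameters \<psi> and y make the sum recursive. Removing the last vertex leaves its
  factor z + y, which is absorbed into \<psi>, and its flag is added to y because every earlier
  factor counts it.\<close>

definition choice_sum :: "nat \<Rightarrow> nat \<Rightarrow> (real \<Rightarrow> real) \<Rightarrow> real \<Rightarrow> real \<Rightarrow> real" where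
  "choice_sum K m \<psi> y R = (\<Sum>\<kappa>\<in>PiE {1..m} (\<lambda>_. choices K).
     (\<Prod>u\<in>{1..m}. (-1) ^ snd (\<kappa> u)) * \<psi> (R - (\<Sum>u\<in>{1..m}. real (fst (\<kappa> u)))) *
     (\<Prod>i\<in>{1..m}. R - (\<Sum>u\<in>{1..m}. real (fst (\<kappa> u))) + y + (\<Sum>u\<in>{i<..m}. real (snd (\<kappa> u)))))"

lemma choice_sum_0: "choice_sum K 0 \<psi> y R = \<psi> R"
  by (simp add: choice_sum_def)

lemma choice_sum_Suc:
  "choice_sum K (Suc m) \<psi> y R =
   (\<Sum>(j, e)\<in>choices K. (-1) ^ e * choice_sum K m (\<lambda>z. \<psi> z * (z + y)) (y + real e) (R - real j))"
proof -
  let ?Ks = "PiE {1..m} (\<lambda>_. choices K)"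
  let ?f = "\<lambda>m \<psi> y R \<kappa>. (\<Prod>u\<in>{1..m}. (-1) ^ snd (\<kappa> u)) * \<psi> (R - (\<Sum>u\<in>{1..m}. real (fst (\<kappa> u)))) *
     (\<Prod>i\<in>{1..m}. R - (\<Sum>u\<in>{1..m}. real (fst (\<kappa> u))) + y + (\<Sum>u\<in>{i<..m}. real (snd (\<kappa> u))))"
  have ins: "{1..Suc m} = insert (Suc m) {1..m}" by auto
  have step: "?f (Suc m) \<psi> y R (\<kappa>(Suc m := (j, e))) =
      (-1) ^ e * ?f m (\<lambda>z. \<psi> z * (z + y)) (y + real e) (R - real j) \<kappa>"
    if \<kappa>: "\<kappa> \<in> ?Ks" for \<kappa> j e
  proof -
    let ?c = "\<kappa>(Suc m := (j, e))"
    have a: "(\<Prod>u\<in>{1..Suc m}. (-1 :: real) ^ snd (?c u)) = (-1) ^ e * (\<Prod>u\<in>{1..m}. (-1) ^ snd (\<kappa> u))"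
      unfolding ins by simp
    have b: "(\<Sum>u\<in>{1..Suc m}. real (fst (?c u))) = real j + (\<Sum>u\<in>{1..m}. real (fst (\<kappa> u)))"
      unfolding ins by simp
    define Z where "Z = R - real j - (\<Sum>u\<in>{1..m}. real (fst (\<kappa> u)))"
    have c: "(\<Sum>u\<in>{i<..Suc m}. real (snd (?c u))) = real e + (\<Sum>u\<in>{i<..m}. real (snd (\<kappa> u)))"
      if "i \<in> {1..m}" for i
    proof -
      have "{i<..Suc m} = insert (Suc m) {i<..m}" using that by auto
      then show ?thesis by simp
    qed
    have "(\<Prod>i\<in>{1..Suc m}. Z + y + (\<Sum>u\<in>{i<..Suc m}. real (snd (?c u)))) =
        (Z + y) * (\<Prod>i\<in>{1..m}. Z + y + (\<Sum>u\<in>{i<..Suc m}. real (snd (?c u))))"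
      unfolding ins by simp
    also have "(\<Prod>i\<in>{1..m}. Z + y + (\<Sum>u\<in>{i<..Suc m}. real (snd (?c u)))) =
        (\<Prod>i\<in>{1..m}. Z + (y + real e) + (\<Sum>u\<in>{i<..m}. real (snd (\<kappa> u))))"
      by (rule prod.cong[OF refl], subst c) simp_all
    finally have d: "(\<Prod>i\<in>{1..Suc m}. Z + y + (\<Sum>u\<in>{i<..Suc m}. real (snd (?c u)))) =
        (Z + y) * (\<Prod>i\<in>{1..m}. Z + (y + real e) + (\<Sum>u\<in>{i<..m}. real (snd (\<kappa> u))))" .
    have Z: "R - (real j + (\<Sum>u\<in>{1..m}. real (fst (\<kappa> u)))) = Z"
      by (simp add: Z_def)
    show ?thesis
      unfolding a b Z d Z_def[symmetric] by (simp add: algebra_simps)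
  qed
  have inj: "inj_on (\<lambda>(p, \<kappa>). \<kappa>(Suc m := p)) (choices K \<times> ?Ks)"
    using inj_combinator[of "Suc m" "{1..m}" "\<lambda>_. choices K"] by simp
  have "choice_sum K (Suc m) \<psi> y R =
      (\<Sum>\<kappa>\<in>(\<lambda>(p, \<kappa>). \<kappa>(Suc m := p)) ` (choices K \<times> ?Ks). ?f (Suc m) \<psi> y R \<kappa>)"
    unfolding choice_sum_def ins PiE_insert_eq by simp
  also have "\<dots> = (\<Sum>p\<in>choices K. \<Sum>\<kappa>\<in>?Ks. ?f (Suc m) \<psi> y R (\<kappa>(Suc m := p)))"
    by (subst sum.reindex[OF inj]) (simp add: sum.cartesian_product case_prod_beta)
  also have "\<dots> = (\<Sum>(j, e)\<in>choices K. (-1) ^ e * choice_sum K m (\<lambda>z. \<psi> z * (z + y)) (y + real e) (R - real j))"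
    unfolding choice_sum_def sum_distrib_left
    by (rule sum.cong[OF refl], clarify, rule sum.cong[OF refl], rule step)
  finally show ?thesis .
qed

text \<open>With W g (z) the sum of g (z - j) over j from 0 to K, the choices at a vertex act as W when e = 0
  and as 1 - W followed by a unit shift when e = 1; \<open>theta m l\<close> collects the coefficient of the
  l-th power of W.\<close>

lemma choice_sum_eq:
  "choice_sum K m \<psi> y R = (\<Sum>l\<le>m. wsum K l (\<lambda>z. \<psi> z * theta m l (z + y)) R)"
proof (induction m arbitrary: \<psi> y R)
  case 0
  then show ?case by (simp add: choice_sum_0)
next
  case (Suc m)
  define \<psi>' where "\<psi>' z = \<psi> z * (z + y)" for z
  define A where "A l = (\<lambda>z. \<psi>' z * theta m l (z + y))" for l
  define B where "B l = (\<lambda>z. \<psi>' z * theta m l (z + (y + 1)))" for l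
  have IH: "choice_sum K m \<psi>' y R = (\<Sum>l\<le>m. wsum K l (A l) R)"
    "choice_sum K m \<psi>' (y + 1) R = (\<Sum>l\<le>m. wsum K l (B l) R)" for R
    unfolding A_def B_def by (rule Suc.IH)+
  have "choice_sum K (Suc m) \<psi> y R =
      (\<Sum>j\<le>K. choice_sum K m \<psi>' y (R - real j) - choice_sum K m \<psi>' (y + 1) (R - real j)) +
      choice_sum K m \<psi>' (y + 1) R"
    unfolding choice_sum_Suc \<psi>'_def[symmetric]
    by (subst sum_choices[of "\<lambda>j e. choice_sum K m \<psi>' (y + real e) (R - real j)"]) simp
  also have "\<dots> = (\<Sum>l\<le>m. wsum K (Suc l) (\<lambda>z. A l z - B l z) R) + (\<Sum>l\<le>m. wsum K l (B l) R)"
    unfolding IH by (simp add: wsum_diff sum_subtractf sum.swap[of _ "{..m}" "{..K}"])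
  \<comment> \<open>A vanishing term is appended so that after splitting off \<open>l = 0\<close>
    both sums are indexed by \<open>Suc l\<close> with the same range, as in the recursion of
    \<open>theta\<close>.\<close>
  also have "(\<Sum>l\<le>m. wsum K l (B l) R) = (\<Sum>l\<le>Suc m. wsum K l (B l) R)"
  proof -
    have "B (Suc m) = (\<lambda>z. 0)"
      by (simp add: B_def theta_eq_0)
    then show ?thesis by (simp del: wsum.simps)
  qed
  also have "\<dots> = wsum K 0 (B 0) R + (\<Sum>l\<le>m. wsum K (Suc l) (B (Suc l)) R)"
    by (rule sum.atMost_Suc_shift)
  also have "(\<Sum>l\<le>m. wsum K (Suc l) (\<lambda>z. A l z - B l z) R) +
      (wsum K 0 (B 0) R + (\<Sum>l\<le>m. wsum K (Suc l) (B (Suc l)) R)) =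
      wsum K 0 (B 0) R + (\<Sum>l\<le>m. wsum K (Suc l) (\<lambda>z. B (Suc l) z + (A l z - B l z)) R)"
    by (simp add: wsum_add sum.distrib del: wsum.simps)
  also have "\<dots> = wsum K 0 (\<lambda>z. \<psi> z * theta (Suc m) 0 (z + y)) R +
      (\<Sum>l\<le>m. wsum K (Suc l) (\<lambda>z. \<psi> z * theta (Suc m) (Suc l) (z + y)) R)"
  proof -
    have "B 0 = (\<lambda>z. \<psi> z * theta (Suc m) 0 (z + y))"
      by (simp add: B_def \<psi>'_def fun_eq_iff add.assoc)
    moreover have "(\<lambda>z. B (Suc l) z + (A l z - B l z)) = (\<lambda>z. \<psi> z * theta (Suc m) (Suc l) (z + y))" for l
      by (simp add: A_def B_def \<psi>'_def fun_eq_iff algebra_simps)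
    ultimately show ?thesis by (simp only:)
  qed
  also have "\<dots> = (\<Sum>l\<le>Suc m. wsum K l (\<lambda>z. \<psi> z * theta (Suc m) l (z + y)) R)"
    by (rule sum.atMost_Suc_shift[symmetric])
  finally show ?case .
qed

text \<open>With T the shift z - 1, this is T^(K+1) = 1 - W (1 - T): the K + 1 unit steps telescope,
  and by Pascal's rule 1 - T lowers the lower index of the binomial by one, which matches the
  passage from l to \<open>Suc l\<close>.\<close>

lemma wsum_gbinomial_shift1:
  assumes "l < m"
  shows "wsum K l (\<lambda>z. (z + real m - real l - 1) gchoose (m - l)) (R - real (Suc K)) =
         wsum K l (\<lambda>z. (z + real m - real l - 1) gchoose (m - l)) R -
         wsum K (Suc l) (\<lambda>z. (z + real m - real (Suc l) - 1) gchoose (m - Suc l)) R"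
proof -
  obtain d where d: "m - l = Suc d" "m = Suc (l + d)"
    using assms by (metis Suc_diff_Suc add_Suc_right le_add_diff_inverse less_imp_le_nat)
  let ?g = "\<lambda>z. (z + real d) gchoose Suc d" and ?h = "\<lambda>z. (z + real d - 1) gchoose d"
  have tel: "?g (z - real (Suc J)) = ?g z - (\<Sum>j\<le>J. ?h (z - real j))" for z J
  proof (induction J)
    case 0
    show ?case
      using gbinomial_Suc_Suc[of "z + real d - 1" d] by (simp add: algebra_simps)
  next
    case (Suc J)
    have "?g (z - real (Suc J)) = ?h (z - real (Suc J)) + ?g (z - real (Suc (Suc J)))"
      using gbinomial_Suc_Suc[of "z - real (Suc J) + real d - 1" d] by (simp add: algebra_simps)
    then show ?case using Suc by simp
  qed
  have "wsum K l ?g (R - real (Suc K)) = wsum K l (\<lambda>z. ?g (z - real (Suc K))) R"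
    by (rule wsum_shift[symmetric])
  also have "\<dots> = wsum K l ?g R - wsum K l (\<lambda>z. \<Sum>j\<le>K. ?h (z - real j)) R"
    unfolding tel by (rule wsum_diff)
  also have "wsum K l (\<lambda>z. \<Sum>j\<le>K. ?h (z - real j)) R = (\<Sum>j\<le>K. wsum K l ?h (R - real j))"
    by (simp add: wsum_sum wsum_shift[of K l ?h])
  finally show ?thesis
    by (simp add: d algebra_simps)
qed

text \<open>The binomial theorem for the c-th power of the preceding operator identity. The bound on
  \<open>l + c\<close> keeps the lower index from being truncated.\<close>

lemma wsum_gbinomial_shift:
  assumes "l + c \<le> m"
  shows "wsum K l (\<lambda>z. (z + real m - real l - 1) gchoose (m - l)) (R - real c * real (Suc K)) =
    (\<Sum>i\<le>c. (-1) ^ i * real (c choose i) *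
       wsum K (l + i) (\<lambda>z. (z + real m - real (l + i) - 1) gchoose (m - (l + i))) R)"
  using assms
proof (induction c arbitrary: l)
  case 0
  then show ?case by simp
next
  case (Suc c)
  define C where "C l = wsum K l (\<lambda>z. (z + real m - real l - 1) gchoose (m - l))" for l
  let ?R = "R - real c * real (Suc K)"
  have "C l (R - real (Suc c) * real (Suc K)) = C l (?R - real (Suc K))"
    by (simp add: algebra_simps)
  also have "\<dots> = C l ?R - C (Suc l) ?R"
    unfolding C_def by (rule wsum_gbinomial_shift1) (use Suc.prems in simp)
  also have "C l ?R = (\<Sum>i\<le>c. (-1) ^ i * real (c choose i) * C (l + i) R)"
    unfolding C_def by (rule Suc.IH) (use Suc.prems in simp)
  also have "\<dots> = (\<Sum>i\<le>Suc c. (-1) ^ i * real (c choose i) * C (l + i) R)"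
    by simp
  also have "\<dots> = C l R + (\<Sum>i\<le>c. (-1) ^ Suc i * real (c choose Suc i) * C (l + Suc i) R)"
    by (subst sum.atMost_Suc_shift) simp
  also have "C (Suc l) ?R = (\<Sum>i\<le>c. (-1) ^ i * real (c choose i) * C (l + Suc i) R)"
    using Suc.IH[of "Suc l"] Suc.prems unfolding C_def by simp
  also have "C l R + (\<Sum>i\<le>c. (-1) ^ Suc i * real (c choose Suc i) * C (l + Suc i) R) -
      (\<Sum>i\<le>c. (-1) ^ i * real (c choose i) * C (l + Suc i) R) =
      C l R + (\<Sum>i\<le>c. (-1) ^ Suc i * real (Suc c choose Suc i) * C (l + Suc i) R)"
    unfolding add_diff_eq[symmetric] sum_subtractf[symmetric]
    by (intro arg_cong2[of _ _ _ _ "(+)"] sum.cong refl) (simp add: algebra_simps)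
  also have "\<dots> = (\<Sum>i\<le>Suc c. (-1) ^ i * real (Suc c choose i) * C (l + i) R)"
    by (subst sum.atMost_Suc_shift) simp
  finally show ?case
    unfolding C_def .
qed

text \<open>Writing \<open>marked_asc\<close> as a sum over permutations moves
  \<open>asc w choose l\<close> inside. For fixed \<open>w\<close> the sum over l is then the
  binomial expansion of a shift by \<open>asc w\<close> times K + 1, and all powers of W
  disappear.\<close>

theorem choice_sum_ascents:
  "choice_sum K m (\<lambda>_. 1) 0 R =
   (\<Sum>w\<in>arr m. (R + real m - 1 - real (asc w) * real (Suc K)) gchoose m)"
proof -
  define C where "C l = wsum K l (\<lambda>z. (z + real m - real l - 1) gchoose (m - l))" for l
  have "choice_sum K m (\<lambda>_. 1) 0 R = (\<Sum>l\<le>m. (-1) ^ l * marked_asc m l * C l R)"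
    unfolding choice_sum_eq C_def by (simp add: theta_eq wsum_cmult del: wsum.simps)
  also have "\<dots> = (\<Sum>w\<in>arr m. \<Sum>l\<le>m. (-1) ^ l * real (asc w choose l) * C l R)"
    unfolding marked_asc_def sum_distrib_left sum_distrib_right by (rule sum.swap)
  also have "\<dots> = (\<Sum>w\<in>arr m. (R + real m - 1 - real (asc w) * real (Suc K)) gchoose m)"
  proof (rule sum.cong[OF refl])
    fix w assume "w \<in> arr m"
    then have le: "asc w \<le> m"
      using asc_le[of w] length_arr[of w m] by simp
    have "(\<Sum>l\<le>m. (-1) ^ l * real (asc w choose l) * C l R) =
        (\<Sum>l\<le>asc w. (-1) ^ l * real (asc w choose l) * C l R)"
      by (rule sum.mono_neutral_right) (use le in \<open>auto simp: binomial_eq_0\<close>)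
    also have "\<dots> = C 0 (R - real (asc w) * real (Suc K))"
      using wsum_gbinomial_shift[of 0 "asc w" m K R] le unfolding C_def by simp
    finally show "(\<Sum>l\<le>m. (-1) ^ l * real (asc w choose l) * C l R) =
        (R + real m - 1 - real (asc w) * real (Suc K)) gchoose m"
      by (simp add: C_def algebra_simps)
  qed
  finally show ?thesis .
qed

section \<open>Counting points with prescribed gaps\<close>

lemma ex_sorted_wrt:
  assumes "finite A" "transp R" "\<And>u v. u \<in> A \<Longrightarrow> v \<in> A \<Longrightarrow> u \<noteq> v \<Longrightarrow> R u v \<or> R v u"
  shows "\<exists>w. distinct w \<and> set w = A \<and> sorted_wrt R w"
  using assms(1,3)
proof (induction A rule: finite_induct)
  case (insert u A)
  then obtain w where w: "distinct w" "set w = A" "sorted_wrt R w" by auto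
  let ?w = "filter (\<lambda>v. R v u) w @ u # filter (\<lambda>v. \<not> R v u) w"
  have "R u v" if "v \<in> A" "\<not> R v u" for v
    using insert that by (metis insert_iff)
  then have "sorted_wrt R ?w"
    using w assms(2) by (auto simp: sorted_wrt_append sorted_wrt_filter dest: transpD)
  moreover have "distinct ?w" "set ?w = insert u A"
    using w insert.hyps by auto
  ultimately show ?case by blast
qed simp

lemma sorted_wrt_unique:
  assumes "\<And>u v. R u v \<Longrightarrow> \<not> R v u"
  shows "distinct w \<Longrightarrow> distinct w' \<Longrightarrow> set w = set w' \<Longrightarrow> sorted_wrt R w \<Longrightarrow> sorted_wrt R w' \<Longrightarrow> w = w'"
proof (induction w arbitrary: w')
  case (Cons u w)
  then obtain u' v' where w': "w' = u' # v'"
    by (cases w') auto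
  have "u = u'"
  proof (rule ccontr)
    assume "u \<noteq> u'"
    then have "u' \<in> set w" "u \<in> set v'"
      using Cons.prems w' by auto
    then have "R u u'" "R u' u"
      using Cons.prems w' by auto
    then show False using assms by blast
  qed
  moreover have "set w = set v'"
    using Cons.prems w' \<open>u = u'\<close> by (metis distinct.simps(2) insert_ident list.simps(15))
  ultimately show ?case
    using Cons w' by simp
qed simp

locale gaps =
  fixes K k2 :: nat
begin

text \<open>For i < j the values 1 - k2, ..., K + k2 of x j - x i are forbidden. So if v follows u
  on the line, it is at distance at least K + k2 + 1 when u < v and at least k2 when u > v.\<close>

definition gap :: "nat \<Rightarrow> nat \<Rightarrow> int" where
  "gap u v = (if u < v then int K + int k2 + 1 else int k2)"

text \<open>For k2 = 0 a descent has gap 0, so equal coordinates are allowed and are ordered by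
  decreasing label; \<open>u \<noteq> v\<close> keeps the relation irreflexive in that case.\<close>

definition rho :: "(nat \<Rightarrow> int) \<Rightarrow> nat \<Rightarrow> nat \<Rightarrow> bool" where
  "rho x u v \<longleftrightarrow> x u + gap u v \<le> x v \<and> u \<noteq> v"

lemma gap_nonneg: "0 \<le> gap u v"
  by (simp add: gap_def)

lemma rho_asym: "rho x u v \<Longrightarrow> \<not> rho x v u"
  by (auto simp: rho_def gap_def split: if_splits)

text \<open>If u < w then u < v or v < w, so one of the two gaps is already the large one: the gaps
  satisfy a triangle inequality.\<close>

lemma transp_rho: "transp (rho x)"
proof (rule transpI)
  fix u v w assume uv: "rho x u v" and vw: "rho x v w"
  have "u \<noteq> w" using rho_asym uv vw by blast
  then show "rho x u w"
    using uv vw by (auto simp: rho_def gap_def split: if_splits)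
qed

definition gap_points :: "int \<Rightarrow> int \<Rightarrow> nat list \<Rightarrow> (nat \<Rightarrow> int) set" where
  "gap_points lo hi w = {x. (\<forall>i. i \<notin> set w \<longrightarrow> x i = 0) \<and> sorted_wrt (rho x) w \<and>
     lo \<le> x (hd w) \<and> x (last w) < hi}"

definition gap_total :: "nat list \<Rightarrow> int" where
  "gap_total w = int (asc w) * (int K + 1) + (int (length w) - 1) * int k2"

lemma gap_total_Cons: "gap_total (u # v # w) = gap u v + gap_total (v # w)"
  by (simp add: gap_total_def gap_def algebra_simps)

lemma gap_total_nonneg: "w \<noteq> [] \<Longrightarrow> 0 \<le> gap_total w"
  by (cases w) (simp_all add: gap_total_def)

text \<open>The second hypothesis makes all terms with t at least \<open>hi\<close> vanish, so
  cutting the summation there loses nothing.\<close>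

lemma hockey_stick:
  assumes "0 < l" "D - hi < int l"
  shows "(\<Sum>t\<in>{lo..<hi}. nat (D - t) choose l) = nat (D - lo + 1) choose Suc l"
proof (cases "lo \<le> hi")
  case False
  then show ?thesis using assms by (simp add: binomial_eq_0)
next
  case True
  then show ?thesis
  proof (induction lo rule: int_le_induct)
    case base
    show ?case using assms by (simp add: binomial_eq_0)
  next
    case (step t)
    have "{t - 1..<hi} = insert (t - 1) {t..<hi}"
      using step.hyps by auto
    then have "(\<Sum>s\<in>{t - 1..<hi}. nat (D - s) choose l) =
        (nat (D - (t - 1)) choose l) + (nat (D - t + 1) choose Suc l)"
      using step by simp
    also have "\<dots> = nat (D - (t - 1) + 1) choose Suc l"
    proof (cases "D - t + 1 \<ge> 0")
      case True
      then have "nat (D - (t - 1) + 1) = Suc (nat (D - t + 1))" "nat (D - (t - 1)) = nat (D - t + 1)"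
        by auto
      then show ?thesis by simp
    qed (use assms in \<open>simp add: binomial_eq_0\<close>)
    finally show ?case .
  qed
qed

text \<open>Subtracting the accumulated gaps leaves a weakly increasing sequence in an interval of
  \<open>hi - lo - gap_total w\<close> values, that is, a multiset. The induction fixes the first
  value and sums over it.\<close>

lemma card_gap_points:
  assumes "w \<noteq> []" "distinct w"
  shows "finite (gap_points lo hi w)" (is ?fin)
    and "card (gap_points lo hi w) = nat (hi - lo - gap_total w + int (length w) - 1) choose length w" (is ?card)
proof -
  have "?fin \<and> ?card"
    using assms
  proof (induction w arbitrary: lo rule: asc.induct)
    case 1
    then show ?case by simp
  next
    case (2 u)
    have "bij_betw (\<lambda>t i. if i = u then t else 0) {lo..<hi} (gap_points lo hi [u])"
      by (rule bij_betw_byWitness[where f' = "\<lambda>x. x u"]) (auto simp: gap_points_def)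
    from bij_betw_finite[OF this] bij_betw_same_card[OF this] show ?case
      by (simp add: gap_total_def)
  next
    case (3 u v w)
    let ?w = "v # w"
    let ?S = "SIGMA t:{lo..<hi}. gap_points (t + gap u v) hi ?w"
    have IH: "finite (gap_points lo hi ?w)"
      "card (gap_points lo hi ?w) = nat (hi - lo - gap_total ?w + int (length ?w) - 1) choose length ?w" for lo
      using 3 by auto
    have ne: "i \<noteq> u" if "i \<in> set ?w" for i
      using 3 that by auto
    have upd: "sorted_wrt (rho (x(u := t))) ?w \<longleftrightarrow> sorted_wrt (rho x) ?w" for x t
    proof -
      have "rho (x(u := t)) i j \<longleftrightarrow> rho x i j" if "i \<in> set ?w" "j \<in> set ?w" for i j
        using ne[OF that(1)] ne[OF that(2)] by (simp add: rho_def)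
      then show ?thesis
        by (metis (mono_tags, lifting) sorted_wrt_mono_rel)
    qed
    have last: "last (u # ?w) = last ?w" "last ?w \<in> set ?w" by auto
    \<comment> \<open>By transitivity the first value only has to respect its neighbour, so it acts
      as a new lower bound for the rest of the word.\<close>
    have "bij_betw (\<lambda>(t, x). x(u := t)) ?S (gap_points lo hi (u # ?w))"
    proof (rule bij_betw_byWitness[where f' = "\<lambda>x. (x u, x(u := 0))"])
      show "\<forall>p\<in>?S. (\<lambda>x. (x u, x(u := 0))) ((\<lambda>(t, x). x(u := t)) p) = p"
        using ne by (auto simp: gap_points_def fun_eq_iff)
      show "\<forall>x\<in>gap_points lo hi (u # ?w). (\<lambda>(t, x). x(u := t)) ((\<lambda>x. (x u, x(u := 0))) x) = x"
        by auto
      show "(\<lambda>(t, x). x(u := t)) ` ?S \<subseteq> gap_points lo hi (u # ?w)"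
      proof (rule image_subsetI)
        fix p assume "p \<in> ?S"
        then obtain t x where p: "p = (t, x)" "lo \<le> t" "t < hi" "x \<in> gap_points (t + gap u v) hi ?w"
          by auto
        have "rho (x(u := t)) u v"
          using p(4) ne[of v] by (simp add: rho_def gap_points_def)
        then show "(\<lambda>(t, x). x(u := t)) p \<in> gap_points lo hi (u # ?w)"
          using p upd[of x t] ne[OF last(2)] last(1)
          by (auto simp: gap_points_def sorted_wrt2[OF transp_rho] simp del: sorted_wrt.simps)
      qed
      show "(\<lambda>x. (x u, x(u := 0))) ` gap_points lo hi (u # ?w) \<subseteq> ?S"
      proof (rule image_subsetI)
        fix x assume x: "x \<in> gap_points lo hi (u # ?w)"
        then have r: "rho x u v" "sorted_wrt (rho x) ?w"
          by (auto simp: gap_points_def sorted_wrt2[OF transp_rho] simp del: sorted_wrt.simps)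
        have "rho x u (last ?w)"
          using x last(2) by (auto simp: gap_points_def)
        then have "x u < hi"
          using x last gap_nonneg[of u "last ?w"] by (auto simp: gap_points_def rho_def)
        moreover have "x(u := 0) \<in> gap_points (x u + gap u v) hi ?w"
          using x r upd[of x 0] ne[OF last(2)] ne[of v] last(1)
          by (auto simp: gap_points_def rho_def simp del: sorted_wrt.simps)
        ultimately show "(x u, x(u := 0)) \<in> ?S"
          using x by (auto simp: gap_points_def)
      qed
    qed
    then have fin: "finite (gap_points lo hi (u # ?w)) \<longleftrightarrow> finite ?S"
      and card: "card (gap_points lo hi (u # ?w)) = card ?S"
      by (simp_all add: bij_betw_finite bij_betw_same_card)
    have "finite ?S"
      using IH(1) by blast
    define D where "D = hi - gap u v - gap_total ?w + int (length ?w) - 1"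
    have "card ?S = (\<Sum>t\<in>{lo..<hi}. card (gap_points (t + gap u v) hi ?w))"
      using IH(1) by simp
    also have "\<dots> = (\<Sum>t\<in>{lo..<hi}. nat (D - t) choose length ?w)"
      by (rule sum.cong[OF refl]) (simp add: IH(2) D_def algebra_simps)
    also have "\<dots> = nat (D - lo + 1) choose Suc (length ?w)"
      using gap_nonneg[of u v] gap_total_nonneg[of ?w] by (intro hockey_stick) (auto simp: D_def)
    also have "D - lo + 1 = hi - lo - gap_total (u # ?w) + int (length (u # ?w)) - 1"
      by (simp add: D_def gap_total_Cons)
    finally have "card ?S = nat (hi - lo - gap_total (u # ?w) + int (length (u # ?w)) - 1) choose length (u # ?w)"
      by simp
    then show ?case
      using fin card \<open>finite ?S\<close> by simp
  qed
  then show ?fin ?card by auto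
qed

text \<open>On such a point \<open>rho x\<close> is a strict total order of 1, ..., m, so exactly
  one permutation lists the vertices in that order.\<close>

lemma card_total_points:
  assumes "1 \<le> m"
  shows "card {x. (\<forall>i. (i \<in> {1..m} \<longrightarrow> lo \<le> x i \<and> x i < hi) \<and> (i \<notin> {1..m} \<longrightarrow> x i = 0)) \<and>
             (\<forall>i\<in>{1..m}. \<forall>j\<in>{1..m}. i < j \<longrightarrow> rho x i j \<or> rho x j i)} =
    (\<Sum>w\<in>arr m. nat (hi - lo - int (asc w) * (int K + 1) - (int m - 1) * int k2 + int m - 1) choose m)"
proof -
  let ?X = "{x. (\<forall>i. (i \<in> {1..m} \<longrightarrow> lo \<le> x i \<and> x i < hi) \<and> (i \<notin> {1..m} \<longrightarrow> x i = 0)) \<and>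
             (\<forall>i\<in>{1..m}. \<forall>j\<in>{1..m}. i < j \<longrightarrow> rho x i j \<or> rho x j i)}"
  have arrD: "w \<noteq> []" "distinct w" "set w = {1..m}" if "w \<in> arr m" for w
    using that assms by (auto simp: arr_def)
  have "?X = (\<Union>w\<in>arr m. gap_points lo hi w)"
  proof (intro equalityI subsetI)
    fix x assume x: "x \<in> ?X"
    have tot: "rho x u v \<or> rho x v u" if "u \<in> {1..m}" "v \<in> {1..m}" "u \<noteq> v" for u v
    proof (cases "u < v")
      case True
      then show ?thesis using x that by blast
    next
      case False
      then have "v < u" using that by simp
      then show ?thesis using x that by blast
    qed
    from ex_sorted_wrt[of "{1..m}", OF _ transp_rho tot]
    obtain w where w: "distinct w" "set w = {1..m}" "sorted_wrt (rho x) w"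
      by auto
    then have a: "w \<in> arr m" by (simp add: arr_def)
    have "hd w \<in> {1..m}" "last w \<in> {1..m}"
      using arrD[OF a] by (metis hd_in_set, metis last_in_set)
    then have "x \<in> gap_points lo hi w"
      using x w by (auto simp: gap_points_def)
    then show "x \<in> (\<Union>w\<in>arr m. gap_points lo hi w)"
      using a by blast
  next
    fix x assume "x \<in> (\<Union>w\<in>arr m. gap_points lo hi w)"
    then obtain w where a: "w \<in> arr m" and x: "x \<in> gap_points lo hi w" by blast
    note d = arrD[OF a]
    have s: "sorted_wrt (rho x) w" using x by (simp add: gap_points_def)
    have rel: "rho x u v \<or> rho x v u" if uv: "u \<in> {1..m}" "v \<in> {1..m}" "u \<noteq> v" for u v
    proof -
      obtain k l where kl: "k < length w" "l < length w" "u = w ! k" "v = w ! l"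
        using uv d(3) by (metis in_set_conv_nth)
      then have "k < l \<or> l < k" using uv(3) by (metis linorder_neqE_nat)
      then show ?thesis
        using s kl by (auto simp: sorted_wrt_iff_nth_less)
    qed
    have bound: "lo \<le> x i \<and> x i < hi" if i: "i \<in> {1..m}" for i
    proof
      have "hd w \<in> set w" using d(1) by simp
      have "i = hd w \<or> rho x (hd w) i"
        using s i d by (cases w) auto
      then show "lo \<le> x i"
        using x gap_nonneg[of "hd w" i] by (auto simp: gap_points_def rho_def)
      obtain ys z where yz: "w = ys @ [z]" using d(1) by (metis append_butlast_last_id)
      then have "i = last w \<or> rho x i (last w)"
        using s i d(3)[symmetric] by (auto simp: sorted_wrt_append)
      then show "x i < hi"
        using x gap_nonneg[of i "last w"] by (auto simp: gap_points_def rho_def)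
    qed
    have "x i = 0" if "i \<notin> {1..m}" for i
      using x that d(3) by (simp add: gap_points_def)
    then show "x \<in> ?X"
      using bound rel by auto
  qed
  moreover have "gap_points lo hi w \<inter> gap_points lo hi w' = {}"
    if "w \<in> arr m" "w' \<in> arr m" "w \<noteq> w'" for w w'
  proof (rule ccontr)
    assume "gap_points lo hi w \<inter> gap_points lo hi w' \<noteq> {}"
    then obtain x where "sorted_wrt (rho x) w" "sorted_wrt (rho x) w'"
      by (auto simp: gap_points_def)
    then have "w = w'"
      using sorted_wrt_unique[of "rho x" w w'] rho_asym arrD(2,3)[OF that(1)] arrD(2,3)[OF that(2)] by metis
    then show False using that(3) by simp
  qed
  ultimately have "card ?X = (\<Sum>w\<in>arr m. card (gap_points lo hi w))"
    using card_gap_points(1) arrD(1,2) by (simp only:) (intro card_UN_disjoint, auto)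
  also have "\<dots> = (\<Sum>w\<in>arr m. nat (hi - lo - int (asc w) * (int K + 1) - (int m - 1) * int k2 + int m - 1) choose m)"
  proof (rule sum.cong[OF refl])
    fix w assume w: "w \<in> arr m"
    show "card (gap_points lo hi w) =
        nat (hi - lo - int (asc w) * (int K + 1) - (int m - 1) * int k2 + int m - 1) choose m"
      using card_gap_points(2)[OF arrD(1)[OF w] arrD(2)[OF w], of lo hi]
      by (simp add: length_arr[OF w] gap_total_def algebra_simps)
  qed
  finally show ?thesis .
qed

end

section \<open>Weighted sums over rooted forests\<close>

text \<open>A rooted forest on V is a parent function with value 0 at the roots; acyclicity is
  expressed by a rank that increases from parent to child.\<close>

definition forests :: "nat set \<Rightarrow> (nat \<Rightarrow> nat) set" where
  "forests V = {f \<in> PiE V (\<lambda>_. insert 0 V). \<exists>h :: nat \<Rightarrow> nat. \<forall>w\<in>V. h (f w) < h w}"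

definition forest_sum :: "nat set \<Rightarrow> (nat \<Rightarrow> nat \<Rightarrow> 'a :: comm_ring_1) \<Rightarrow> 'a" where
  "forest_sum V \<omega> = (\<Sum>f\<in>forests V. \<Prod>w\<in>V. \<omega> (f w) w)"

lemma finite_forests [simp]: "finite V \<Longrightarrow> finite (forests V)"
  unfolding forests_def by (rule finite_subset[OF _ finite_PiE[of V "\<lambda>_. insert 0 V"]]) auto

lemma forest_parent: "f \<in> forests V \<Longrightarrow> w \<in> V \<Longrightarrow> f w \<in> insert 0 V"
  by (auto simp: forests_def)

lemma forest_parent_ne: "f \<in> forests V \<Longrightarrow> w \<in> V \<Longrightarrow> f w \<noteq> w"
  by (force simp: forests_def)

lemma forest_sum_cong:
  assumes "\<And>u w. u \<in> insert 0 V \<Longrightarrow> w \<in> V \<Longrightarrow> \<omega> u w = \<omega>' u w"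
  shows "forest_sum V \<omega> = forest_sum V \<omega>'"
  unfolding forest_sum_def
  by (intro sum.cong prod.cong refl assms) (auto dest: forest_parent)

lemma forests_empty: "forests {} = {\<lambda>_. undefined}"
  by (auto simp: forests_def restrict_def)

lemma forest_sum_empty: "forest_sum {} \<omega> = 1"
  by (simp add: forest_sum_def forests_empty)

text \<open>Contracting the edge above v: the children of v become children of the parent of v.\<close>

lemma forest_sum_contract:
  fixes \<omega> :: "nat \<Rightarrow> nat \<Rightarrow> 'a :: comm_ring_1"
  assumes fin: "finite V" and v: "v \<notin> V" "v \<noteq> 0" "0 \<notin> V"
  shows "forest_sum (insert v V) \<omega> =
    (\<Sum>u\<in>insert 0 V. \<omega> u v * forest_sum V (\<lambda>u' w. (if u' = u then \<omega> v w else 0) + \<omega> u' w))"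
proof -
  \<comment> \<open>To undo the contraction one needs the parent \<open>u\<close> of
    \<open>v\<close>, the contracted forest, and the set \<open>D\<close> of those children of
    \<open>u\<close> that belonged to \<open>v\<close>.\<close>
  define S where "S = (SIGMA u:insert 0 V. SIGMA f:forests V. Pow {w \<in> V. f w = u})"
  define up where "up = (\<lambda>(u, f, D) w. if w = v then u else if w \<in> D then v else f w :: nat)"
  define dn where "dn f = (f v, (\<lambda>w\<in>V. if f w = v then f v else f w), {w \<in> V. f w = v})" for f :: "nat \<Rightarrow> nat"
  have bij: "bij_betw up S (forests (insert v V))"
  proof (rule bij_betw_byWitness[where f' = dn])
    show "\<forall>p\<in>S. dn (up p) = p"
    proof
      fix p assume "p \<in> S"
      then obtain u f D where p: "p = (u, f, D)" "u \<in> insert 0 V" "f \<in> forests V" "D \<subseteq> {w \<in> V. f w = u}"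
        unfolding S_def by auto
      have fv: "f w \<noteq> v" if "w \<in> V" for w
        using forest_parent[OF p(3) that] v by auto
      have "{w \<in> V. up p w = v} = D"
        using p(1,4) fv v by (auto simp: up_def)
      moreover have "(\<lambda>w\<in>V. if up p w = v then up p v else up p w) = f"
      proof
        fix w
        show "(\<lambda>w\<in>V. if up p w = v then up p v else up p w) w = f w"
        proof (cases "w \<in> V")
          case True
          then show ?thesis
            using p(1,4) fv[OF True] v by (auto simp: up_def)
        next
          case False
          then show ?thesis
            using p(3) by (auto simp: forests_def)
        qed
      qed
      ultimately show "dn (up p) = p"
        unfolding dn_def by (simp only:) (simp add: p(1) up_def)
    qed
    show "\<forall>f\<in>forests (insert v V). up (dn f) = f"
    proof
      fix f assume f: "f \<in> forests (insert v V)"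
      show "up (dn f) = f"
      proof
        fix w
        show "up (dn f) w = f w"
          using f by (auto simp: up_def dn_def forests_def PiE_def extensional_def)
      qed
    qed
    show "up ` S \<subseteq> forests (insert v V)"
    proof (rule image_subsetI)
      fix p assume "p \<in> S"
      then obtain u f D where p: "p = (u, f, D)" "u \<in> insert 0 V" "f \<in> forests V" "D \<subseteq> {w \<in> V. f w = u}"
        unfolding S_def by auto
      obtain h :: "nat \<Rightarrow> nat" where h: "\<And>w. w \<in> V \<Longrightarrow> h (f w) < h w"
        using p(3) by (auto simp: forests_def)
      have fv: "f w \<noteq> v" if "w \<in> V" for w
        using forest_parent[OF p(3) that] v by auto
      have uv: "u \<noteq> v" using p(2) v by auto
      \<comment> \<open>Doubling the ranks leaves an odd value for \<open>v\<close>, strictly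
        between its parent \<open>u\<close> and the vertices of \<open>D\<close>.\<close>
      define g where "g x = (if x = v then 2 * h u + 1 else 2 * h x)" for x
      have "g (up p w) < g w" if "w \<in> insert v V" for w
      proof -
        consider "w = v" | "w \<noteq> v" "w \<in> D" | "w \<noteq> v" "w \<notin> D" by blast
        then show ?thesis
        proof cases
          case 1
          then show ?thesis using uv by (simp add: g_def up_def p(1))
        next
          case 2
          then have "h u < h w" using h[of w] p(4) by auto
          then show ?thesis using 2 by (simp add: g_def up_def p(1))
        next
          case 3
          then have "h (f w) < h w" "f w \<noteq> v" using h fv that by auto
          then show ?thesis using 3 by (simp add: g_def up_def p(1))
        qed
      qed
      moreover have "up p \<in> PiE (insert v V) (\<lambda>_. insert 0 (insert v V))"
        using p forest_parent[OF p(3)] by (auto simp: up_def PiE_iff forests_def extensional_def)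
      ultimately show "up p \<in> forests (insert v V)"
        unfolding forests_def by blast
    qed
    show "dn ` forests (insert v V) \<subseteq> S"
    proof (rule image_subsetI)
      fix f assume f: "f \<in> forests (insert v V)"
      then obtain h :: "nat \<Rightarrow> nat" where h: "\<And>w. w \<in> insert v V \<Longrightarrow> h (f w) < h w"
        by (auto simp: forests_def)
      let ?f = "\<lambda>w\<in>V. if f w = v then f v else f w"
      have fv: "f v \<in> insert 0 V"
        using forest_parent[OF f, of v] forest_parent_ne[OF f, of v] by auto
      have "h (?f w) < h w" if "w \<in> V" for w
        using h[of w] h[of v] that by auto
      moreover have "?f \<in> PiE V (\<lambda>_. insert 0 V)"
        using forest_parent[OF f] fv by (auto simp: PiE_iff)
      ultimately have "?f \<in> forests V"
        unfolding forests_def by blast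
      then show "dn f \<in> S"
        unfolding S_def dn_def using fv by auto
    qed
  qed
  have weight: "(\<Prod>w\<in>insert v V. \<omega> (up (u, f, D) w) w) =
      \<omega> u v * ((\<Prod>w\<in>D. \<omega> v w) * (\<Prod>w\<in>V - D. \<omega> (f w) w))"
    if "D \<subseteq> {w \<in> V. f w = u}" for u f D
  proof -
    have D: "D \<subseteq> V" using that by auto
    have "(\<Prod>w\<in>insert v V. \<omega> (up (u, f, D) w) w) = \<omega> u v * (\<Prod>w\<in>V. \<omega> (up (u, f, D) w) w)"
      using fin v by (simp add: up_def)
    also have "(\<Prod>w\<in>V. \<omega> (up (u, f, D) w) w) =
        (\<Prod>w\<in>V - D. \<omega> (up (u, f, D) w) w) * (\<Prod>w\<in>D. \<omega> (up (u, f, D) w) w)"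
      by (rule prod.subset_diff[OF D fin])
    also have "(\<Prod>w\<in>V - D. \<omega> (up (u, f, D) w) w) = (\<Prod>w\<in>V - D. \<omega> (f w) w)"
      by (rule prod.cong[OF refl]) (use v in \<open>auto simp: up_def\<close>)
    also have "(\<Prod>w\<in>D. \<omega> (up (u, f, D) w) w) = (\<Prod>w\<in>D. \<omega> v w)"
      by (rule prod.cong[OF refl]) (use v D in \<open>auto simp: up_def\<close>)
    finally show ?thesis by (simp add: mult.commute)
  qed
  have expand: "(\<Prod>w\<in>V. (if f w = u then \<omega> v w else 0) + \<omega> (f w) w) =
      (\<Sum>D\<in>Pow {w \<in> V. f w = u}. (\<Prod>w\<in>D. \<omega> v w) * (\<Prod>w\<in>V - D. \<omega> (f w) w))" for f :: "nat \<Rightarrow> nat" and u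
  proof -
    have "(\<Prod>w\<in>V. (if f w = u then \<omega> v w else 0) + \<omega> (f w) w) =
        (\<Sum>D\<in>Pow V. (\<Prod>w\<in>D. if f w = u then \<omega> v w else 0) * (\<Prod>w\<in>V - D. \<omega> (f w) w))"
      by (rule prod_add[OF fin])
    also have "\<dots> = (\<Sum>D\<in>Pow {w \<in> V. f w = u}.
        (\<Prod>w\<in>D. if f w = u then \<omega> v w else 0) * (\<Prod>w\<in>V - D. \<omega> (f w) w))"
    proof (rule sum.mono_neutral_right)
      show "\<forall>D\<in>Pow V - Pow {w \<in> V. f w = u}.
          (\<Prod>w\<in>D. if f w = u then \<omega> v w else 0) * (\<Prod>w\<in>V - D. \<omega> (f w) w) = 0"
      proof
        fix D assume D: "D \<in> Pow V - Pow {w \<in> V. f w = u}"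
        then obtain w where "w \<in> D" "f w \<noteq> u" by auto
        moreover have "finite D" using D fin finite_subset by auto
        ultimately have "(\<Prod>w\<in>D. if f w = u then \<omega> v w else 0) = 0"
          using prod.remove[of D w "\<lambda>w. if f w = u then \<omega> v w else 0"] by simp
        then show "(\<Prod>w\<in>D. if f w = u then \<omega> v w else 0) * (\<Prod>w\<in>V - D. \<omega> (f w) w) = 0"
          by simp
      qed
    qed (use fin in auto)
    also have "\<dots> = (\<Sum>D\<in>Pow {w \<in> V. f w = u}. (\<Prod>w\<in>D. \<omega> v w) * (\<Prod>w\<in>V - D. \<omega> (f w) w))"
    proof (rule sum.cong[OF refl])
      fix D assume "D \<in> Pow {w \<in> V. f w = u}"
      then have "(\<Prod>w\<in>D. if f w = u then \<omega> v w else 0) = (\<Prod>w\<in>D. \<omega> v w)"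
        by (intro prod.cong) auto
      then show "(\<Prod>w\<in>D. if f w = u then \<omega> v w else 0) * (\<Prod>w\<in>V - D. \<omega> (f w) w) =
          (\<Prod>w\<in>D. \<omega> v w) * (\<Prod>w\<in>V - D. \<omega> (f w) w)"
        by simp
    qed
    finally show ?thesis .
  qed
  have "forest_sum (insert v V) \<omega> = (\<Sum>p\<in>S. \<Prod>w\<in>insert v V. \<omega> (up p w) w)"
    unfolding forest_sum_def
    by (subst sum.reindex_bij_betw[OF bij, symmetric]) simp
  also have "\<dots> = (\<Sum>u\<in>insert 0 V. \<Sum>f\<in>forests V. \<Sum>D\<in>Pow {w \<in> V. f w = u}.
      \<Prod>w\<in>insert v V. \<omega> (up (u, f, D) w) w)"
    unfolding S_def using fin by (simp add: sum.Sigma case_prod_beta)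
  also have "\<dots> = (\<Sum>u\<in>insert 0 V. \<Sum>f\<in>forests V. \<omega> u v * (\<Prod>w\<in>V. (if f w = u then \<omega> v w else 0) + \<omega> (f w) w))"
    unfolding expand sum_distrib_left
    by (intro sum.cong[OF refl] weight) auto
  finally show ?thesis
    by (simp add: forest_sum_def sum_distrib_left)
qed

definition updown :: "'a \<Rightarrow> (nat \<Rightarrow> 'a) \<Rightarrow> (nat \<Rightarrow> 'a) \<Rightarrow> nat \<Rightarrow> nat \<Rightarrow> 'a" where
  "updown t A D u w = (if u = 0 then t else if u < w then A u else D u)"

text \<open>All children of the largest vertex N are smaller, so the edges to them share the weight
  d = D N, and contraction gives an up-down weight again. Contracting into a vertex u > 0 adds d to
  both \<open>A u\<close> and \<open>D u\<close>, hence d to every factor, since u lies on exactly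
  one side of each i. Contracting into the root 0 adds d to t, with the same effect on the factors
  and an extra factor t + d in front. Adding up the two contributions yields the missing factor of
  the product.\<close>

theorem forest_sum_updown:
  fixes A D :: "nat \<Rightarrow> 'a :: comm_ring_1"
  shows "forest_sum {1..Suc n} (updown t A D) =
         t * (\<Prod>i\<in>{1..n}. t + (\<Sum>u\<in>{1..i}. A u) + (\<Sum>u\<in>{i<..Suc n}. D u))"
proof (induction n arbitrary: t A D)
  case 0
  have ins: "{1..Suc 0} = insert 1 {}" by auto
  show ?case
    unfolding ins using forest_sum_contract[of "{}" 1 "updown t A D"]
    by (simp add: forest_sum_empty updown_def[of _ _ _ 0])
next
  case (Suc n)
  let ?n = "Suc n" and ?N = "Suc (Suc n)"
  define d where "d = D ?N"
  define P where "P = (\<Prod>i\<in>{1..n}. t + (\<Sum>u\<in>{1..i}. A u) + (\<Sum>u\<in>{i<..?N}. D u))"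
  have ins: "{1..?N} = insert ?N {1..?n}" by auto
  have Dsum: "(\<Sum>u\<in>{i<..?N}. D u) = d + (\<Sum>u\<in>{i<..?n}. D u)" if "i \<in> {1..n}" for i
  proof -
    have "{i<..?N} = insert ?N {i<..?n}" using that by auto
    then show ?thesis by (simp add: d_def)
  qed
  have zero: "forest_sum {1..?n} (\<lambda>u' w. (if u' = 0 then updown t A D ?N w else 0) + updown t A D u' w) =
      (t + d) * P"
  proof -
    have "forest_sum {1..?n} (\<lambda>u' w. (if u' = 0 then updown t A D ?N w else 0) + updown t A D u' w) =
        forest_sum {1..?n} (updown (t + d) A D)"
      by (rule forest_sum_cong) (auto simp: updown_def d_def add.commute)
    also have "\<dots> = (t + d) * (\<Prod>i\<in>{1..n}. t + d + (\<Sum>u\<in>{1..i}. A u) + (\<Sum>u\<in>{i<..?n}. D u))"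
      by (rule Suc.IH)
    also have "(\<Prod>i\<in>{1..n}. t + d + (\<Sum>u\<in>{1..i}. A u) + (\<Sum>u\<in>{i<..?n}. D u)) = P"
      unfolding P_def by (rule prod.cong[OF refl]) (simp add: Dsum algebra_simps)
    finally show ?thesis .
  qed
  have pos: "forest_sum {1..?n} (\<lambda>u' w. (if u' = u then updown t A D ?N w else 0) + updown t A D u' w) =
      t * P" if u: "u \<in> {1..?n}" for u
  proof -
    let ?A = "A(u := A u + d)" and ?D = "D(u := D u + d)"
    have "forest_sum {1..?n} (\<lambda>u' w. (if u' = u then updown t A D ?N w else 0) + updown t A D u' w) =
        forest_sum {1..?n} (updown t ?A ?D)"
      by (rule forest_sum_cong) (use u in \<open>auto simp: updown_def d_def add.commute\<close>)
    also have "\<dots> = t * (\<Prod>i\<in>{1..n}. t + (\<Sum>u\<in>{1..i}. ?A u) + (\<Sum>u\<in>{i<..?n}. ?D u))"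
      by (rule Suc.IH)
    also have "(\<Prod>i\<in>{1..n}. t + (\<Sum>u\<in>{1..i}. ?A u) + (\<Sum>u\<in>{i<..?n}. ?D u)) = P"
      unfolding P_def
    proof (rule prod.cong[OF refl])
      fix i assume i: "i \<in> {1..n}"
      have upd: "(\<Sum>x\<in>X. (g(u := g u + d)) x) = (\<Sum>x\<in>X. g x) + (if u \<in> X then d else 0)"
        if "finite X" for X and g :: "nat \<Rightarrow> 'a"
      proof -
        have "(\<Sum>x\<in>X. (g(u := g u + d)) x) = (\<Sum>x\<in>X. g x + (if x = u then d else 0))"
          by (rule sum.cong) auto
        then show ?thesis
          using that by (simp add: sum.distrib sum.delta)
      qed
      show "t + (\<Sum>u\<in>{1..i}. ?A u) + (\<Sum>u\<in>{i<..?n}. ?D u) =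
          t + (\<Sum>u\<in>{1..i}. A u) + (\<Sum>u\<in>{i<..?N}. D u)"
        unfolding upd[OF finite_atLeastAtMost] upd[OF finite_greaterThanAtMost] Dsum[OF i]
        using u i by (auto simp: algebra_simps)
    qed
    finally show ?thesis .
  qed
  have "forest_sum {1..?N} (updown t A D) =
      (\<Sum>u\<in>insert 0 {1..?n}. updown t A D u ?N *
         forest_sum {1..?n} (\<lambda>u' w. (if u' = u then updown t A D ?N w else 0) + updown t A D u' w))"
    unfolding ins by (rule forest_sum_contract) auto
  also have "\<dots> = t * ((t + d) * P) + (\<Sum>u\<in>{1..?n}. A u * (t * P))"
  proof -
    have "updown t A D 0 ?N = t" "\<And>u. u \<in> {1..?n} \<Longrightarrow> updown t A D u ?N = A u"
      by (auto simp: updown_def)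
    then have "updown t A D u ?N * forest_sum {1..?n}
        (\<lambda>u' w. (if u' = u then updown t A D ?N w else 0) + updown t A D u' w) =
        (if u = 0 then t * ((t + d) * P) else A u * (t * P))" if "u \<in> insert 0 {1..?n}" for u
      using that zero pos[of u] by (cases "u = 0") simp_all
    then have "(\<Sum>u\<in>insert 0 {1..?n}. updown t A D u ?N * forest_sum {1..?n}
        (\<lambda>u' w. (if u' = u then updown t A D ?N w else 0) + updown t A D u' w)) =
        (\<Sum>u\<in>insert 0 {1..?n}. if u = 0 then t * ((t + d) * P) else A u * (t * P))"
      by (rule sum.cong[OF refl])
    also have "\<dots> = t * ((t + d) * P) + (\<Sum>u\<in>{1..?n}. if u = 0 then t * ((t + d) * P) else A u * (t * P))"
      by (subst sum.insert) auto
    also have "(\<Sum>u\<in>{1..?n}. if u = 0 then t * ((t + d) * P) else A u * (t * P)) = (\<Sum>u\<in>{1..?n}. A u * (t * P))"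
      by (rule sum.cong) auto
    finally show ?thesis .
  qed
  also have "\<dots> = t * (P * (t + (\<Sum>u\<in>{1..?n}. A u) + d))"
    by (simp add: algebra_simps sum_distrib_left sum_distrib_right del: sum.cl_ivl_Suc)
  also have "P * (t + (\<Sum>u\<in>{1..?n}. A u) + d) =
      (\<Prod>i\<in>{1..?n}. t + (\<Sum>u\<in>{1..i}. A u) + (\<Sum>u\<in>{i<..?N}. D u))"
  proof -
    have "{?n<..?N} = {?N}" by auto
    then show ?thesis
      unfolding P_def d_def by (simp add: prod.nat_ivl_Suc' mult.commute del: sum.cl_ivl_Suc)
  qed
  finally show ?case .
qed

definition trees :: "nat \<Rightarrow> (nat \<Rightarrow> nat) set" where
  "trees n = {f \<in> forests {1..n}. card {w \<in> {1..n}. f w = 0} = 1}"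

text \<open>Rooted trees are the forests counted by the linear term in the root weight t.\<close>

theorem tree_sum_updown:
  fixes A D :: "nat \<Rightarrow> real"
  shows "(\<Sum>f\<in>trees (Suc n). \<Prod>w\<in>{w \<in> {1..Suc n}. f w \<noteq> 0}. if f w < w then A (f w) else D (f w)) =
         (\<Prod>i\<in>{1..n}. (\<Sum>u\<in>{1..i}. A u) + (\<Sum>u\<in>{i<..Suc n}. D u))"
proof -
  let ?V = "{1..Suc n}"
  let ?t = "[:0, 1:] :: real poly"
  let ?a = "\<lambda>f. \<Prod>w\<in>{w \<in> ?V. f w \<noteq> 0}. if f w < w then A (f w) else D (f w)"
  let ?Q = "\<Prod>i\<in>{1..n}. ?t + (\<Sum>u\<in>{1..i}. [:A u:]) + (\<Sum>u\<in>{i<..Suc n}. [:D u:])"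
  have prod_const: "(\<Prod>x\<in>X. [:g x:]) = [:\<Prod>x\<in>X. g x:]" if "finite X" for X and g :: "nat \<Rightarrow> real"
    using that by (induction X rule: finite_induct) (simp_all add: one_pCons)
  have "(\<Prod>w\<in>?V. updown ?t (\<lambda>u. [:A u:]) (\<lambda>u. [:D u:]) (f w) w) =
      ?t ^ card {w \<in> ?V. f w = 0} * [:?a f:]" for f
  proof -
    have "(\<Prod>w\<in>?V. updown ?t (\<lambda>u. [:A u:]) (\<lambda>u. [:D u:]) (f w) w) =
        (\<Prod>w\<in>?V. if f w = 0 then ?t else [:if f w < w then A (f w) else D (f w):])"
      by (rule prod.cong) (auto simp: updown_def)
    also have "\<dots> = (\<Prod>w\<in>?V \<inter> {w. f w = 0}. ?t) *
        (\<Prod>w\<in>?V \<inter> - {w. f w = 0}. [:if f w < w then A (f w) else D (f w):])"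
      by (rule prod.If_cases) simp
    also have "?V \<inter> {w. f w = 0} = {w \<in> ?V. f w = 0}" by auto
    also have "?V \<inter> - {w. f w = 0} = {w \<in> ?V. f w \<noteq> 0}" by auto
    finally show ?thesis
      by (simp add: prod_const)
  qed
  then have "(\<Sum>f\<in>forests ?V. ?t ^ card {w \<in> ?V. f w = 0} * [:?a f:]) = ?t * ?Q"
    using forest_sum_updown[of n ?t "\<lambda>u. [:A u:]" "\<lambda>u. [:D u:]"] unfolding forest_sum_def by simp
  then have "coeff (\<Sum>f\<in>forests ?V. ?t ^ card {w \<in> ?V. f w = 0} * [:?a f:]) 1 = coeff (?t * ?Q) 1"
    by (rule arg_cong)
  moreover have co: "coeff (?t ^ c * [:y:]) 1 = (if c = 1 then y else 0)" for c and y :: real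
  proof -
    have "?t ^ c * [:y:] = monom y c"
      by (simp add: monom_altdef mult.commute)
    then show ?thesis by simp
  qed
  moreover have "coeff (?t * ?Q) 1 = poly ?Q 0"
    by (simp add: poly_0_coeff_0)
  ultimately have "(\<Sum>f\<in>forests ?V. if card {w \<in> ?V. f w = 0} = 1 then ?a f else 0) = poly ?Q 0"
    by (simp only: coeff_sum co)
  moreover have "poly ?Q 0 = (\<Prod>i\<in>{1..n}. (\<Sum>u\<in>{1..i}. A u) + (\<Sum>u\<in>{i<..Suc n}. D u))"
    by (simp add: poly_prod poly_sum)
  moreover have "(\<Sum>f\<in>forests ?V. if card {w \<in> ?V. f w = 0} = 1 then ?a f else 0) = (\<Sum>f\<in>trees (Suc n). ?a f)"
    unfolding trees_def by (rule sum.inter_filter[symmetric]) simp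
  ultimately show ?thesis by (simp only:)
qed

section \<open>Colored rooted trees\<close>

definition nonroots :: "nat \<Rightarrow> (nat \<Rightarrow> nat) \<Rightarrow> nat set" where
  "nonroots n f = {w \<in> {1..n}. f w \<noteq> 0}"

definition tree_of :: "nat \<Rightarrow> (nat \<Rightarrow> nat) \<Rightarrow> (nat \<Rightarrow> nat) \<Rightarrow> (nat \<times> nat \<times> nat) set" where
  "tree_of n f c = (\<lambda>w. (f w, w, c w)) ` nonroots n f"

lemma finite_nonroots [simp]: "finite (nonroots n f)"
  by (simp add: nonroots_def)

lemma in_tree_of: "(u, w, y) \<in> tree_of n f c \<longleftrightarrow> w \<in> nonroots n f \<and> u = f w \<and> y = c w"
  by (auto simp: tree_of_def)

lemma card_nonroots: "f \<in> trees n \<Longrightarrow> card (nonroots n f) = n - 1"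
proof -
  assume f: "f \<in> trees n"
  have "nonroots n f = {1..n} - {w \<in> {1..n}. f w = 0}"
    by (auto simp: nonroots_def)
  moreover have "card ({1..n} - {w \<in> {1..n}. f w = 0}) = card {1..n} - card {w \<in> {1..n}. f w = 0}"
    by (rule card_Diff_subset) auto
  ultimately have "card (nonroots n f) = card {1..n} - card {w \<in> {1..n}. f w = 0}"
    by presburger
  then show ?thesis
    using f by (simp add: trees_def)
qed

lemma tree_of_colored:
  assumes f: "f \<in> trees n" and c: "c \<in> PiE (nonroots n f) (\<lambda>_. {1..k})"
  shows "colored_rooted_tree n k (tree_of n f c)"
proof -
  have ff: "f \<in> forests {1..n}" using f by (simp add: trees_def)
  then obtain h :: "nat \<Rightarrow> nat" where h: "\<And>w. w \<in> {1..n} \<Longrightarrow> h (f w) < h w"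
    unfolding forests_def by blast
  have sub: "tree_of n f c \<subseteq> {1..n} \<times> {1..n} \<times> {1..k}"
  proof
    fix t assume "t \<in> tree_of n f c"
    then obtain w where w: "w \<in> nonroots n f" "t = (f w, w, c w)"
      by (auto simp: tree_of_def)
    then have "w \<in> {1..n}" "f w \<noteq> 0" by (auto simp: nonroots_def)
    moreover have "f w \<in> {1..n}"
      using forest_parent[OF ff \<open>w \<in> {1..n}\<close>] \<open>f w \<noteq> 0\<close> by auto
    moreover have "c w \<in> {1..k}" using c w(1) by auto
    ultimately show "t \<in> {1..n} \<times> {1..n} \<times> {1..k}" using w(2) by auto
  qed
  have "inj_on (\<lambda>w. (f w, w, c w)) (nonroots n f)"
    by (auto simp: inj_on_def)
  then have "card (tree_of n f c) = n - 1"
    unfolding tree_of_def by (simp add: card_image card_nonroots[OF f])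
  moreover have "acyclic {(u, w). \<exists>y. (u, w, y) \<in> tree_of n f c}"
  proof (rule acyclic_subset[OF wf_acyclic[OF wf_measure[of h]]])
    show "{(u, w). \<exists>y. (u, w, y) \<in> tree_of n f c} \<subseteq> Wellfounded.measure h"
      using h by (auto simp: in_tree_of nonroots_def)
  qed
  moreover have "u \<noteq> w" if "(u, w, y) \<in> tree_of n f c" for u w y
    using that forest_parent_ne[OF ff, of w] by (simp add: in_tree_of nonroots_def)
  then have "\<forall>(u, w, y)\<in>tree_of n f c. u \<noteq> w"
    by blast
  ultimately show ?thesis
    unfolding colored_rooted_tree_def using sub by (auto simp: tree_of_def)
qed

text \<open>The rank of a vertex is the number of its proper ancestors, which grows strictly along
  an arc because the relation is acyclic.\<close>

lemma acyclic_rank: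
  assumes "finite V" "R \<subseteq> V \<times> V" "acyclic R"
  shows "\<exists>h :: 'a \<Rightarrow> nat. \<forall>(u, w)\<in>R. h u < h w"
proof (rule exI[of _ "\<lambda>w. card {u. (u, w) \<in> R\<^sup>+}"], clarify)
  fix u w assume uw: "(u, w) \<in> R"
  have "R\<^sup>+ \<subseteq> V \<times> V"
    using assms(2) by (rule trancl_subset_Sigma)
  then have "finite {x. (x, w) \<in> R\<^sup>+}"
    using assms(1) by (auto intro: finite_subset)
  moreover have "{x. (x, u) \<in> R\<^sup>+} \<subset> {x. (x, w) \<in> R\<^sup>+}"
  proof
    show "{x. (x, u) \<in> R\<^sup>+} \<subseteq> {x. (x, w) \<in> R\<^sup>+}"
      using uw by (auto intro: trancl_into_trancl)
    have "u \<in> {x. (x, w) \<in> R\<^sup>+}" "u \<notin> {x. (x, u) \<in> R\<^sup>+}"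
      using uw assms(3) by (auto simp: acyclic_def)
    then show "{x. (x, u) \<in> R\<^sup>+} \<noteq> {x. (x, w) \<in> R\<^sup>+}" by blast
  qed
  ultimately show "card {x. (x, u) \<in> R\<^sup>+} < card {x. (x, w) \<in> R\<^sup>+}"
    by (rule psubset_card_mono)
qed

lemma colored_tree_of:
  assumes n: "1 \<le> n" and T: "colored_rooted_tree n k T"
  shows "\<exists>f\<in>trees n. \<exists>c\<in>PiE (nonroots n f) (\<lambda>_. {1..k}). T = tree_of n f c"
proof -
  have sub: "T \<subseteq> {1..n} \<times> {1..n} \<times> {1..k}" and card: "card T = n - 1"
    and uniq: "\<And>u w y u' y'. (u, w, y) \<in> T \<Longrightarrow> (u', w, y') \<in> T \<Longrightarrow> u = u' \<and> y = y'"
    and acyc: "acyclic {(u, w). \<exists>y. (u, w, y) \<in> T}"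
    using T unfolding colored_rooted_tree_def by fastforce+
  define par where "par w = (if \<exists>u y. (u, w, y) \<in> T then SOME u. \<exists>y. (u, w, y) \<in> T else 0)" for w
  define col where "col w = (SOME y. \<exists>u. (u, w, y) \<in> T)" for w
  have parcol: "par w = u \<and> col w = y" if "(u, w, y) \<in> T" for u w y
  proof -
    have ex: "\<exists>u y. (u, w, y) \<in> T" "\<exists>y u. (u, w, y) \<in> T"
      using that by blast+
    have "par w = (SOME u. \<exists>y. (u, w, y) \<in> T)"
      using ex(1) by (simp add: par_def)
    then have "\<exists>y. (par w, w, y) \<in> T"
      using someI_ex[OF ex(1)] by simp
    moreover have "\<exists>u. (u, w, col w) \<in> T"
      unfolding col_def using someI_ex[OF ex(2)] .
    ultimately show ?thesis
      using that uniq by blast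
  qed
  define f where "f = restrict par {1..n}"
  define c where "c = restrict col (nonroots n f)"
  have nr: "w \<in> nonroots n f \<longleftrightarrow> (\<exists>u y. (u, w, y) \<in> T)" for w
  proof
    assume "w \<in> nonroots n f"
    then show "\<exists>u y. (u, w, y) \<in> T"
      by (auto simp: nonroots_def f_def par_def split: if_splits)
  next
    assume "\<exists>u y. (u, w, y) \<in> T"
    then obtain u y where t: "(u, w, y) \<in> T" by blast
    then have "w \<in> {1..n}" "u \<in> {1..n}" "par w = u"
      using sub parcol by auto
    then show "w \<in> nonroots n f"
      by (auto simp: nonroots_def f_def)
  qed
  have memT: "(u, w, y) \<in> T \<longleftrightarrow> w \<in> nonroots n f \<and> u = f w \<and> y = c w" for u w y
  proof
    assume t: "(u, w, y) \<in> T"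
    then have "w \<in> nonroots n f" using nr by blast
    then show "w \<in> nonroots n f \<and> u = f w \<and> y = c w"
      using parcol[OF t] by (simp add: c_def) (simp add: f_def nonroots_def)
  next
    assume a: "w \<in> nonroots n f \<and> u = f w \<and> y = c w"
    then obtain u' y' where t: "(u', w, y') \<in> T" using nr by blast
    then have "u' = u" "y' = y"
      using parcol[OF t] a by (simp_all add: c_def) (simp add: f_def nonroots_def)
    then show "(u, w, y) \<in> T" using t by simp
  qed
  have TT: "T = tree_of n f c"
    using memT by (auto simp: in_tree_of set_eq_iff)
  have cP: "c \<in> PiE (nonroots n f) (\<lambda>_. {1..k})"
  proof (rule PiE_I)
    fix w assume "w \<in> nonroots n f"
    then have "(f w, w, c w) \<in> T" using memT by blast
    then show "c w \<in> {1..k}" using sub by auto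
  qed (simp add: c_def)
  have fP: "f \<in> PiE {1..n} (\<lambda>_. insert 0 {1..n})"
  proof (rule PiE_I)
    fix w assume "w \<in> {1..n}"
    show "f w \<in> insert 0 {1..n}"
    proof (cases "f w = 0")
      case False
      then have "(f w, w, c w) \<in> T" using memT \<open>w \<in> {1..n}\<close> by (simp add: nonroots_def)
      then show ?thesis using sub by auto
    qed simp
  qed (auto simp: f_def)
  have "{(u, w). \<exists>y. (u, w, y) \<in> T} \<subseteq> {1..n} \<times> {1..n}"
    using sub by auto
  from acyclic_rank[OF _ this acyc] obtain h :: "nat \<Rightarrow> nat"
    where h: "\<And>u w y. (u, w, y) \<in> T \<Longrightarrow> h u < h w" by auto
  \<comment> \<open>The ranks are raised by one so that the fictitious parent 0 of the roots lies
    strictly below all vertices.\<close>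
  define g where "g x = (if x = 0 then 0 else Suc (h x))" for x
  have "g (f w) < g w" if w: "w \<in> {1..n}" for w
  proof (cases "f w = 0")
    case True
    then show ?thesis using w by (simp add: g_def)
  next
    case False
    then have "(f w, w, c w) \<in> T" using memT w by (simp add: nonroots_def)
    from h[OF this] show ?thesis using w False by (simp add: g_def)
  qed
  then have "f \<in> forests {1..n}"
    using fP unfolding forests_def by blast
  moreover have "card {w \<in> {1..n}. f w = 0} = 1"
  proof -
    have "inj_on (\<lambda>w. (f w, w, c w)) (nonroots n f)"
      by (auto simp: inj_on_def)
    then have "card (nonroots n f) = n - 1"
      using card unfolding TT tree_of_def by (simp add: card_image)
    moreover have "{w \<in> {1..n}. f w = 0} = {1..n} - nonroots n f"
      by (auto simp: nonroots_def)
    moreover have "nonroots n f \<subseteq> {1..n}" by (auto simp: nonroots_def)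
    ultimately show ?thesis
      using n by (simp add: card_Diff_subset)
  qed
  ultimately have "f \<in> trees n" by (simp add: trees_def)
  then show ?thesis using cP TT by blast
qed

lemma bij_betw_tree_of:
  assumes "1 \<le> n"
  shows "bij_betw (\<lambda>(f, c). tree_of n f c) (SIGMA f:trees n. PiE (nonroots n f) (\<lambda>_. {1..k}))
           {T. colored_rooted_tree n k T}"
proof (rule bij_betw_imageI)
  let ?S = "SIGMA f:trees n. PiE (nonroots n f) (\<lambda>_. {1..k})"
  show "inj_on (\<lambda>(f, c). tree_of n f c) ?S"
  proof (rule inj_onI, clarify)
    fix f c f' c'
    assume f: "f \<in> trees n" "c \<in> PiE (nonroots n f) (\<lambda>_. {1..k})"
      and f': "f' \<in> trees n" "c' \<in> PiE (nonroots n f') (\<lambda>_. {1..k})"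
      and eq: "tree_of n f c = tree_of n f' c'"
    have mem: "w \<in> nonroots n f \<and> u = f w \<and> y = c w \<longleftrightarrow> w \<in> nonroots n f' \<and> u = f' w \<and> y = c' w" for u w y
      using eq by (metis in_tree_of)
    have nr: "nonroots n f = nonroots n f'"
      using mem by blast
    have "f w = f' w" for w
    proof (cases "w \<in> {1..n}")
      case True
      show ?thesis
      proof (cases "w \<in> nonroots n f")
        case True
        then show ?thesis using mem by blast
      next
        case False
        then have "w \<notin> nonroots n f'" using nr by simp
        then show ?thesis using True False by (simp add: nonroots_def)
      qed
    next
      case False
      then show ?thesis
        using f(1) f'(1) by (auto simp: trees_def forests_def PiE_def extensional_def)
    qed
    moreover have "c w = c' w" for w
      using mem nr f(2) f'(2) by (cases "w \<in> nonroots n f") (blast, auto simp: PiE_def extensional_def)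
    ultimately show "f = f' \<and> c = c'" by auto
  qed
  show "(\<lambda>(f, c). tree_of n f c) ` ?S = {T. colored_rooted_tree n k T}"
  proof (intro equalityI subsetI)
    fix T assume "T \<in> {T. colored_rooted_tree n k T}"
    then obtain f c where "f \<in> trees n" "c \<in> PiE (nonroots n f) (\<lambda>_. {1..k})" "T = tree_of n f c"
      using colored_tree_of[OF assms] by blast
    then show "T \<in> (\<lambda>(f, c). tree_of n f c) ` ?S"
      by (intro image_eqI[of _ _ "(f, c)"]) auto
  qed (use tree_of_colored in auto)
qed

section \<open>The condition on colors, vertex by vertex\<close>

definition ok_at :: "nat \<Rightarrow> nat \<Rightarrow> nat set \<Rightarrow> (nat \<Rightarrow> nat) \<Rightarrow> bool" where
  "ok_at K v C c \<longleftrightarrow> (C \<noteq> {} \<and> Min (c ` C) \<le> K \<longrightarrow> (\<exists>w\<in>C. c w = Min (c ` C) \<and> w < v))"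

text \<open>Every child of n is smaller than n, so a child of least color already serves as witness
  there; numbers outside 1, ..., n have no children.\<close>

lemma non_increasing_tree_of:
  assumes "f \<in> trees n"
  shows "non_increasing K (tree_of n f c) \<longleftrightarrow> (\<forall>v\<in>{1..<n}. ok_at K v {w \<in> nonroots n f. f w = v} c)"
proof -
  have ff: "f \<in> forests {1..n}" using assms by (simp add: trees_def)
  let ?C = "\<lambda>v. {w \<in> nonroots n f. f w = v}"
  have par: "f w \<in> {1..n}" "f w \<noteq> w" "w \<in> {1..n}" if "w \<in> nonroots n f" for w
    using that forest_parent[OF ff, of w] forest_parent_ne[OF ff, of w] by (auto simp: nonroots_def)
  have mc: "min_child_color (tree_of n f c) v = Min (c ` ?C v)" for v
  proof -
    have "{y. \<exists>w. (v, w, y) \<in> tree_of n f c} = c ` ?C v"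
      by (auto simp: in_tree_of)
    then show ?thesis by (simp add: min_child_color_def)
  qed
  have "non_increasing K (tree_of n f c) \<longleftrightarrow> (\<forall>v. ok_at K v (?C v) c)"
  proof -
    have "(\<exists>w y. (v, w, y) \<in> tree_of n f c) \<longleftrightarrow> ?C v \<noteq> {}" for v
      by (auto simp: in_tree_of)
    moreover have "(\<exists>w. (v, w, Min (c ` ?C v)) \<in> tree_of n f c \<and> w < v) \<longleftrightarrow>
        (\<exists>w\<in>?C v. c w = Min (c ` ?C v) \<and> w < v)" for v
      by (auto simp: in_tree_of) 
    ultimately show ?thesis
      unfolding non_increasing_def ok_at_def mc by simp
  qed
  also have "\<dots> \<longleftrightarrow> (\<forall>v\<in>{1..<n}. ok_at K v (?C v) c)"
  proof -
    have "ok_at K v (?C v) c" if v: "v \<notin> {1..<n}" for v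
      unfolding ok_at_def
    proof (intro impI, elim conjE)
      assume ne: "?C v \<noteq> {}"
      then obtain w0 where "w0 \<in> nonroots n f" "f w0 = v" by auto
      then have "v = n" using par(1)[of w0] v by auto
      have "Min (c ` ?C v) \<in> c ` ?C v"
        using ne by (intro Min_in) auto
      then obtain w where w: "w \<in> ?C v" "c w = Min (c ` ?C v)" by auto
      then have "w < v" using par[of w] \<open>v = n\<close> by auto
      then show "\<exists>w\<in>?C v. c w = Min (c ` ?C v) \<and> w < v" using w by blast
    qed
    then show ?thesis by blast
  qed
  finally show ?thesis .
qed

lemma num_root_edges_tree_of:
  "num_root_edges_col1 n (tree_of n f c) = card {w \<in> nonroots n f. f w = n \<and> c w = 1}"
proof -
  have "{t \<in> tree_of n f c. fst t = n \<and> snd (snd t) = 1} =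
      (\<lambda>w. (f w, w, c w)) ` {w \<in> nonroots n f. f w = n \<and> c w = 1}"
    by (auto simp: tree_of_def)
  moreover have "inj_on (\<lambda>w. (f w, w, c w)) {w \<in> nonroots n f. f w = n \<and> c w = 1}"
    by (auto simp: inj_on_def)
  ultimately show ?thesis
    unfolding num_root_edges_col1_def by (simp only: card_image)
qed

lemma prod_of_bool:
  "finite C \<Longrightarrow> (\<Prod>w\<in>C. of_bool (P w)) = (of_bool (\<forall>w\<in>C. P w) :: 'a :: comm_semiring_1)"
  by (induction C rule: finite_induct) auto

text \<open>Inclusion-exclusion over the least color K - j + 1 of the children: the choice (j, 0) demands
  that all colors are at least K - j + 1, the choice (j, 1) moreover that no child smaller than the
  vertex attains it.\<close>

lemma ok_at_indicator:
  assumes fin: "finite C" and pos: "\<And>w. w \<in> C \<Longrightarrow> 1 \<le> c w"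
  shows "(\<Sum>(j, e)\<in>choices K. (-1) ^ e *
            (\<Prod>w\<in>C. of_bool (K - j + (if w < v then e else 0) < c w))) = (of_bool (ok_at K v C c) :: real)"
proof -
  define P where "P j \<longleftrightarrow> (\<forall>w\<in>C. K - j < c w)" for j
  define Q where "Q j \<longleftrightarrow> (\<forall>w\<in>C. K - j + (if w < v then 1 else 0) < c w)" for j
  define \<phi> where "\<phi> j e = (\<Prod>w\<in>C. of_bool (K - j + (if w < v then e else 0) < c w) :: real)" for j e
  have \<phi>0: "\<phi> j 0 = of_bool (P j)" for j
    unfolding \<phi>_def prod_of_bool[OF fin] P_def by simp
  have \<phi>1: "\<phi> j 1 = of_bool (Q j)" for j
    unfolding \<phi>_def prod_of_bool[OF fin] Q_def by simp
  have \<phi>1': "\<phi> j (Suc 0) = of_bool (Q j)" for j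
    using \<phi>1 by simp
  have "(\<Sum>(j, e)\<in>choices K. (-1) ^ e * \<phi> j e) = (\<Sum>j\<le>K. \<phi> j 0 - \<phi> j 1) + \<phi> 0 1"
    by (rule sum_choices)
  also have "\<dots> = of_bool (P 0) + (\<Sum>j\<in>{1..K}. \<phi> j 0 - \<phi> j 1)"
    by (simp add: atMost_atLeast0 sum.atLeast_Suc_atMost \<phi>0 \<phi>1')
  also have "\<dots> = of_bool (ok_at K v C c)"
  proof (cases "C = {}")
    case True
    then show ?thesis
      by (simp add: P_def Q_def \<phi>0 \<phi>1' ok_at_def)
  next
    case ne: False
    define \<mu> where "\<mu> = Min (c ` C)"
    have min: "\<mu> \<le> c w" if "w \<in> C" for w
      using that fin by (simp add: \<mu>_def)
    have "\<mu> \<in> c ` C"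
      unfolding \<mu>_def using ne fin by (intro Min_in) auto
    then obtain w0 where w0: "w0 \<in> C" "c w0 = \<mu>" by auto
    have "1 \<le> \<mu>" using pos[OF w0(1)] w0(2) by simp
    have PP: "P j \<longleftrightarrow> K - j < \<mu>" for j
      unfolding P_def using w0 min by (metis less_le_trans)
    \<comment> \<open>The difference indicates that all colors are at least K - j + 1 and that a
      smaller child attains this value. Only the j for which it is the least color \<mu> can
      contribute, namely j = K + 1 - \<mu>.\<close>
    have diff: "\<phi> j 0 - \<phi> j 1 = (if j = K + 1 - \<mu> then of_bool (ok_at K v C c) else 0)" if j: "j \<in> {1..K}" for j
    proof -
      have QQ: "Q j \<longleftrightarrow> K - j < \<mu> \<and> (\<forall>w\<in>C. w < v \<longrightarrow> K - j + 1 < c w)"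
      proof -
        have "Q j \<longleftrightarrow> P j \<and> (\<forall>w\<in>C. w < v \<longrightarrow> K - j + 1 < c w)"
        proof -
          have "K - j + (if w < v then 1 else 0) < c w \<longleftrightarrow>
              K - j < c w \<and> (w < v \<longrightarrow> K - j + 1 < c w)" for w
            by auto
          then show ?thesis
            unfolding Q_def P_def by blast
        qed
        then show ?thesis by (simp add: PP)
      qed
      show ?thesis
      proof (cases "j = K + 1 - \<mu>")
        case True
        then have mu: "\<mu> = K - j + 1" "\<mu> \<le> K" using j by auto
        have "(\<forall>w\<in>C. w < v \<longrightarrow> K - j + 1 < c w) \<longleftrightarrow> \<not> (\<exists>w\<in>C. c w = \<mu> \<and> w < v)"
          using min mu(1) by (metis le_neq_implies_less less_irrefl)
        then have "Q j \<longleftrightarrow> \<not> (\<exists>w\<in>C. c w = \<mu> \<and> w < v)"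
          unfolding QQ using mu(1) by simp
        moreover have "P j"
          unfolding PP using mu(1) by simp
        moreover have "ok_at K v C c \<longleftrightarrow> (\<exists>w\<in>C. c w = \<mu> \<and> w < v)"
          unfolding ok_at_def \<mu>_def[symmetric] using ne mu(2) by simp
        ultimately show ?thesis
          using True by (simp add: \<phi>0 \<phi>1')
      next
        case False
        then have "\<mu> \<noteq> K - j + 1" using j by auto
        then have "P j \<longleftrightarrow> Q j"
        proof -
          have "K - j + 1 < c w" if "K - j < \<mu>" "w \<in> C" for w
            using min[OF that(2)] that(1) \<open>\<mu> \<noteq> K - j + 1\<close> by linarith
          then show ?thesis
            unfolding PP QQ by blast
        qed
        then show ?thesis using False by (simp add: \<phi>0 \<phi>1')
      qed
    qed
    have "(\<Sum>j\<in>{1..K}. \<phi> j 0 - \<phi> j 1) =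
        (\<Sum>j\<in>{1..K}. if j = K + 1 - \<mu> then of_bool (ok_at K v C c) else 0)"
      by (rule sum.cong[OF refl]) (rule diff)
    also have "\<dots> = (if \<mu> \<le> K then of_bool (ok_at K v C c) else 0)"
      using \<open>1 \<le> \<mu>\<close> by (auto simp: sum.delta)
    finally have "(\<Sum>j\<in>{1..K}. \<phi> j 0 - \<phi> j 1) = (if \<mu> \<le> K then of_bool (ok_at K v C c) else 0)" .
    moreover have "P 0 \<longleftrightarrow> \<not> \<mu> \<le> K" by (simp add: PP not_le)
    moreover have "\<not> \<mu> \<le> K \<Longrightarrow> ok_at K v C c"
      unfolding ok_at_def \<mu>_def by simp
    ultimately show ?thesis by auto
  qed
  finally show ?thesis
    unfolding \<phi>_def .
qed

text \<open>Membership in \<open>choices\<close> gives j \<le> K, so the subtraction is exact, and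
  keeps the threshold at most K even with the flag, so the count of colors above it is linear in j
  and e.\<close>

lemma card_colors:
  assumes "(j, e) \<in> choices K"
  shows "(\<Sum>y\<in>{1..K + k2}. of_bool (K - j + (if b then e else 0) < y)) =
         real k2 + real j - (if b then real e else 0)"
proof -
  let ?s = "K - j + (if b then e else 0)"
  have s: "?s \<le> K + k2" "real ?s = real K - real j + (if b then real e else 0)"
    using assms by (auto simp: choices_def of_nat_diff)
  have "(\<Sum>y\<in>{1..K + k2}. of_bool (?s < y)) = (\<Sum>y\<in>{1..K + k2}. if ?s < y then 1 else 0 :: real)"
    by (simp add: of_bool_def)
  also have "\<dots> = real (card {y \<in> {1..K + k2}. ?s < y})"
    by (simp add: sum.inter_filter[symmetric])
  also have "{y \<in> {1..K + k2}. ?s < y} = {?s<..K + k2}"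
    by auto
  also have "real (card {?s<..K + k2}) = real (K + k2) - real ?s"
    using s(1) by (simp add: of_nat_diff)
  finally show ?thesis using s(2) by simp
qed

text \<open>Expanding the indicator at each of the vertices 1, ..., m gives a sum over functions
  \<kappa> of products over edges. For fixed \<kappa> the colors of different edges are independent,
  so summing them leaves a weight that depends only on the parent and on the direction of the edge.
  Vertex n carries no condition: color 1 contributes x and each of the other K + k2 - 1 colors
  contributes 1.\<close>

theorem colored_tree_sum:
  fixes x :: real and m K k2 :: nat
  defines "A \<equiv> \<lambda>\<kappa> u. if u = Suc m then real (K + k2) - 1 + x else real k2 + real (fst (\<kappa> u))"
    and "D \<equiv> \<lambda>\<kappa> u. if u = Suc m then real (K + k2) - 1 + x else real k2 + real (fst (\<kappa> u)) - real (snd (\<kappa> u))"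
  assumes K: "1 \<le> K"
  shows "(\<Sum>T | colored_rooted_tree (Suc m) (K + k2) T \<and> non_increasing K T. x ^ num_root_edges_col1 (Suc m) T) =
    (\<Sum>\<kappa>\<in>PiE {1..m} (\<lambda>_. choices K). (\<Prod>u\<in>{1..m}. (-1) ^ snd (\<kappa> u)) *
       (\<Prod>i\<in>{1..m}. (\<Sum>u\<in>{1..i}. A \<kappa> u) + (\<Sum>u\<in>{i<..Suc m}. D \<kappa> u)))"
proof -
  let ?n = "Suc m" and ?k = "K + k2"
  let ?NR = "nonroots ?n"
  let ?Ks = "PiE {1..m} (\<lambda>_. choices K)"
  let ?sg = "\<lambda>\<kappa>. (\<Prod>u\<in>{1..m}. (-1 :: real) ^ snd (\<kappa> u :: nat \<times> nat))"
  let ?T = "tree_of ?n" and ?num = "num_root_edges_col1 ?n" and ?ni = "non_increasing K"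
  let ?Cs = "\<lambda>f. PiE (?NR f) (\<lambda>_. {1..?k})"
  define I where "I = (\<lambda>(v :: nat) (j, e) (w :: nat) y. of_bool (K - j + (if w < v then e else 0) < y) :: real)"
  define J where "J \<kappa> u w y = (if u = ?n then (if y = 1 then x else 1) else I u (\<kappa> u) w y)"
    for \<kappa> :: "nat \<Rightarrow> nat \<times> nat" and u w y :: nat
  let ?J = "\<lambda>\<kappa> f c. (\<Prod>w\<in>?NR f. J \<kappa> (f w) w (c w))"
  have finT: "finite {T. colored_rooted_tree ?n ?k T}"
    by (rule finite_subset[of _ "Pow ({1..?n} \<times> {1..?n} \<times> {1..?k})"]) (auto simp: colored_rooted_tree_def)
  have fint: "finite (trees ?n)"
    unfolding trees_def by simp
  have finC: "finite (?Cs f)" for f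
    by (intro finite_PiE) auto
  have summand: "(if ?ni (?T f c) then x ^ ?num (?T f c) else 0) =
      (\<Sum>\<kappa>\<in>?Ks. ?sg \<kappa> * ?J \<kappa> f c)"
    if f: "f \<in> trees ?n" and c: "c \<in> ?Cs f" for f c
  proof -
    let ?C = "\<lambda>v. {w \<in> ?NR f. f w = v}"
    have par: "f w \<in> {1..?n}" if "w \<in> ?NR f" for w
      using that f forest_parent[of f "{1..?n}" w] by (auto simp: nonroots_def trees_def)
    have "of_bool (?ni (?T f c)) = (\<Prod>v\<in>{1..m}. of_bool (ok_at K v (?C v) c) :: real)"
      unfolding non_increasing_tree_of[OF f] prod_of_bool[OF finite_atLeastAtMost]
      by (simp add: atLeastLessThanSuc_atLeastAtMost)
    also have "\<dots> = (\<Prod>v\<in>{1..m}. \<Sum>p\<in>choices K. (-1) ^ snd p * (\<Prod>w\<in>?C v. I v p w (c w)))"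
    proof (rule prod.cong[OF refl])
      fix v
      have "(\<Sum>(j, e)\<in>choices K. (-1) ^ e *
            (\<Prod>w\<in>?C v. of_bool (K - j + (if w < v then e else 0) < c w))) = (of_bool (ok_at K v (?C v) c) :: real)"
        by (rule ok_at_indicator) (use c in auto)
      then show "of_bool (ok_at K v (?C v) c) = (\<Sum>p\<in>choices K. (-1) ^ snd p * (\<Prod>w\<in>?C v. I v p w (c w)))"
        by (simp add: I_def case_prod_beta)
    qed
    also have "\<dots> = (\<Sum>\<kappa>\<in>?Ks. \<Prod>v\<in>{1..m}. (-1) ^ snd (\<kappa> v) * (\<Prod>w\<in>?C v. I v (\<kappa> v) w (c w)))"
      by (rule prod_sum_PiE) auto
    finally have ind: "of_bool (?ni (?T f c)) =
        (\<Sum>\<kappa>\<in>?Ks. ?sg \<kappa> *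
           (\<Prod>v\<in>{1..m}. \<Prod>w\<in>?C v. I v (\<kappa> v) w (c w)))"
      by (simp add: prod.distrib)
    have num: "x ^ ?num (?T f c) =
        (\<Prod>w\<in>?NR f. if f w = ?n \<and> c w = 1 then x else 1)"
      unfolding num_root_edges_tree_of by (simp add: prod.inter_filter[symmetric])
    have fib: "(\<Prod>v\<in>{1..m}. \<Prod>w\<in>?C v. I v (\<kappa> v) w (c w)) =
        (\<Prod>w\<in>?NR f. if f w = ?n then 1 else I (f w) (\<kappa> (f w)) w (c w))" for \<kappa>
    proof -
      have "(\<Prod>v\<in>{1..m}. \<Prod>w\<in>?C v. I v (\<kappa> v) w (c w)) =
          (\<Prod>v\<in>{1..m}. \<Prod>w\<in>?NR f. if f w = v then I v (\<kappa> v) w (c w) else 1)"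
        by (simp add: prod.inter_filter)
      also have "\<dots> = (\<Prod>w\<in>?NR f. \<Prod>v\<in>{1..m}. if f w = v then I v (\<kappa> v) w (c w) else 1)"
        by (rule prod.swap)
      also have "\<dots> = (\<Prod>w\<in>?NR f. if f w = ?n then 1 else I (f w) (\<kappa> (f w)) w (c w))"
      proof (rule prod.cong[OF refl])
        fix w assume "w \<in> ?NR f"
        from par[OF this] show "(\<Prod>v\<in>{1..m}. if f w = v then I v (\<kappa> v) w (c w) else 1) =
            (if f w = ?n then 1 else I (f w) (\<kappa> (f w)) w (c w))"
          by (auto simp: prod.delta)
      qed
      finally show ?thesis .
    qed
    have "(if ?ni (?T f c) then x ^ ?num (?T f c) else 0) =
        of_bool (?ni (?T f c)) * x ^ ?num (?T f c)"
      by simp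
    also have "\<dots> = (\<Sum>\<kappa>\<in>?Ks. ?sg \<kappa> *
        ((\<Prod>w\<in>?NR f. if f w = ?n then 1 else I (f w) (\<kappa> (f w)) w (c w)) *
         (\<Prod>w\<in>?NR f. if f w = ?n \<and> c w = 1 then x else 1)))"
      unfolding ind num fib sum_distrib_right by (simp only: mult.assoc)
    also have "\<dots> = (\<Sum>\<kappa>\<in>?Ks. ?sg \<kappa> * ?J \<kappa> f c)"
    proof -
      have "(\<Prod>w\<in>?NR f. if f w = ?n then 1 else I (f w) (\<kappa> (f w)) w (c w)) *
         (\<Prod>w\<in>?NR f. if f w = ?n \<and> c w = 1 then x else 1) = ?J \<kappa> f c" for \<kappa>
        unfolding prod.distrib[symmetric] by (rule prod.cong[OF refl]) (simp add: J_def)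
      then show ?thesis by (simp only:)
    qed
    finally show ?thesis .
  qed
  have colors: "(\<Sum>y\<in>{1..?k}. J \<kappa> u w y) = (if u < w then A \<kappa> u else D \<kappa> u)"
    if "\<kappa> \<in> ?Ks" "u \<in> {1..?n}" "u \<noteq> w" for \<kappa> u w
  proof (cases "u = ?n")
    case True
    have "(\<Sum>y\<in>{1..?k}. J \<kappa> u w y) = (\<Sum>y\<in>{1..?k}. (if y = 1 then x - 1 else 0) + 1)"
      unfolding J_def using True by (intro sum.cong) auto
    also have "\<dots> = x - 1 + real ?k"
      using K by (subst sum.distrib) (simp add: sum.delta)
    finally show ?thesis using True by (simp add: A_def D_def)
  next
    case False
    then have "\<kappa> u \<in> choices K" using that by auto
    then obtain j e where je: "\<kappa> u = (j, e)" "(j, e) \<in> choices K" by (metis surj_pair)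
    have "(\<Sum>y\<in>{1..?k}. J \<kappa> u w y) = real k2 + real j - (if w < u then real e else 0)"
      unfolding J_def I_def je(1) using False card_colors[OF je(2), where ?k2.0 = k2 and b = "w < u"] by simp
    then show ?thesis
      using False that(3) je(1) by (auto simp: A_def D_def)
  qed
  have "(\<Sum>T | colored_rooted_tree ?n ?k T \<and> ?ni T. x ^ ?num T) =
      (\<Sum>T | colored_rooted_tree ?n ?k T. if ?ni T then x ^ ?num T else 0)"
    using sum.inter_filter[OF finT, of "\<lambda>T. x ^ ?num T" "?ni"] by simp
  also have "\<dots> = (\<Sum>(f, c)\<in>(SIGMA f:trees ?n. ?Cs f).
      if ?ni (?T f c) then x ^ ?num (?T f c) else 0)"
    by (subst sum.reindex_bij_betw[OF bij_betw_tree_of, symmetric]) (auto intro!: sum.cong)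
  also have "\<dots> = (\<Sum>f\<in>trees ?n. \<Sum>c\<in>?Cs f.
      if ?ni (?T f c) then x ^ ?num (?T f c) else 0)"
    using fint finC by (subst sum.Sigma) auto
  also have "\<dots> = (\<Sum>f\<in>trees ?n. \<Sum>c\<in>?Cs f. \<Sum>\<kappa>\<in>?Ks.
      ?sg \<kappa> * ?J \<kappa> f c)"
    by (intro sum.cong[OF refl] summand)
  also have "\<dots> = (\<Sum>f\<in>trees ?n. \<Sum>\<kappa>\<in>?Ks. \<Sum>c\<in>?Cs f.
      ?sg \<kappa> * ?J \<kappa> f c)"
    by (intro sum.cong[OF refl] sum.swap)
  also have "\<dots> = (\<Sum>\<kappa>\<in>?Ks. \<Sum>f\<in>trees ?n. \<Sum>c\<in>?Cs f.
      ?sg \<kappa> * ?J \<kappa> f c)"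
    by (rule sum.swap)
  also have "\<dots> = (\<Sum>\<kappa>\<in>?Ks. ?sg \<kappa> *
       (\<Prod>i\<in>{1..m}. (\<Sum>u\<in>{1..i}. A \<kappa> u) + (\<Sum>u\<in>{i<..Suc m}. D \<kappa> u)))"
  proof (rule sum.cong[OF refl])
    fix \<kappa> assume \<kappa>: "\<kappa> \<in> ?Ks"
    have "(\<Sum>c\<in>?Cs f. \<Prod>w\<in>?NR f. J \<kappa> (f w) w (c w)) =
        (\<Prod>w\<in>{w \<in> {1..?n}. f w \<noteq> 0}. if f w < w then A \<kappa> (f w) else D \<kappa> (f w))" if f: "f \<in> trees ?n" for f
    proof -
      have ff: "f \<in> forests {1..?n}" using f by (simp add: trees_def)
      have "(\<Sum>c\<in>?Cs f. \<Prod>w\<in>?NR f. J \<kappa> (f w) w (c w)) = (\<Prod>w\<in>?NR f. \<Sum>y\<in>{1..?k}. J \<kappa> (f w) w y)"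
        by (rule prod_sum_PiE[symmetric]) auto
      also have "\<dots> = (\<Prod>w\<in>?NR f. if f w < w then A \<kappa> (f w) else D \<kappa> (f w))"
      proof (rule prod.cong[OF refl])
        fix w assume "w \<in> ?NR f"
        then have w: "w \<in> {1..?n}" "f w \<noteq> 0" by (auto simp: nonroots_def)
        show "(\<Sum>y\<in>{1..?k}. J \<kappa> (f w) w y) = (if f w < w then A \<kappa> (f w) else D \<kappa> (f w))"
          using forest_parent[OF ff w(1)] forest_parent_ne[OF ff w(1)] w(2)
          by (intro colors[OF \<kappa>]) auto
      qed
      finally show ?thesis by (simp only: nonroots_def)
    qed
    then have "(\<Sum>f\<in>trees ?n. \<Sum>c\<in>?Cs f. ?sg \<kappa> * ?J \<kappa> f c) =
        ?sg \<kappa> *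
        (\<Sum>f\<in>trees ?n. \<Prod>w\<in>{w \<in> {1..?n}. f w \<noteq> 0}. if f w < w then A \<kappa> (f w) else D \<kappa> (f w))"
      unfolding sum_distrib_left[symmetric] by (intro arg_cong2[of _ _ _ _ "(*)"] sum.cong refl) blast
    then show "(\<Sum>f\<in>trees ?n. \<Sum>c\<in>?Cs f. ?sg \<kappa> * ?J \<kappa> f c) =
        ?sg \<kappa> *
        (\<Prod>i\<in>{1..m}. (\<Sum>u\<in>{1..i}. A \<kappa> u) + (\<Sum>u\<in>{i<..Suc m}. D \<kappa> u))"
      unfolding tree_sum_updown .
  qed
  finally show ?thesis .
qed

section \<open>Comparing bases and trees\<close>

text \<open>With x n = 0 the edge from i to n excludes the residues 0, ..., k2 - 1 and the top K +
  k2 residues. Inside the remaining interval all differences are too small to wrap around modulo q,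
  so congruences between the other vertices become equalities of integers.\<close>

lemma proper_points_eq:
  fixes q :: int and m K k2 :: nat
  assumes r: "gain_graph (Suc m) (1 - int k2) (int K + int k2) r"
  shows "{x \<in> gain_graph.box (Suc m) q. \<forall>e\<in>gain_edges (Suc m) (1 - int k2) (int K + int k2). \<not> q dvd lval x e} =
    {x. (\<forall>i. (i \<in> {1..m} \<longrightarrow> int k2 \<le> x i \<and> x i < q - (int K + int k2)) \<and> (i \<notin> {1..m} \<longrightarrow> x i = 0)) \<and>
        (\<forall>i\<in>{1..m}. \<forall>j\<in>{1..m}. i < j \<longrightarrow> gaps.rho K k2 x i j \<or> gaps.rho K k2 x j i)}"
    (is "?L = ?R")
proof -
  interpret gain_graph "Suc m" "1 - int k2" "int K + int k2" r by (rule r)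
  interpret gaps K k2 .
  have ivl: "{1..<Suc m} = {1..m}" by auto
  have nodvd: "\<not> q dvd z" if "z \<noteq> 0" "\<bar>z\<bar> < q" for z
    using that zdvd_imp_le[of q "\<bar>z\<bar>"] by auto
  show ?thesis
  proof (intro equalityI subsetI)
    fix x assume "x \<in> ?L"
    then have box: "x \<in> box q" and pr: "\<And>e. e \<in> E \<Longrightarrow> \<not> q dvd lval x e" by auto
    have xi: "0 \<le> x i" "x i < q" if "i \<in> {1..m}" for i
      using box that unfolding box_def ivl by auto
    have x0: "x i = 0" if "i \<notin> {1..m}" for i
      using box that unfolding box_def ivl by auto
    have xn: "x (Suc m) = 0" by (rule x0) simp
    have bounds: "int k2 \<le> x i \<and> x i < q - (int K + int k2)" if i: "i \<in> {1..m}" for i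
    proof (rule ccontr)
      assume "\<not> ?thesis"
      then consider "x i < int k2" | "q - (int K + int k2) \<le> x i" by linarith
      then show False
      proof cases
        case 1
        then have "(i, Suc m, - x i) \<in> E"
          using xi[OF i] i by (auto simp: gain_edges_iff)
        from pr[OF this] show False by (simp add: lval_def gain_def xn)
      next
        case 2
        then have "(i, Suc m, q - x i) \<in> E"
          using xi[OF i] i by (auto simp: gain_edges_iff)
        from pr[OF this] show False by (simp add: lval_def gain_def xn)
      qed
    qed
    have "rho x i j \<or> rho x j i" if ij: "i \<in> {1..m}" "j \<in> {1..m}" "i < j" for i j
    proof (rule ccontr)
      assume "\<not> ?thesis"
      then have "(i, j, x j - x i) \<in> E"
        using ij by (auto simp: gain_edges_iff rho_def gap_def)
      from pr[OF this] show False by (simp add: lval_def gain_def)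
    qed
    then show "x \<in> ?R"
      using bounds x0 by blast
  next
    fix x assume x: "x \<in> ?R"
    have bounds: "int k2 \<le> x i" "x i < q - (int K + int k2)" if "i \<in> {1..m}" for i
      using x that by auto
    have x0: "x i = 0" if "i \<notin> {1..m}" for i
      using x that by auto
    have "x \<in> box q"
      unfolding box_def ivl using bounds x0 by (auto; smt (verit) of_nat_0_le_iff)
    moreover have "\<not> q dvd lval x (i, j, g)" if e: "(i, j, g) \<in> E" for i j g
    proof (rule nodvd)
      have g: "1 - int k2 \<le> g" "g \<le> int K + int k2" "1 \<le> i" "i < j" "j \<le> Suc m"
        using e by (auto simp: gain_edges_iff)
      have lv: "lval x (i, j, g) = x j - x i - g" by (simp add: lval_def gain_def)
      have i: "i \<in> {1..m}" using g by auto
      have "lval x (i, j, g) \<noteq> 0 \<and> \<bar>lval x (i, j, g)\<bar> < q"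
      proof (cases "j = Suc m")
        case True
        then have "x j = 0" by (intro x0) simp
        then show ?thesis using bounds[OF i] g unfolding lv by linarith
      next
        case False
        then have j: "j \<in> {1..m}" using g by auto
        have "rho x i j \<or> rho x j i" using x i j g by blast
        then have "x j - x i \<ge> int K + int k2 + 1 \<or> x i - x j \<ge> int k2"
          using g by (auto simp: rho_def gap_def)
        then show ?thesis using bounds[OF i] bounds[OF j] g unfolding lv by linarith
      qed
      then show "lval x (i, j, g) \<noteq> 0" "\<bar>lval x (i, j, g)\<bar> < q" by auto
    qed
    ultimately show "x \<in> ?L" by auto
  qed
qed

text \<open>At 1 - q vertex n contributes K + k2 - q to every factor. Any other vertex u contributes
  k2 plus its first choice to every factor, whichever side of i it lies on; only the flags depend on
  i. Taking -1 out of each of the m factors gives the argument q - (K + k2) - m k2.\<close>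

lemma tree_sum_choice_sum:
  fixes q :: int
  assumes K: "1 \<le> K"
  shows "(\<Sum>T | colored_rooted_tree (Suc m) (K + k2) T \<and> non_increasing K T.
            (1 - real_of_int q) ^ num_root_edges_col1 (Suc m) T) =
         (-1) ^ m * choice_sum K m (\<lambda>_. 1) 0 (real_of_int q - real (K + k2) - real m * real k2)"
proof -
  let ?R = "real_of_int q - real (K + k2) - real m * real k2"
  define A where "A = (\<lambda>(\<kappa> :: nat \<Rightarrow> nat \<times> nat) u. if u = Suc m then real (K + k2) - 1 + (1 - real_of_int q)
    else real k2 + real (fst (\<kappa> u)))"
  define D where "D = (\<lambda>(\<kappa> :: nat \<Rightarrow> nat \<times> nat) u. if u = Suc m then real (K + k2) - 1 + (1 - real_of_int q)
    else real k2 + real (fst (\<kappa> u)) - real (snd (\<kappa> u)))"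
  have factor: "(\<Sum>u\<in>{1..i}. A \<kappa> u) + (\<Sum>u\<in>{i<..Suc m}. D \<kappa> u) =
      - 1 * (?R - (\<Sum>u\<in>{1..m}. real (fst (\<kappa> u))) + 0 + (\<Sum>u\<in>{i<..m}. real (snd (\<kappa> u))))"
    if i: "i \<in> {1..m}" for i \<kappa>
  proof -
    have "{i<..Suc m} = insert (Suc m) {i<..m}" using i by auto
    then have "(\<Sum>u\<in>{i<..Suc m}. D \<kappa> u) = real (K + k2) - real_of_int q + (\<Sum>u\<in>{i<..m}. D \<kappa> u)"
      by (simp add: D_def)
    also have "(\<Sum>u\<in>{i<..m}. D \<kappa> u) = (\<Sum>u\<in>{i<..m}. (real k2 + real (fst (\<kappa> u))) - real (snd (\<kappa> u)))"
      by (rule sum.cong) (auto simp: D_def)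
    also have "\<dots> = (\<Sum>u\<in>{i<..m}. real k2 + real (fst (\<kappa> u))) - (\<Sum>u\<in>{i<..m}. real (snd (\<kappa> u)))"
      by (rule sum_subtractf)
    finally have d: "(\<Sum>u\<in>{i<..Suc m}. D \<kappa> u) = real (K + k2) - real_of_int q +
        ((\<Sum>u\<in>{i<..m}. real k2 + real (fst (\<kappa> u))) - (\<Sum>u\<in>{i<..m}. real (snd (\<kappa> u))))" .
    have a: "(\<Sum>u\<in>{1..i}. A \<kappa> u) = (\<Sum>u\<in>{1..i}. real k2 + real (fst (\<kappa> u)))"
      by (rule sum.cong) (use i in \<open>auto simp: A_def\<close>)
    have "{1..m} = {1..i} \<union> {i<..m}" using i by auto
    then have "(\<Sum>u\<in>{1..m}. real k2 + real (fst (\<kappa> u))) =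
        (\<Sum>u\<in>{1..i}. real k2 + real (fst (\<kappa> u))) + (\<Sum>u\<in>{i<..m}. real k2 + real (fst (\<kappa> u)))"
      by (simp only:) (rule sum.union_disjoint, auto)
    moreover have "(\<Sum>u\<in>{1..m}. real k2 + real (fst (\<kappa> u))) = real m * real k2 + (\<Sum>u\<in>{1..m}. real (fst (\<kappa> u)))"
      by (simp add: sum.distrib)
    ultimately show ?thesis
      unfolding a d by simp
  qed
  have "(\<Prod>i\<in>{1..m}. (\<Sum>u\<in>{1..i}. A \<kappa> u) + (\<Sum>u\<in>{i<..Suc m}. D \<kappa> u)) =
      (-1) ^ m * (\<Prod>i\<in>{1..m}. ?R - (\<Sum>u\<in>{1..m}. real (fst (\<kappa> u))) + 0 + (\<Sum>u\<in>{i<..m}. real (snd (\<kappa> u))))"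
    for \<kappa> :: "nat \<Rightarrow> nat \<times> nat"
  proof -
    have "(\<Prod>i\<in>{1..m}. (\<Sum>u\<in>{1..i}. A \<kappa> u) + (\<Sum>u\<in>{i<..Suc m}. D \<kappa> u)) =
        (\<Prod>i\<in>{1..m}. - 1 * (?R - (\<Sum>u\<in>{1..m}. real (fst (\<kappa> u))) + 0 + (\<Sum>u\<in>{i<..m}. real (snd (\<kappa> u)))))"
      by (rule prod.cong[OF refl factor])
    also have "\<dots> = (\<Prod>i\<in>{1..m}. - 1) *
        (\<Prod>i\<in>{1..m}. ?R - (\<Sum>u\<in>{1..m}. real (fst (\<kappa> u))) + 0 + (\<Sum>u\<in>{i<..m}. real (snd (\<kappa> u))))"
      by (rule prod.distrib)
    finally show ?thesis by simp
  qed
  then have "(\<Sum>\<kappa>\<in>PiE {1..m} (\<lambda>_. choices K). (\<Prod>u\<in>{1..m}. (-1) ^ snd (\<kappa> u)) *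
       (\<Prod>i\<in>{1..m}. (\<Sum>u\<in>{1..i}. A \<kappa> u) + (\<Sum>u\<in>{i<..Suc m}. D \<kappa> u))) =
     (-1) ^ m * choice_sum K m (\<lambda>_. 1) 0 ?R"
    unfolding choice_sum_def sum_distrib_left by (intro sum.cong refl) (simp only: mult.left_commute mult_1_right)
  then show ?thesis
    using colored_tree_sum[OF K, where x = "1 - real_of_int q" and m = m and ?k2.0 = k2] unfolding A_def D_def by simp
qed

lemma card_eq_if_powers_eq:
  assumes "finite X" "finite Y" "infinite S"
    and "\<And>x :: real. x \<in> S \<Longrightarrow> (\<Sum>a\<in>X. x ^ f a) = (\<Sum>b\<in>Y. x ^ g b)"
  shows "card {a \<in> X. f a = \<alpha>} = card {b \<in> Y. g b = \<alpha>}"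
proof -
  define P where "P = (\<Sum>a\<in>X. monom (1 :: real) (f a)) - (\<Sum>b\<in>Y. monom 1 (g b))"
  have "poly P x = 0" if "x \<in> S" for x
    using assms(4)[OF that] by (simp add: P_def poly_sum poly_monom)
  then have "S \<subseteq> {x. poly P x = 0}" by auto
  then have "P = 0"
    using assms(3) poly_roots_finite finite_subset by blast
  then have "coeff (\<Sum>a\<in>X. monom (1 :: real) (f a)) \<alpha> = coeff (\<Sum>b\<in>Y. monom 1 (g b)) \<alpha>"
    by (simp add: P_def)
  then have "(\<Sum>a\<in>X. if f a = \<alpha> then 1 else 0 :: real) = (\<Sum>b\<in>Y. if g b = \<alpha> then 1 else 0)"
    by (simp add: coeff_sum)
  then show ?thesis
    using assms(1,2) by (simp add: sum.inter_filter[symmetric])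
qed

theorem nbc_bases_trees:
  fixes n k1 k2 \<alpha> :: nat and r :: "gedge \<Rightarrow> nat"
  assumes n2: "2 \<le> n" and k1: "1 \<le> k1"
    and inj: "inj_on r (gain_edges n (1 - int k2) (int k1 + int k2))"
  shows "card {B. nbc_basis r n (1 - int k2) (int k1 + int k2) B \<and>
                  activity r n (1 - int k2) (int k1 + int k2) B = \<alpha>} =
         card {T. colored_rooted_tree n (k1 + k2) T \<and> non_increasing k1 T \<and> num_root_edges_col1 n T = \<alpha>}"
proof -
  define a b where "a = 1 - int k2" and "b = int k1 + int k2"
  obtain m where m: "n = Suc m" "1 \<le> m" using n2 by (cases n) auto
  have G: "gain_graph n a b r"
    using n2 k1 inj by unfold_locales (auto simp: a_def b_def)
  interpret gain_graph n a b r by (rule G)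
  interpret gaps k1 k2 .
  \<comment> \<open>The first summand makes circles that are balanced modulo q balanced. The others
    keep the upper index of every binomial nonnegative, for up to m ascents, so that it agrees with
    the generalized binomial.\<close>
  define q0 where "q0 = int n * (\<bar>a\<bar> + \<bar>b\<bar>) + int (k1 + k2) + int m * int k2 + int m * (int k1 + 1)"
  let ?X = "{B. nbc_basis r n a b B}"
  let ?Y = "{T. colored_rooted_tree n (k1 + k2) T \<and> non_increasing k1 T}"
  have sums: "(\<Sum>B\<in>?X. (1 - real_of_int q) ^ activity r n a b B) =
      (\<Sum>T\<in>?Y. (1 - real_of_int q) ^ num_root_edges_col1 n T)" if q: "q0 < q" for q
  proof -
    let ?N = "card {x \<in> box q. \<forall>e\<in>E. \<not> q dvd lval x e}"
    let ?R = "real_of_int q - real (k1 + k2) - real m * real k2"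
    have "0 \<le> int (k1 + k2) + int m * int k2 + int m * (int k1 + 1)" by simp
    then have q1: "int n * (\<bar>a\<bar> + \<bar>b\<bar>) < q"
      using q unfolding q0_def by linarith
    have "0 \<le> int n * (\<bar>a\<bar> + \<bar>b\<bar>)" by simp
    then have q2: "int (k1 + k2) + int m * int k2 + int m * (int k1 + 1) < q"
      using q unfolding q0_def by linarith
    have "?N = (\<Sum>w\<in>arr m. nat (q - (int k1 + int k2) - int k2 - int (asc w) * (int k1 + 1) -
        (int m - 1) * int k2 + int m - 1) choose m)"
      using proper_points_eq[of m k2 k1 r q] G card_total_points[OF m(2), of "int k2" "q - (int k1 + int k2)"]
      unfolding m(1) a_def b_def by simp
    also have "real \<dots> = (\<Sum>w\<in>arr m. (?R + real m - 1 - real (asc w) * real (Suc k1)) gchoose m)"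
      unfolding of_nat_sum
    proof (rule sum.cong[OF refl])
      fix w assume w: "w \<in> arr m"
      let ?z = "q - (int k1 + int k2) - int k2 - int (asc w) * (int k1 + 1) - (int m - 1) * int k2 + int m - 1"
      have "asc w \<le> m" using asc_le[of w] length_arr[OF w] by simp
      then have "int (asc w) * (int k1 + 1) \<le> int m * (int k1 + 1)"
        by (intro mult_right_mono) auto
      then have "0 \<le> ?z" using q2 m(2) by (simp add: algebra_simps)
      then have "real (nat ?z choose m) = (real_of_int ?z) gchoose m"
        by (simp add: binomial_gbinomial)
      also have "real_of_int ?z = ?R + real m - 1 - real (asc w) * real (Suc k1)"
        by (simp add: algebra_simps)
      finally show "real (nat ?z choose m) = (?R + real m - 1 - real (asc w) * real (Suc k1)) gchoose m" .
    qed
    finally have N: "real ?N = choice_sum k1 m (\<lambda>_. 1) 0 ?R"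
      by (simp add: choice_sum_ascents)
    have "(\<Sum>B\<in>?X. (1 - real_of_int q) ^ activity r n a b B) = real_of_int (\<Sum>B\<in>?X. (1 - q) ^ activity r n a b B)"
      by simp
    also have "\<dots> = real_of_int ((-1) ^ (n - 1) * int ?N)"
      by (simp only: proper_count_activity[OF q1])
    also have "\<dots> = (-1) ^ m * real ?N"
      using m(1) by simp
    also have "\<dots> = (\<Sum>T\<in>?Y. (1 - real_of_int q) ^ num_root_edges_col1 n T)"
      unfolding N using tree_sum_choice_sum[OF k1, where m = m and ?k2.0 = k2 and q = q] m(1) by simp
    finally show ?thesis .
  qed
  have finY: "finite ?Y"
    by (rule finite_subset[of _ "Pow ({1..n} \<times> {1..n} \<times> {1..k1 + k2})"]) (auto simp: colored_rooted_tree_def)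
  have inf: "infinite ((\<lambda>q. 1 - real_of_int q) ` {q0<..})"
  proof
    assume "finite ((\<lambda>q. 1 - real_of_int q) ` {q0<..})"
    then have "finite {q0<..}"
      by (rule finite_imageD) (auto simp: inj_on_def)
    then show False using infinite_Ioi by blast
  qed
  have "card {B \<in> ?X. activity r n a b B = \<alpha>} = card {T \<in> ?Y. num_root_edges_col1 n T = \<alpha>}"
    by (rule card_eq_if_powers_eq[OF finite_nbc_bases finY inf]) (use sums in auto)
  then show ?thesis
    by (simp add: a_def b_def conj_assoc)
qed

section \<open>Bounded regions\<close>

lemma rtrancl_insert_both:
  "(b, a) \<in> (insert (i, j) (insert (j, i) D))\<^sup>* \<longleftrightarrow> (b, a) \<in> D\<^sup>* \<or>
     (b, i) \<in> D\<^sup>* \<and> (j, a) \<in> D\<^sup>* \<or> (b, j) \<in> D\<^sup>* \<and> (i, a) \<in> D\<^sup>*"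
  unfolding rtrancl_insert by (auto intro: rtrancl_trans)

lemma finite_pos_lower_bound:
  fixes f :: "'a \<Rightarrow> real"
  assumes "finite A" "\<And>e. e \<in> A \<Longrightarrow> 0 < f e"
  shows "\<exists>\<delta>>0. \<forall>e\<in>A. \<delta> < f e"
  using assms
proof (induction A rule: finite_induct)
  case empty
  show ?case by (rule exI[of _ 1]) simp
next
  case (insert e A)
  then obtain \<delta> where "\<delta> > 0" "\<forall>e\<in>A. \<delta> < f e" by auto
  then show ?case
    using insert.prems[of e] by (intro exI[of _ "min \<delta> (f e / 2)"]) auto
qed

lemma finite_upper_bound:
  fixes f :: "'a \<Rightarrow> 'b \<Rightarrow> real"
  assumes "finite A" "\<And>e. e \<in> A \<Longrightarrow> \<exists>c. \<forall>x\<in>R. f e x \<le> c"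
  shows "\<exists>c. \<forall>x\<in>R. \<forall>e\<in>A. f e x \<le> c"
  using assms
proof (induction A rule: finite_induct)
  case (insert e A)
  then obtain c c' where "\<forall>x\<in>R. \<forall>e\<in>A. f e x \<le> c" "\<forall>x\<in>R. f e x \<le> c'" by blast
  then show ?case
    by (intro exI[of _ "max c c'"]) (auto simp: le_max_iff_disj)
qed simp

context gain_graph
begin

section \<open>Cells on a flat and their unbounded directions\<close>

definition pts :: "gedge set \<Rightarrow> gedge set \<Rightarrow> (nat \<Rightarrow> real) set" where
  "pts F A = {x \<in> sum_zero_space n. (\<forall>e\<in>F. lval x e = 0) \<and> (\<forall>e\<in>A. lval x e \<noteq> 0)}"

definition cell :: "gedge set \<Rightarrow> gedge set \<Rightarrow> gedge set \<Rightarrow> (nat \<Rightarrow> real) set" where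
  "cell F A P = {x \<in> sum_zero_space n. (\<forall>e\<in>F. lval x e = 0) \<and>
     (\<forall>e\<in>A. if e \<in> P then 0 < lval x e else lval x e < 0)}"

text \<open>Boundedness of all the functionals in A, that is, boundedness modulo the lineality space of
  the arrangement A.\<close>

definition bnd :: "gedge set \<Rightarrow> (nat \<Rightarrow> real) set \<Rightarrow> bool" where
  "bnd A R \<longleftrightarrow> (\<exists>M. \<forall>x\<in>R. \<forall>e\<in>A. \<bar>lval x e\<bar> \<le> M)"

definition good :: "gedge set \<Rightarrow> gedge set \<Rightarrow> gedge set \<Rightarrow> bool" where
  "good F A P \<longleftrightarrow> cell F A P \<noteq> {} \<and> bnd A (cell F A P)"

definition nbounded :: "gedge set \<Rightarrow> gedge set \<Rightarrow> int" where
  "nbounded F A = (\<Sum>P\<in>Pow A. of_bool (good F A P))"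

text \<open>Raises the vertices of \<open>C\<close> by t and then recentres all of them. The
  correction restores the coordinate sum 0 and cancels in every difference, so only edges leaving or
  entering \<open>C\<close> notice the move.\<close>

definition shift :: "nat set \<Rightarrow> real \<Rightarrow> (nat \<Rightarrow> real) \<Rightarrow> nat \<Rightarrow> real" where
  "shift C t x v = (if v \<in> {1..n} then x v + t * of_bool (v \<in> C) - t * real (card (C \<inter> {1..n})) / real n else x v)"

lemma shift_sum_zero: "x \<in> sum_zero_space n \<Longrightarrow> shift C t x \<in> sum_zero_space n"
proof -
  assume x: "x \<in> sum_zero_space n"
  have "(\<Sum>v\<in>{1..n}. of_bool (v \<in> C) :: real) = real (card (C \<inter> {1..n}))"
    by (simp add: of_bool_def sum.If_cases Int_commute)
  then have "(\<Sum>v\<in>{1..n}. t * of_bool (v \<in> C)) = t * real (card (C \<inter> {1..n}))"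
    by (simp only: sum_distrib_left[symmetric])
  moreover have "(\<Sum>v\<in>{1..n}. shift C t x v) =
      (\<Sum>v\<in>{1..n}. x v + t * of_bool (v \<in> C) - t * real (card (C \<inter> {1..n})) / real n)"
    by (rule sum.cong) (auto simp: shift_def)
  ultimately have "(\<Sum>v\<in>{1..n}. shift C t x v) = 0"
    using x n2 by (simp add: sum.distrib sum_subtractf sum_zero_space_def)
  then show ?thesis
    using x by (auto simp: sum_zero_space_def shift_def)
qed

lemma shift_lval:
  "(i, j, g) \<in> E \<Longrightarrow> lval (shift C t x) (i, j, g) = lval x (i, j, g) + t * (of_bool (j \<in> C) - of_bool (i \<in> C))"
  using E_verts[of i j g] by (simp add: lval_def shift_def algebra_simps)

lemma shift_lval_same:
  "(i, j, g) \<in> E \<Longrightarrow> (i \<in> C \<longleftrightarrow> j \<in> C) \<Longrightarrow> lval (shift C t x) (i, j, g) = lval x (i, j, g)"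
  by (simp add: shift_lval)

lemma conn_class_edge:
  "(i, j, g) \<in> X \<Longrightarrow> i \<in> conn X `` {v} \<longleftrightarrow> j \<in> conn X `` {v}"
proof -
  assume "(i, j, g) \<in> X"
  then have "(i, j) \<in> conn X"
    by (rule conn_edge) (simp add: ends_def)
  then show ?thesis
    by (meson Image_singleton_iff conn_sym conn_trans)
qed

text \<open>Equations are satisfied one edge at a time: moving the whole component of
  \<open>j\<close> repairs the new equation and changes none of the earlier ones.\<close>

lemma forest_central:
  assumes "F \<subseteq> E" "is_forest F"
  shows "pts F {} \<noteq> {}"
proof -
  have "finite F" using assms finite_subset finite_gain_edges by blast
  then show ?thesis
    using assms
  proof (induction F)
    case empty
    have "(\<lambda>_. 0) \<in> pts {} {}" by (simp add: pts_def sum_zero_space_def)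
    then show ?case by blast
  next
    case (insert e F)
    obtain i j g where e: "e = (i, j, g)" by (cases e)
    have F: "is_forest F" "F \<subseteq> E" and eE: "(i, j, g) \<in> E"
      using insert.prems e by (auto intro: is_forest_mono)
    have nc: "(i, j) \<notin> conn F"
      using is_forest_insert[of F i j g] insert e F E_ne[OF eE] by auto
    obtain x where x: "x \<in> pts F {}"
      using insert.IH F by blast
    let ?C = "conn F `` {j}"
    let ?y = "shift ?C (- lval x e) x"
    have "lval ?y f = 0" if "f \<in> F" for f
    proof -
      obtain i' j' g' where f: "f = (i', j', g')" by (cases f)
      have "lval ?y f = lval x f"
        unfolding f using that F(2) f by (intro shift_lval_same conn_class_edge) auto
      then show ?thesis using x that by (simp add: pts_def)
    qed
    moreover have "i \<notin> ?C" using nc conn_sym by blast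
    then have "lval ?y e = 0"
      unfolding e by (simp add: shift_lval[OF eE])
    ultimately have "?y \<in> pts (insert e F) {}"
      using x shift_sum_zero by (auto simp: pts_def)
    then show ?case by blast
  qed
qed

definition cdig :: "gedge set \<Rightarrow> gedge set \<Rightarrow> gedge set \<Rightarrow> (nat \<times> nat) set" where
  "cdig F A P = {(i, j). \<exists>g. (i, j, g) \<in> (A - P) \<union> F} \<union> {(j, i). \<exists>g. (i, j, g) \<in> (A \<inter> P) \<union> F}"

text \<open>A directed path from u to w in the constraint digraph bounds x w - x u from above on the cell;
  otherwise all vertices not reachable from u can be moved up together indefinitely.\<close>

lemma cdig_bound:
  assumes "(u, w) \<in> (cdig F A P)\<^sup>*"
  shows "\<exists>c. \<forall>x\<in>cell F A P. x w - x u \<le> c"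
  using assms
proof (induction rule: rtrancl_induct)
  case base
  show ?case by (rule exI[of _ 0]) simp
next
  case (step v w)
  then obtain c where c: "\<forall>x\<in>cell F A P. x v - x u \<le> c" by blast
  have "\<exists>d. \<forall>x\<in>cell F A P. x w - x v \<le> d"
  proof -
    consider g where "(v, w, g) \<in> (A - P) \<union> F" | g where "(w, v, g) \<in> (A \<inter> P) \<union> F"
      using step.hyps(2) by (auto simp: cdig_def)
    then show ?thesis
    proof cases
      case 1
      have "x w - x v \<le> of_int g" if "x \<in> cell F A P" for x
      proof -
        have "lval x (v, w, g) \<le> 0"
          using that 1 by (fastforce simp: cell_def)
        then show ?thesis by (simp add: lval_def gain_def)
      qed
      then show ?thesis by blast
    next
      case 2
      have "x w - x v \<le> - of_int g" if "x \<in> cell F A P" for x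
      proof -
        have "lval x (w, v, g) \<ge> 0"
          using that 2 by (fastforce simp: cell_def)
        then show ?thesis by (simp add: lval_def gain_def)
      qed
      then show ?thesis by blast
    qed
  qed
  then obtain d where d: "\<forall>x\<in>cell F A P. x w - x v \<le> d" by blast
  have "x w - x u \<le> c + d" if "x \<in> cell F A P" for x
    using c d that by (smt (verit))
  then show ?case by blast
qed

text \<open>An arc stands for an upper bound on the coordinate of its head minus that of its tail.
  Raising \<open>C\<close> can violate such a bound only along an arc entering \<open>C\<close>, and
  there is none.\<close>

lemma shift_in_cell:
  assumes x: "x \<in> cell F A P" and sub: "F \<subseteq> E" "A \<subseteq> E"
    and cl: "\<And>v w. (v, w) \<in> cdig F A P \<Longrightarrow> v \<notin> C \<Longrightarrow> w \<notin> C" and t: "0 \<le> t"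
  shows "shift C t x \<in> cell F A P"
proof -
  have "lval (shift C t x) e = 0" if "e \<in> F" for e
  proof -
    obtain i j g where e: "e = (i, j, g)" by (cases e)
    have "(i, j) \<in> cdig F A P" "(j, i) \<in> cdig F A P"
      using that e by (auto simp: cdig_def)
    then have "i \<in> C \<longleftrightarrow> j \<in> C" using cl by blast
    then have "lval (shift C t x) e = lval x e"
      unfolding e using that e sub by (intro shift_lval_same) auto
    then show ?thesis using x that by (simp add: cell_def)
  qed
  moreover have "if e \<in> P then 0 < lval (shift C t x) e else lval (shift C t x) e < 0" if "e \<in> A" for e
  proof -
    obtain i j g where e: "e = (i, j, g)" by (cases e)
    have lv: "lval (shift C t x) e = lval x e + t * (of_bool (j \<in> C) - of_bool (i \<in> C))"
      unfolding e using that e sub by (intro shift_lval) auto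
    have s: "if e \<in> P then 0 < lval x e else lval x e < 0"
      using x that unfolding cell_def by blast
    show ?thesis
    proof (cases "e \<in> P")
      case True
      then have "(j, i) \<in> cdig F A P" using that e by (auto simp: cdig_def)
      then have "of_bool (i \<in> C) \<le> (of_bool (j \<in> C) :: real)" using cl[of j i] by auto
      then have "0 \<le> t * (of_bool (j \<in> C) - of_bool (i \<in> C))" using t by simp
      then show ?thesis using s True unfolding lv by auto
    next
      case False
      then have "(i, j) \<in> cdig F A P" using that e by (auto simp: cdig_def)
      then have "(of_bool (j \<in> C) :: real) \<le> of_bool (i \<in> C)" using cl[of i j] by auto
      then have "t * (of_bool (j \<in> C) - of_bool (i \<in> C)) \<le> 0" using t by (simp add: mult_nonneg_nonpos)
      then show ?thesis using s False unfolding lv by auto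
    qed
  qed
  moreover have "shift C t x \<in> sum_zero_space n"
    using x shift_sum_zero by (auto simp: cell_def)
  ultimately show ?thesis
    unfolding cell_def by blast
qed

section \<open>Boundedness as strong connectivity\<close>

definition total_cyclic :: "gedge set \<Rightarrow> (nat \<times> nat) set \<Rightarrow> bool" where
  "total_cyclic A D \<longleftrightarrow> (\<forall>(i, j, g)\<in>A. (i, j) \<in> D\<^sup>* \<and> (j, i) \<in> D\<^sup>*)"

lemma bnd_cell_iff:
  assumes ne: "cell F A P \<noteq> {}" and sub: "F \<subseteq> E" "A \<subseteq> E"
  shows "bnd A (cell F A P) \<longleftrightarrow> total_cyclic A (cdig F A P)"
proof
  assume tc: "total_cyclic A (cdig F A P)"
  have "\<exists>c. \<forall>x\<in>cell F A P. \<forall>e\<in>A. \<bar>lval x e\<bar> \<le> c"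
  proof (rule finite_upper_bound)
    show "finite A" using sub finite_subset finite_gain_edges by blast
    fix e assume e: "e \<in> A"
    obtain i j g where eq: "e = (i, j, g)" by (cases e)
    obtain c d where c: "\<forall>x\<in>cell F A P. x j - x i \<le> c" and d: "\<forall>x\<in>cell F A P. x i - x j \<le> d"
      using tc e eq cdig_bound[of i j F A P] cdig_bound[of j i F A P] unfolding total_cyclic_def by blast
    have "\<bar>lval x e\<bar> \<le> \<bar>c\<bar> + \<bar>d\<bar> + \<bar>real_of_int g\<bar>" if "x \<in> cell F A P" for x
    proof -
      have "x j - x i \<le> c" "x i - x j \<le> d" using c d that by auto
      then show ?thesis unfolding eq lval_def gain_def by simp
    qed
    then show "\<exists>c. \<forall>x\<in>cell F A P. \<bar>lval x e\<bar> \<le> c" by blast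
  qed
  then show "bnd A (cell F A P)" unfolding bnd_def .
next
  assume b: "bnd A (cell F A P)"
  obtain x where x: "x \<in> cell F A P" using ne by blast
  obtain M where M: "\<And>y e. y \<in> cell F A P \<Longrightarrow> e \<in> A \<Longrightarrow> \<bar>lval y e\<bar> \<le> M"
    using b unfolding bnd_def by blast
  have reach: "(u, w) \<in> (cdig F A P)\<^sup>*" if e: "(i, j, g) \<in> A" "{u, w} = {i, j}" for i j g u w
  proof (rule ccontr)
    assume nr: "(u, w) \<notin> (cdig F A P)\<^sup>*"
    define C where "C = {v. (u, v) \<notin> (cdig F A P)\<^sup>*}"
    \<comment> \<open>Large enough to push the value at the edge beyond \<open>M\<close> in absolute
      value, since exactly one of its ends is raised.\<close>
    define t where "t = M + \<bar>lval x (i, j, g)\<bar> + 1"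
    have "0 \<le> t"
      using M[OF x e(1)] unfolding t_def by linarith
    moreover have "w' \<notin> C" if "(v, w') \<in> cdig F A P" "v \<notin> C" for v w'
      using that unfolding C_def by (auto intro: rtrancl_into_rtrancl)
    ultimately have "shift C t x \<in> cell F A P"
      using shift_in_cell[OF x sub] by blast
    from M[OF this e(1)] have "\<bar>lval x (i, j, g) + t * (of_bool (j \<in> C) - of_bool (i \<in> C))\<bar> \<le> M"
      using shift_lval[of i j g C t x] e sub by auto
    moreover have "u \<notin> C" "w \<in> C" using nr by (auto simp: C_def)
    then have "i \<in> C \<and> j \<notin> C \<or> i \<notin> C \<and> j \<in> C"
      using e(2) by (auto simp: doubleton_eq_iff)
    ultimately show False
      unfolding t_def by auto
  qed
  show "total_cyclic A (cdig F A P)"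
    unfolding total_cyclic_def using reach by blast
qed

lemma total_cyclic_mono: "total_cyclic A D \<Longrightarrow> D \<subseteq> D' \<Longrightarrow> total_cyclic A D'"
  unfolding total_cyclic_def using rtrancl_mono[of D D'] by blast

lemma total_cyclic_conn:
  assumes "total_cyclic A D" "\<And>i j g. (i, j, g) \<in> F \<Longrightarrow> (i, j) \<in> D\<^sup>* \<and> (j, i) \<in> D\<^sup>*"
    and "(u, w) \<in> conn (F \<union> A)"
  shows "(u, w) \<in> D\<^sup>*"
proof -
  have "adj (F \<union> A) \<subseteq> D\<^sup>*"
  proof
    fix p assume "p \<in> adj (F \<union> A)"
    then obtain u w e where p: "p = (u, w)" "e \<in> F \<union> A" "ends e = {u, w}"
      unfolding adj_def by blast
    obtain i j g where e: "e = (i, j, g)" by (cases e)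
    have "(i, j) \<in> D\<^sup>* \<and> (j, i) \<in> D\<^sup>*"
      using p(2) assms(1,2) e unfolding total_cyclic_def by blast
    then show "p \<in> D\<^sup>*"
      using p e by (auto simp: ends_def doubleton_eq_iff)
  qed
  then have "(adj (F \<union> A))\<^sup>* \<subseteq> (D\<^sup>*)\<^sup>*" by (rule rtrancl_mono)
  then show ?thesis using assms(3) by (auto simp: conn_def)
qed

text \<open>If \<open>D\<close> is not totally cyclic, at most one of the two orientations of the
  new edge makes it so. Otherwise \<open>con\<close> would give paths from j to i and from i to j
  that do not use the new arcs, and adding an arc would change no reachability. One orientation
  works exactly when both arcs together do.\<close>

lemma total_cyclic_count:
  assumes arc: "\<And>i' j' g'. (i', j', g') \<in> A \<Longrightarrow> (i', j') \<in> D \<or> (j', i') \<in> D"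
    and con: "\<And>D'. D \<subseteq> D' \<Longrightarrow> total_cyclic A D' \<Longrightarrow> (i, j) \<in> D'\<^sup>* \<and> (j, i) \<in> D'\<^sup>*"
  shows "of_bool (total_cyclic A (insert (i, j) D)) + of_bool (total_cyclic A (insert (j, i) D)) =
         (of_bool (total_cyclic A D) + of_bool (total_cyclic A (insert (i, j) (insert (j, i) D))) :: int)"
proof (cases "total_cyclic A D")
  case True
  then have "total_cyclic A (insert (i, j) D)" "total_cyclic A (insert (j, i) D)"
    "total_cyclic A (insert (i, j) (insert (j, i) D))"
    by (auto intro: total_cyclic_mono)
  then show ?thesis using True by simp
next
  case False
  let ?B = "insert (i, j) (insert (j, i) D)"
  have ins: "total_cyclic A (insert (v, w) X) \<longleftrightarrow> total_cyclic A X" if "(v, w) \<in> X\<^sup>*" for v w X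
  proof -
    have "(insert (v, w) X)\<^sup>* = X\<^sup>*"
      unfolding rtrancl_insert using that by (auto intro: rtrancl_trans)
    then show ?thesis unfolding total_cyclic_def by simp
  qed
  have ij: "(j, i) \<in> D\<^sup>*" if "total_cyclic A (insert (i, j) D)"
    using con[of "insert (i, j) D"] that by (auto simp: rtrancl_insert)
  have ji: "(i, j) \<in> D\<^sup>*" if "total_cyclic A (insert (j, i) D)"
    using con[of "insert (j, i) D"] that by (auto simp: rtrancl_insert)
  have not_both: "\<not> (total_cyclic A (insert (i, j) D) \<and> total_cyclic A (insert (j, i) D))"
    using ij ji ins[of i j D] False by blast
  have sub: "total_cyclic A ?B" if "total_cyclic A (insert (i, j) D) \<or> total_cyclic A (insert (j, i) D)"
    using that by (auto intro: total_cyclic_mono)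
  have conv: "total_cyclic A (insert (i, j) D) \<or> total_cyclic A (insert (j, i) D)" if B: "total_cyclic A ?B"
  proof -
    obtain i' j' g' where e: "(i', j', g') \<in> A" "(i', j') \<notin> D\<^sup>* \<or> (j', i') \<notin> D\<^sup>*"
      using False unfolding total_cyclic_def by blast
    \<comment> \<open>Take an arc of \<open>D\<close> without a return in \<open>D\<close>. With
      both new arcs it has a return, through one of them; closing this with the arc itself yields a
      path in \<open>D\<close> between i and j, which makes the opposite new arc redundant.\<close>
    obtain a b where ab: "(a, b) \<in> D" "(b, a) \<notin> D\<^sup>*" "(b, a) \<in> ?B\<^sup>*"
    proof (cases "(i', j') \<in> D")
      case True
      then show ?thesis using that[of i' j'] e B unfolding total_cyclic_def by blast
    next
      case F: False
      then have "(j', i') \<in> D" using arc e(1) by blast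
      then show ?thesis using that[of j' i'] e B unfolding total_cyclic_def by blast
    qed
    then consider "(b, i) \<in> D\<^sup>*" "(j, a) \<in> D\<^sup>*" | "(b, j) \<in> D\<^sup>*" "(i, a) \<in> D\<^sup>*"
      using rtrancl_insert_both[of b a i j D] by blast
    then show ?thesis
    proof cases
      case 1
      then have "(j, i) \<in> D\<^sup>*"
        using ab(1) by (meson rtrancl_trans r_into_rtrancl)
      then have "(j, i) \<in> (insert (i, j) D)\<^sup>*"
        using rtrancl_mono[of D "insert (i, j) D"] by blast
      then show ?thesis
        using ins[of j i "insert (i, j) D"] B by (simp add: insert_commute)
    next
      case 2
      then have "(i, j) \<in> D\<^sup>*"
        using ab(1) by (meson rtrancl_trans r_into_rtrancl)
      then have "(i, j) \<in> (insert (j, i) D)\<^sup>*"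
        using rtrancl_mono[of D "insert (j, i) D"] by blast
      then show ?thesis
        using ins[of i j "insert (j, i) D"] B by simp
    qed
  qed
  show ?thesis
    using False not_both sub conv by (auto simp: of_bool_def)
qed


section \<open>Deletion and restriction for bounded cells\<close>

lemma cell_insert:
  assumes "H \<notin> A" "P \<subseteq> A"
  shows "cell F (insert H A) P = {x \<in> cell F A P. lval x H < 0}"
    "cell F (insert H A) (insert H P) = {x \<in> cell F A P. 0 < lval x H}"
    "cell (insert H F) A P = {x \<in> cell F A P. lval x H = 0}"
proof -
  have "e \<noteq> H" if "e \<in> A" for e using assms that by blast
  then show "cell F (insert H A) P = {x \<in> cell F A P. lval x H < 0}"
    "cell F (insert H A) (insert H P) = {x \<in> cell F A P. 0 < lval x H}"
    "cell (insert H F) A P = {x \<in> cell F A P. lval x H = 0}"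
    using assms unfolding cell_def by auto
qed

lemma nbounded_insert:
  assumes "H \<notin> A" "finite A"
  shows "nbounded F (insert H A) =
    (\<Sum>P\<in>Pow A. of_bool (good F (insert H A) P) + of_bool (good F (insert H A) (insert H P)))"
proof -
  let ?g = "\<lambda>P. of_bool (good F (insert H A) P) :: int"
  have "inj_on (insert H) (Pow A)"
    using assms by (auto simp: inj_on_def)
  then have "(\<Sum>P\<in>insert H ` Pow A. ?g P) = (\<Sum>P\<in>Pow A. ?g (insert H P))"
    by (simp add: sum.reindex)
  moreover have "(\<Sum>P\<in>Pow (insert H A). ?g P) = (\<Sum>P\<in>Pow A. ?g P) + (\<Sum>P\<in>insert H ` Pow A. ?g P)"
    unfolding Pow_insert using assms by (intro sum.union_disjoint) auto
  ultimately show ?thesis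
    by (simp add: nbounded_def sum.distrib)
qed

lemma bnd_insert: "bnd (insert H A) R \<longleftrightarrow> bnd A R \<and> (\<exists>c. \<forall>x\<in>R. \<bar>lval x H\<bar> \<le> c)"
proof
  assume "bnd A R \<and> (\<exists>c. \<forall>x\<in>R. \<bar>lval x H\<bar> \<le> c)"
  then obtain M c where "\<forall>x\<in>R. \<forall>e\<in>A. \<bar>lval x e\<bar> \<le> M" "\<forall>x\<in>R. \<bar>lval x H\<bar> \<le> c"
    unfolding bnd_def by blast
  then show "bnd (insert H A) R"
    unfolding bnd_def by (intro exI[of _ "max M c"]) (auto simp: le_max_iff_disj)
qed (unfold bnd_def, blast)

lemma bnd_subset: "bnd A R \<Longrightarrow> R' \<subseteq> R \<Longrightarrow> bnd A R'"
  unfolding bnd_def by blast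

lemma conn_const:
  assumes "(u, w) \<in> conn F"
  shows "\<exists>c :: real. \<forall>x. (\<forall>e\<in>F. lval x e = 0) \<longrightarrow> x w - x u = c"
  using assms unfolding conn_def
proof (induction rule: rtrancl_induct)
  case base
  show ?case by (rule exI[of _ 0]) simp
next
  case (step v w)
  from step.IH obtain c :: real where c: "\<forall>x. (\<forall>e\<in>F. lval x e = 0) \<longrightarrow> x v - x u = c" ..
  obtain e where e: "e \<in> F" "ends e = {v, w}" using step.hyps(2) unfolding adj_def by blast
  obtain i j g where eq: "e = (i, j, g)" by (cases e)
  have "x w - x u = c + (if v = i then real_of_int g else - real_of_int g)" if x: "\<forall>e\<in>F. lval x e = 0" for x
  proof -
    have "lval x e = 0" using x e(1) by blast
    then have "x j - x i = real_of_int g" by (simp add: eq lval_def gain_def)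
    moreover have "v = i \<and> w = j \<or> v = j \<and> w = i"
      using e(2) by (auto simp: eq ends_def doubleton_eq_iff)
    moreover have "x v - x u = c" using c x by simp
    ultimately show ?thesis by auto
  qed
  then show ?case by blast
qed

lemma conn_bnd:
  assumes "(u, w) \<in> conn (F \<union> A)" and b: "bnd A R" and R: "\<And>x e. x \<in> R \<Longrightarrow> e \<in> F \<Longrightarrow> lval x e = 0"
  shows "\<exists>c. \<forall>x\<in>R. \<bar>x w - x u\<bar> \<le> c"
  using assms(1) unfolding conn_def
proof (induction rule: rtrancl_induct)
  case base
  show ?case by (rule exI[of _ 0]) simp
next
  case (step v w)
  then obtain c where c: "\<And>x. x \<in> R \<Longrightarrow> \<bar>x v - x u\<bar> \<le> c" by blast
  obtain M where M: "\<And>x e. x \<in> R \<Longrightarrow> e \<in> A \<Longrightarrow> \<bar>lval x e\<bar> \<le> M"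
    using b unfolding bnd_def by blast
  obtain e where e: "e \<in> F \<union> A" "ends e = {v, w}" using step.hyps(2) unfolding adj_def by blast
  obtain i j g where eq: "e = (i, j, g)" by (cases e)
  have "\<bar>x w - x u\<bar> \<le> c + (\<bar>M\<bar> + \<bar>real_of_int g\<bar>)" if x: "x \<in> R" for x
  proof -
    have "\<bar>lval x e\<bar> \<le> \<bar>M\<bar>"
      using e(1) R[OF x] M[OF x] by fastforce
    then have "\<bar>x j - x i\<bar> \<le> \<bar>M\<bar> + \<bar>real_of_int g\<bar>" by (simp add: eq lval_def gain_def)
    moreover have "v = i \<and> w = j \<or> v = j \<and> w = i"
      using e(2) by (auto simp: eq ends_def doubleton_eq_iff)
    ultimately have "\<bar>x w - x v\<bar> \<le> \<bar>M\<bar> + \<bar>real_of_int g\<bar>" by auto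
    then show ?thesis using c[OF x] by linarith
  qed
  then show ?case by blast
qed

lemma cell_convex_zero:
  assumes "x \<in> cell F A P" "y \<in> cell F A P" "lval x H < 0" "0 < lval y H"
  shows "\<exists>z\<in>cell F A P. lval z H = 0"
proof -
  define s where "s = - lval x H / (lval y H - lval x H)"
  have s: "0 < s" "s < 1" using assms(3,4) by (auto simp: s_def field_simps)
  define z where "z i = (1 - s) * x i + s * y i" for i
  have lv: "lval z e = (1 - s) * lval x e + s * lval y e" for e
    by (simp add: lval_def z_def algebra_simps)
  have "lval z H = 0"
    unfolding lv s_def using assms(3,4) by (simp add: field_simps)
  moreover have "z \<in> sum_zero_space n"
  proof -
    have "(\<Sum>i\<in>{1..n}. z i) = (1 - s) * (\<Sum>i\<in>{1..n}. x i) + s * (\<Sum>i\<in>{1..n}. y i)"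
      by (simp add: z_def sum.distrib sum_distrib_left)
    then show ?thesis
      using assms(1,2) by (auto simp: cell_def sum_zero_space_def z_def)
  qed
  moreover have "lval z e = 0" if "e \<in> F" for e
    using assms(1,2) that by (simp add: lv cell_def)
  moreover have "if e \<in> P then 0 < lval z e else lval z e < 0" if "e \<in> A" for e
  proof (cases "e \<in> P")
    case True
    then have "0 < lval x e" "0 < lval y e" using assms(1,2) that unfolding cell_def by auto
    then show ?thesis using True s unfolding lv by (simp add: add_pos_pos)
  next
    case False
    then have "lval x e < 0" "lval y e < 0" using assms(1,2) that unfolding cell_def by auto
    then show ?thesis using False s unfolding lv by (simp add: add_neg_neg mult_pos_neg)
  qed
  ultimately show ?thesis unfolding cell_def by blast
qed

text \<open>Deletion and restriction at H. Its functional is constant on the flat of F if its ends are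
  connected in F, and a combination of the functionals in F and A if they are connected in
  F \<union> A.\<close>

lemma nbounded_const:
  assumes H: "H = (i, j, g)" "H \<notin> A" "finite A" and con: "(i, j) \<in> conn F"
  shows "nbounded F (insert H A) = nbounded F A - nbounded (insert H F) A"
proof -
  obtain c0 :: real where c0: "\<And>x. \<forall>e\<in>F. lval x e = 0 \<Longrightarrow> x j - x i = c0"
    using conn_const[OF con] by blast
  define c where "c = c0 - real_of_int g"
  have c: "lval x H = c" if "x \<in> cell F A P" for x P
    using c0[of x] that by (simp add: cell_def c_def H(1) lval_def gain_def)
  have "of_bool (good F (insert H A) P) + of_bool (good F (insert H A) (insert H P)) =
      (of_bool (good F A P) - of_bool (good (insert H F) A P) :: int)" if P: "P \<in> Pow A" for P
  proof -
    have PA: "P \<subseteq> A" using P by simp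
    note ci = cell_insert[OF H(2) PA, of F]
    have b: "bnd (insert H A) (cell F A P) \<longleftrightarrow> bnd A (cell F A P)"
      unfolding bnd_insert using c by (metis order_refl)
    consider "c = 0" | "c < 0" | "0 < c" by linarith
    then show ?thesis
    proof cases
      case 1
      then have "cell F (insert H A) P = {}" "cell F (insert H A) (insert H P) = {}"
        "cell (insert H F) A P = cell F A P"
        unfolding ci using c by auto
      then show ?thesis by (simp add: good_def)
    next
      case 2
      then have "cell F (insert H A) P = cell F A P" "cell F (insert H A) (insert H P) = {}"
        "cell (insert H F) A P = {}"
        unfolding ci using c by auto
      then show ?thesis using b by (simp add: good_def)
    next
      case 3
      then have "cell F (insert H A) P = {}" "cell F (insert H A) (insert H P) = cell F A P"
        "cell (insert H F) A P = {}"
        unfolding ci using c by auto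
      then show ?thesis using b by (simp add: good_def)
    qed
  qed
  then show ?thesis
    unfolding nbounded_insert[OF H(2,3)] by (simp add: nbounded_def sum_subtractf[symmetric])
qed

text \<open>Fix a cell of the deletion. If H misses it, the cell lies on one side of H and the
  functional of H is bounded on it whenever those of \<open>A\<close> are, so its status is
  unchanged. If H cuts it, both sides are nonempty, and boundedness of the cell, of its two halves
  and of the section becomes strong connectivity of \<open>D\<close> with neither, one or both arcs
  along H, to which \<open>total_cyclic_count\<close> applies.\<close>

lemma nbounded_dependent:
  assumes H: "H = (i, j, g)" "H \<notin> A" "H \<in> E" and sub: "F \<subseteq> E" "A \<subseteq> E"
    and nc: "(i, j) \<notin> conn F" and con: "(i, j) \<in> conn (F \<union> A)"
  shows "nbounded F (insert H A) = nbounded F A + nbounded (insert H F) A"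
proof -
  have finA: "finite A" using sub finite_subset finite_gain_edges by blast
  have "of_bool (good F (insert H A) P) + of_bool (good F (insert H A) (insert H P)) =
      (of_bool (good F A P) + of_bool (good (insert H F) A P) :: int)" if P: "P \<in> Pow A" for P
  proof -
    have PA: "P \<subseteq> A" using P by simp
    note ci = cell_insert[OF H(2) PA, of F]
    show ?thesis
    proof (cases "cell (insert H F) A P = {}")
      case True
      then have no0: "lval x H \<noteq> 0" if "x \<in> cell F A P" for x
        using that unfolding ci by blast
      have b: "bnd (insert H A) (cell F A P) \<longleftrightarrow> bnd A (cell F A P)"
      proof
        assume b: "bnd A (cell F A P)"
        obtain c where c: "\<And>x. x \<in> cell F A P \<Longrightarrow> \<bar>x j - x i\<bar> \<le> c"
          using conn_bnd[OF con b] by (auto simp: cell_def)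
        have "\<bar>lval x H\<bar> \<le> c + \<bar>real_of_int g\<bar>" if "x \<in> cell F A P" for x
          using c[OF that] by (simp add: H(1) lval_def gain_def)
        then show "bnd (insert H A) (cell F A P)"
          unfolding bnd_insert using b by blast
      qed (simp add: bnd_insert)
      consider "cell F (insert H A) P = {}" | "cell F (insert H A) (insert H P) = {}"
        using cell_convex_zero[of _ F A P _ H] no0 unfolding ci by blast
      then show ?thesis
      proof cases
        case 1
        then have "cell F (insert H A) (insert H P) = cell F A P"
          using no0 unfolding ci by (auto simp: not_less order_le_less)
        then show ?thesis using 1 True b by (simp add: good_def)
      next
        case 2
        then have "cell F (insert H A) P = cell F A P"
          using no0 unfolding ci by (auto simp: not_less order_le_less)
        then show ?thesis using 2 True b by (simp add: good_def)
      qed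
    next
      case False
      then obtain x where x: "x \<in> cell F A P" "lval x H = 0" unfolding ci by blast
      \<comment> \<open>A point on the section keeps all signs in \<open>A\<close> under a move by
        at most \<delta>, while the equations \<open>F\<close> are undisturbed and the value at H
        changes by the full amount; this reaches both halves.\<close>
      have "0 < \<bar>lval x e\<bar>" if "e \<in> A" for e
        using x(1) that unfolding cell_def by (metis (mono_tags, lifting) mem_Collect_eq less_irrefl zero_less_abs_iff)
      then obtain \<delta> where \<delta>: "\<delta> > 0" "\<And>e. e \<in> A \<Longrightarrow> \<delta> < \<bar>lval x e\<bar>"
        using finite_pos_lower_bound[OF finA, of "\<lambda>e. \<bar>lval x e\<bar>"] by blast
      let ?C = "conn F `` {j}"
      have "i \<notin> ?C" using nc conn_sym by blast
      then have lH: "lval (shift ?C t x) H = t" for t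
        using H(3) x(2) unfolding H(1) by (simp add: shift_lval)
      have inc: "shift ?C t x \<in> cell F A P" if t: "\<bar>t\<bar> \<le> \<delta>" for t
      proof -
        have "lval (shift ?C t x) e = 0" if "e \<in> F" for e
        proof -
          obtain i' j' g' where e: "e = (i', j', g')" by (cases e)
          have "lval (shift ?C t x) e = lval x e"
            unfolding e using that sub(1) e by (intro shift_lval_same conn_class_edge) auto
          then show ?thesis using x(1) that by (simp add: cell_def)
        qed
        moreover have "if e \<in> P then 0 < lval (shift ?C t x) e else lval (shift ?C t x) e < 0" if "e \<in> A" for e
        proof -
          obtain i' j' g' where e: "e = (i', j', g')" by (cases e)
          have "lval (shift ?C t x) e = lval x e + t * (of_bool (j' \<in> ?C) - of_bool (i' \<in> ?C))"
            unfolding e using that sub(2) e by (intro shift_lval) auto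
          moreover have "\<bar>t * (of_bool (j' \<in> ?C) - of_bool (i' \<in> ?C))\<bar> \<le> \<delta>"
            using t \<delta>(1) by (simp add: of_bool_def)
          moreover have "if e \<in> P then 0 < lval x e else lval x e < 0"
            using x(1) that unfolding cell_def by blast
          ultimately show ?thesis using \<delta>(2)[OF that] by (auto split: if_splits)
        qed
        moreover have "shift ?C t x \<in> sum_zero_space n"
          using x(1) shift_sum_zero by (auto simp: cell_def)
        ultimately show ?thesis unfolding cell_def by blast
      qed
      have ne: "cell F A P \<noteq> {}" "cell F (insert H A) P \<noteq> {}" "cell F (insert H A) (insert H P) \<noteq> {}"
      proof -
        have "shift ?C (- \<delta>) x \<in> cell F A P" "lval (shift ?C (- \<delta>) x) H < 0"
          "shift ?C \<delta> x \<in> cell F A P" "0 < lval (shift ?C \<delta> x) H"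
          using inc[of "- \<delta>"] inc[of \<delta>] lH \<delta>(1) by auto
        then show "cell F A P \<noteq> {}" "cell F (insert H A) P \<noteq> {}" "cell F (insert H A) (insert H P) \<noteq> {}"
          unfolding ci by blast+
      qed
      define D where "D = cdig F A P"
      have Dm: "cdig F (insert H A) P = insert (i, j) D"
        "cdig F (insert H A) (insert H P) = insert (j, i) D"
        "cdig (insert H F) A P = insert (i, j) (insert (j, i) D)"
        using H(2) PA unfolding D_def cdig_def H(1) by auto
      have DF: "(i', j') \<in> D \<and> (j', i') \<in> D" if "(i', j', g') \<in> F" for i' j' g'
        using that unfolding D_def cdig_def by auto
      have DA: "(i', j') \<in> D \<or> (j', i') \<in> D" if "(i', j', g') \<in> A" for i' j' g'
        using that unfolding D_def cdig_def by auto
      have tcon: "(i, j) \<in> D'\<^sup>* \<and> (j, i) \<in> D'\<^sup>*" if D': "D \<subseteq> D'" "total_cyclic A D'" for D'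
      proof -
        have "(i', j') \<in> D'\<^sup>* \<and> (j', i') \<in> D'\<^sup>*" if "(i', j', g') \<in> F" for i' j' g'
          using DF[OF that] D'(1) by blast
        then show ?thesis
          using total_cyclic_conn[OF D'(2)] con conn_sym[OF con] by blast
      qed
      have tci: "total_cyclic (insert H A) D' \<longleftrightarrow> total_cyclic A D'" if "D \<subseteq> D'" for D'
      proof -
        have "total_cyclic (insert H A) D' \<longleftrightarrow> total_cyclic A D' \<and> (i, j) \<in> D'\<^sup>* \<and> (j, i) \<in> D'\<^sup>*"
          unfolding total_cyclic_def H(1) by auto
        then show ?thesis using tcon[OF that] by blast
      qed
      have sub': "insert H F \<subseteq> E" "insert H A \<subseteq> E" using sub H(3) by auto
      have "good F (insert H A) P \<longleftrightarrow> total_cyclic A (insert (i, j) D)"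
        "good F (insert H A) (insert H P) \<longleftrightarrow> total_cyclic A (insert (j, i) D)"
        "good F A P \<longleftrightarrow> total_cyclic A D"
        "good (insert H F) A P \<longleftrightarrow> total_cyclic A (insert (i, j) (insert (j, i) D))"
        unfolding good_def
        using ne False bnd_cell_iff[OF ne(2) sub(1) sub'(2)] bnd_cell_iff[OF ne(3) sub(1) sub'(2)]
          bnd_cell_iff[OF ne(1) sub] bnd_cell_iff[OF False sub'(1) sub(2)]
          tci[of "insert (i, j) D"] tci[of "insert (j, i) D"]
        unfolding Dm D_def[symmetric] by blast+
      then show ?thesis
        using total_cyclic_count[of A D i j] DA tcon by simp
    qed
  qed
  then show ?thesis
    unfolding nbounded_insert[OF H(2) finA] by (simp add: nbounded_def sum.distrib[symmetric])
qed

text \<open>Moving the component of \<open>j\<close> in \<open>F \<union> A\<close> changes only the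
  value at H. Every cell is therefore a union of lines crossing H: both halves are unbounded in the
  direction of H, and sliding onto H identifies the cells of the deletion with those of the
  restriction.\<close>

lemma nbounded_independent:
  assumes H: "H = (i, j, g)" "H \<notin> A" "H \<in> E" and sub: "F \<subseteq> E" "A \<subseteq> E"
    and nc: "(i, j) \<notin> conn (F \<union> A)"
  shows "nbounded F (insert H A) = 0" "nbounded F A = nbounded (insert H F) A"
proof -
  have finA: "finite A" using sub finite_subset finite_gain_edges by blast
  let ?C = "conn (F \<union> A) `` {j}"
  have "i \<notin> ?C" using nc conn_sym by blast
  then have lH: "lval (shift ?C t x) H = lval x H + t" for t x
    using H(3) unfolding H(1) by (simp add: shift_lval)
  have same: "lval (shift ?C t x) e = lval x e" if "e \<in> F \<union> A" for t x e
  proof -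
    obtain i' j' g' where e: "e = (i', j', g')" by (cases e)
    show ?thesis
      unfolding e using that sub e by (intro shift_lval_same conn_class_edge) auto
  qed
  have inc: "shift ?C t x \<in> cell F A P" if x: "x \<in> cell F A P" for t x P
  proof -
    have "shift ?C t x \<in> sum_zero_space n"
      using x shift_sum_zero by (auto simp: cell_def)
    moreover have "\<forall>e\<in>F. lval (shift ?C t x) e = 0"
      using x same by (auto simp: cell_def)
    moreover have "\<forall>e\<in>A. if e \<in> P then 0 < lval (shift ?C t x) e else lval (shift ?C t x) e < 0"
    proof
      fix e assume e: "e \<in> A"
      have "if e \<in> P then 0 < lval x e else lval x e < 0"
        using x e unfolding cell_def by blast
      then show "if e \<in> P then 0 < lval (shift ?C t x) e else lval (shift ?C t x) e < 0"
        using same[of e t x] e by simp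
    qed
    ultimately show ?thesis unfolding cell_def by blast
  qed
  have "\<not> good F (insert H A) P" "\<not> good F (insert H A) (insert H P)" if P: "P \<in> Pow A" for P
  proof -
    have PA: "P \<subseteq> A" using P by simp
    note ci = cell_insert[OF H(2) PA, of F]
    show "\<not> good F (insert H A) P"
    proof
      assume g: "good F (insert H A) P"
      then obtain x where x: "x \<in> cell F A P" "lval x H < 0" unfolding good_def ci by blast
      obtain M where M: "\<And>y. y \<in> cell F A P \<Longrightarrow> lval y H < 0 \<Longrightarrow> \<bar>lval y H\<bar> \<le> M"
        using g unfolding good_def bnd_insert ci by blast
      have "0 \<le> M" using M[OF x] by linarith
      then show False
        using M[OF inc[OF x(1), of "- (M + 1)"]] x(2) by (simp add: lH)
    qed
    show "\<not> good F (insert H A) (insert H P)"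
    proof
      assume g: "good F (insert H A) (insert H P)"
      then obtain x where x: "x \<in> cell F A P" "0 < lval x H" unfolding good_def ci by blast
      obtain M where M: "\<And>y. y \<in> cell F A P \<Longrightarrow> 0 < lval y H \<Longrightarrow> \<bar>lval y H\<bar> \<le> M"
        using g unfolding good_def bnd_insert ci by blast
      have "0 \<le> M" using M[OF x] by linarith
      then show False
        using M[OF inc[OF x(1), of "M + 1"]] x(2) by (simp add: lH)
    qed
  qed
  then show "nbounded F (insert H A) = 0"
    unfolding nbounded_insert[OF H(2) finA] by simp
  have "good F A P \<longleftrightarrow> good (insert H F) A P" if P: "P \<in> Pow A" for P
  proof -
    have PA: "P \<subseteq> A" using P by simp
    note ci = cell_insert[OF H(2) PA, of F]
    have proj: "shift ?C (- lval x H) x \<in> cell (insert H F) A P" if "x \<in> cell F A P" for x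
      using inc[OF that] unfolding ci by (simp add: lH)
    have "cell F A P = {} \<longleftrightarrow> cell (insert H F) A P = {}"
      using proj unfolding ci by blast
    moreover have "bnd A (cell F A P)" if b: "bnd A (cell (insert H F) A P)"
    proof -
      obtain M where M: "\<And>x e. x \<in> cell (insert H F) A P \<Longrightarrow> e \<in> A \<Longrightarrow> \<bar>lval x e\<bar> \<le> M"
        using b unfolding bnd_def by blast
      have "\<bar>lval x e\<bar> \<le> M" if "x \<in> cell F A P" "e \<in> A" for x e
        using M[OF proj[OF that(1)] that(2)] same[of e] that(2) by simp
      then show ?thesis unfolding bnd_def by blast
    qed
    moreover have "bnd A (cell (insert H F) A P)" if "bnd A (cell F A P)"
      by (rule bnd_subset[OF that]) (unfold ci, blast)
    ultimately show ?thesis unfolding good_def by blast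
  qed
  then show "nbounded F A = nbounded (insert H F) A"
    unfolding nbounded_def by (intro sum.cong refl) simp
qed

section \<open>The alternating sum over central edge sets\<close>

definition central_sum :: "gedge set \<Rightarrow> gedge set \<Rightarrow> int" where
  "central_sum F A = (\<Sum>G\<in>Pow A. of_bool (pts (F \<union> G) {} \<noteq> {}) * (-1) ^ card G)"

lemma central_sum_insert:
  assumes "H \<notin> A" "finite A"
  shows "central_sum F (insert H A) = central_sum F A - central_sum (insert H F) A"
proof -
  let ?g = "\<lambda>G. of_bool (pts (F \<union> G) {} \<noteq> {}) * (-1) ^ card G :: int"
  have "inj_on (insert H) (Pow A)"
    using assms by (auto simp: inj_on_def)
  then have "(\<Sum>G\<in>insert H ` Pow A. ?g G) = (\<Sum>G\<in>Pow A. ?g (insert H G))"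
    by (simp add: sum.reindex)
  also have "\<dots> = (\<Sum>G\<in>Pow A. - (of_bool (pts (insert H F \<union> G) {} \<noteq> {}) * (-1) ^ card G))"
  proof (rule sum.cong[OF refl])
    fix G assume "G \<in> Pow A"
    then have "H \<notin> G" "finite G" using assms finite_subset by auto
    then show "?g (insert H G) = - (of_bool (pts (insert H F \<union> G) {} \<noteq> {}) * (-1) ^ card G)"
      by simp
  qed
  also have "\<dots> = - central_sum (insert H F) A"
    by (simp add: central_sum_def sum_negf)
  finally have "(\<Sum>G\<in>insert H ` Pow A. ?g G) = - central_sum (insert H F) A" .
  moreover have "(\<Sum>G\<in>Pow (insert H A). ?g G) = (\<Sum>G\<in>Pow A. ?g G) + (\<Sum>G\<in>insert H ` Pow A. ?g G)"
    unfolding Pow_insert using assms by (intro sum.union_disjoint) auto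
  ultimately show ?thesis
    by (simp add: central_sum_def)
qed

text \<open>The left side is Whitney's expansion of the characteristic polynomial at 1, and
  satisfies one and the same recursion throughout. The exponent has the parity of the rank of
  \<open>A\<close> over \<open>F\<close>; its change in the three positions of H turns that
  recursion into the three rules for \<open>nbounded\<close>.\<close>

theorem central_sum_nbounded:
  assumes "A \<subseteq> E" "F \<subseteq> E"
  shows "central_sum F A = (-1) ^ (card (comps n F) + card (comps n (F \<union> A))) * nbounded F A"
proof -
  have "finite A" using assms finite_subset finite_gain_edges by blast
  then show ?thesis
    using assms
  proof (induction A arbitrary: F rule: finite_induct)
    case empty
    have "cell F {} {} = pts F {}" by (simp add: cell_def pts_def)
    then have "good F {} {} \<longleftrightarrow> pts F {} \<noteq> {}" by (simp add: good_def bnd_def)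
    then show ?case
      by (simp add: central_sum_def nbounded_def flip: mult_2)
  next
    case (insert H A)
    obtain i j g where H: "H = (i, j, g)" by (cases H)
    have HE: "H \<in> E" and A: "A \<subseteq> E" and HF: "insert H F \<subseteq> E" using insert.prems by auto
    have ij: "i \<in> {1..n}" "j \<in> {1..n}" using E_verts HE H by auto
    let ?c = "\<lambda>X. card (comps n X)"
    have IH: "central_sum F (insert H A) = (-1) ^ (?c F + ?c (F \<union> A)) * nbounded F A -
        (-1) ^ (?c (insert H F) + ?c (insert H (F \<union> A))) * nbounded (insert H F) A"
      unfolding central_sum_insert[OF insert.hyps(2,1)] using insert.IH[OF A insert.prems(2)] insert.IH[OF A HF]
      by simp
    have un: "F \<union> insert H A = insert H (F \<union> A)" by simp
    consider "(i, j) \<in> conn F" | "(i, j) \<notin> conn F" "(i, j) \<in> conn (F \<union> A)" | "(i, j) \<notin> conn (F \<union> A)"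
      by blast
    then show ?case
    proof cases
      case 1
      have "(i, j) \<in> conn (F \<union> A)" using 1 conn_mono[of F "F \<union> A"] by blast
      then have "?c (insert H F) = ?c F" "?c (insert H (F \<union> A)) = ?c (F \<union> A)"
        unfolding H using 1 by (simp_all add: comps_insert_connected)
      then show ?thesis
        unfolding IH un nbounded_const[OF H insert.hyps(2,1) 1] by (simp add: algebra_simps)
    next
      case 2
      have "?c F = Suc (?c (insert H F))" "?c (insert H (F \<union> A)) = ?c (F \<union> A)"
        unfolding H using 2 card_comps_insert[OF ij 2(1)] by (simp_all add: comps_insert_connected)
      then show ?thesis
        unfolding IH un nbounded_dependent[OF H insert.hyps(2) HE insert.prems(2) A 2] by (simp add: algebra_simps)
    next
      case 3
      then have "(i, j) \<notin> conn F" using conn_mono[of F "F \<union> A"] by blast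
      then have "?c F = Suc (?c (insert H F))" "?c (F \<union> A) = Suc (?c (insert H (F \<union> A)))"
        unfolding H using 3 card_comps_insert[OF ij] by simp_all
      then show ?thesis
        unfolding IH un using nbounded_independent[OF H insert.hyps(2) HE insert.prems(2) A 3] by simp
    qed
  qed
qed

end

text \<open>Moebius inversion in its weakest form: if the sums over all members with closure below X
  vanish, induction on X shows that the sum over each single closure vanishes.\<close>

lemma sum_zero_by_closure:
  fixes w :: "'a \<Rightarrow> int" and cl :: "'a \<Rightarrow> 'b set"
  assumes fin: "finite \<G>" "\<And>G. G \<in> \<G> \<Longrightarrow> finite (cl G)"
    and zero: "\<And>X. X \<in> cl ` \<G> \<Longrightarrow> (\<Sum>G | G \<in> \<G> \<and> cl G \<subseteq> X. w G) = 0"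
  shows "(\<Sum>G\<in>\<G>. w G) = 0"
proof -
  define d where "d X = (\<Sum>G | G \<in> \<G> \<and> cl G = X. w G)" for X
  have "d X = 0" if X: "X \<in> cl ` \<G>" for X
  proof -
    have "finite X" using X fin(2) by blast
    then show ?thesis
      using X
    proof (induction X rule: finite_psubset_induct)
      case (psubset X)
      let ?S = "{G. G \<in> \<G> \<and> cl G \<subseteq> X}"
      have "0 = (\<Sum>G\<in>?S. w G)" using zero[OF psubset.prems] by simp
      also have "\<dots> = (\<Sum>Y\<in>cl ` ?S. \<Sum>G | G \<in> ?S \<and> cl G = Y. w G)"
        by (rule sum.image_gen) (use fin in auto)
      also have "\<dots> = (\<Sum>Y\<in>cl ` ?S. d Y)"
        unfolding d_def by (intro sum.cong refl arg_cong[of _ _ "sum w"]) auto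
      also have "\<dots> = d X + (\<Sum>Y\<in>cl ` ?S - {X}. d Y)"
        using psubset.prems fin by (intro sum.remove) auto
      also have "(\<Sum>Y\<in>cl ` ?S - {X}. d Y) = 0"
        by (rule sum.neutral) (use psubset.IH in auto)
      finally show ?case by simp
    qed
  qed
  moreover have "(\<Sum>G\<in>\<G>. w G) = (\<Sum>Y\<in>cl ` \<G>. d Y)"
    unfolding d_def by (rule sum.image_gen[OF fin(1)])
  ultimately show ?thesis by simp
qed

context gain_graph
begin

text \<open>Below a flat every subset is central, so the sum over all of them is that of a power
  set: 1 for the empty flat and 0 otherwise. The NBC subsets of the flat give the same value, hence
  the difference has sum zero below every flat.\<close>

theorem central_sum_nbc: "central_sum {} E = (\<Sum>F | nbc_set r n a b F. (-1) ^ card F)"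
proof -
  define \<G> where "\<G> = {G. G \<subseteq> E \<and> pts G {} \<noteq> {}}"
  \<comment> \<open>The closure consists of all edges whose functional vanishes wherever
    \<open>G\<close> does; divisibility by the real number 0 is vanishing.\<close>
  define cl where "cl G = flat (0 :: real) (pts G {})" for G
  define w :: "gedge set \<Rightarrow> int" where "w G = (-1) ^ card G - of_bool (nbc_set r n a b G) * (-1) ^ card G" for G
  have fin\<G>: "finite \<G>"
    by (rule finite_subset[of _ "Pow E"]) (auto simp: \<G>_def)
  have nbc\<G>: "G \<in> \<G>" if "nbc_set r n a b G" for G
    using that forest_central[of G] by (auto simp: \<G>_def nbc_set_def)
  have clE: "cl G \<subseteq> E" for G by (auto simp: cl_def flat_def)
  have fincl: "finite (cl G)" for G by (rule finite_subset[OF clE finite_gain_edges])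
  have below: "{G. G \<in> \<G> \<and> cl G \<subseteq> cl G0} = Pow (cl G0)" if G0: "G0 \<in> \<G>" for G0
  proof (intro equalityI subsetI)
    fix G assume "G \<in> {G. G \<in> \<G> \<and> cl G \<subseteq> cl G0}"
    then have G: "G \<subseteq> E" "cl G \<subseteq> cl G0" by (auto simp: \<G>_def)
    have "G \<subseteq> cl G" using G(1) by (auto simp: cl_def flat_def pts_def)
    then show "G \<in> Pow (cl G0)" using G(2) by blast
  next
    fix G assume "G \<in> Pow (cl G0)"
    then have G: "G \<subseteq> cl G0" by simp
    have sub: "pts G0 {} \<subseteq> pts G {}"
      using G by (auto simp: cl_def flat_def pts_def)
    then have "cl G \<subseteq> cl G0" by (auto simp: cl_def flat_def)
    moreover have "G \<in> \<G>"
      using sub G0 G clE[of G0] by (auto simp: \<G>_def)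
    ultimately show "G \<in> {G. G \<in> \<G> \<and> cl G \<subseteq> cl G0}" by simp
  qed
  have "(\<Sum>G\<in>\<G>. w G) = 0"
  proof (rule sum_zero_by_closure[OF fin\<G> fincl])
    fix X assume "X \<in> cl ` \<G>"
    then obtain G0 where G0: "G0 \<in> \<G>" "X = cl G0" by blast
    have "(\<Sum>G | G \<in> \<G> \<and> cl G \<subseteq> X. w G) = (\<Sum>G\<in>Pow (cl G0). w G)"
      unfolding G0(2) below[OF G0(1)] ..
    also have "\<dots> = (\<Sum>G\<in>Pow (cl G0). (-1) ^ card G) -
        (\<Sum>G\<in>Pow (cl G0). of_bool (nbc_set r n a b G) * (-1) ^ card G)"
      by (simp add: w_def sum_subtractf)
    also have "(\<Sum>G\<in>Pow (cl G0). (-1 :: int) ^ card G) = (if cl G0 = {} then 1 else 0)"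
      using sum_Pow_power_card[OF fincl, of "-1 :: int" G0] fincl[of G0] by (simp add: power_0_left)
    also have "(\<Sum>G\<in>Pow (cl G0). of_bool (nbc_set r n a b G) * (-1 :: int) ^ card G) =
        (\<Sum>G | nbc_set r n a b G \<and> G \<subseteq> cl G0. (-1) ^ card G)"
    proof -
      have "(\<Sum>G\<in>Pow (cl G0). of_bool (nbc_set r n a b G) * (-1 :: int) ^ card G) =
          (\<Sum>G\<in>Pow (cl G0). if nbc_set r n a b G then (-1) ^ card G else 0)"
        by (rule sum.cong) auto
      also have "\<dots> = (\<Sum>G\<in>{G \<in> Pow (cl G0). nbc_set r n a b G}. (-1) ^ card G)"
        using fincl[of G0] by (intro sum.inter_filter[symmetric]) simp
      finally show ?thesis by (simp add: conj_commute)
    qed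
    also have "\<dots> = (if cl G0 = {} then 1 else 0)"
      unfolding cl_def by (rule nbc_alternating_flat) (use G0(1) in \<open>auto simp: \<G>_def\<close>)
    finally show "(\<Sum>G | G \<in> \<G> \<and> cl G \<subseteq> X. w G) = 0" by simp
  qed
  then have "(\<Sum>G\<in>\<G>. (-1 :: int) ^ card G) = (\<Sum>G\<in>\<G>. of_bool (nbc_set r n a b G) * (-1) ^ card G)"
    by (simp add: w_def sum_subtractf)
  also have "\<dots> = (\<Sum>F | nbc_set r n a b F. of_bool (nbc_set r n a b F) * (-1) ^ card F)"
    using nbc\<G> by (intro sum.mono_neutral_right fin\<G>) auto
  also have "\<dots> = (\<Sum>F | nbc_set r n a b F. (-1) ^ card F)"
    by (rule sum.cong) auto
  finally have "(\<Sum>G\<in>\<G>. (-1 :: int) ^ card G) = (\<Sum>F | nbc_set r n a b F. (-1) ^ card F)" .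
  moreover have "central_sum {} E = (\<Sum>G\<in>\<G>. (-1) ^ card G)"
  proof -
    have "central_sum {} E = (\<Sum>G\<in>Pow E. if pts G {} \<noteq> {} then (-1) ^ card G else 0)"
      unfolding central_sum_def by (rule sum.cong) auto
    also have "\<dots> = (\<Sum>G\<in>{G \<in> Pow E. pts G {} \<noteq> {}}. (-1) ^ card G)"
      by (rule sum.inter_filter[symmetric]) simp
    finally show ?thesis by (simp add: \<G>_def)
  qed
  ultimately show ?thesis by simp
qed

text \<open>The expansion by activity at y = -1 has 1 + y = 0, which leaves just the bases of
  activity 0. The sign is that of rank n - 1, from n components without edges to a single
  one.\<close>

theorem nbounded_activity: "nbounded {} E = int (card {B. nbc_basis r n a b B \<and> activity r n a b B = 0})"
proof -
  have conE: "(u, w) \<in> conn E" if "u \<in> {1..n}" "w \<in> {1..n}" for u w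
  proof -
    obtain B where "spanning_tree n a b B"
      using spanning_tree_extension[of "{}"] by auto
    then have "(u, w) \<in> conn B" "B \<subseteq> E"
      using that by (auto simp: spanning_tree_def conn_def)
    then show ?thesis using conn_mono by blast
  qed
  have c1: "card (comps n {}) = n"
    using forest_card_comps[of "{}" n a b] by simp
  have "card (comps n E) = 1"
    using conE n2 by (intro card_comps_connected) auto
  then have S: "central_sum {} E = (-1) ^ (n + 1) * nbounded {} E"
    using central_sum_nbounded[of E "{}"] c1 by simp
  have sq: "(-1 :: int) ^ (n + 1) * (-1) ^ (n + 1) = 1"
    by (simp flip: power_mult_distrib)
  have "nbounded {} E = (-1) ^ (n + 1) * central_sum {} E"
    unfolding S mult.assoc[symmetric] sq by simp
  also have "\<dots> = (\<Sum>F | nbc_set r n a b F. (-1) ^ (n + 1) * (-1) ^ card F)"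
    by (simp add: central_sum_nbc sum_distrib_left)
  also have "\<dots> = (\<Sum>F | nbc_set r n a b F. (-1) ^ (n - 1 - card F))"
  proof (rule sum.cong[OF refl])
    fix F assume "F \<in> {F. nbc_set r n a b F}"
    then have "F \<subseteq> E" "is_forest F" by (auto simp: nbc_set_def)
    from forest_card_comps[OF this] have "card F + card (comps n F) = n" .
    moreover have "card (comps n F) \<ge> 1"
      using n2 by (simp add: Suc_le_eq card_gt_0_iff comps_def)
    ultimately have le: "card F \<le> n - 1" by linarith
    obtain d where "n - 1 = card F + d"
      using le_Suc_ex[OF le] by blast
    then have d: "n = card F + d + 1"
      using n2 by linarith
    have e: "n + 1 + card F = (n - 1 - card F) + 2 * (card F + 1)"
      by (simp add: d)
    have "(-1 :: int) ^ (n + 1) * (-1) ^ card F = (-1) ^ ((n - 1 - card F) + 2 * (card F + 1))"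
      unfolding power_add[symmetric] e ..
    then show "(-1 :: int) ^ (n + 1) * (-1) ^ card F = (-1) ^ (n - 1 - card F)"
      by (simp add: power_add power_mult)
  qed
  also have "\<dots> = (\<Sum>B | nbc_basis r n a b B. (1 + (-1)) ^ activity r n a b B)"
    by (rule nbc_sets_sum_activity)
  also have "\<dots> = (\<Sum>B | nbc_basis r n a b B. if activity r n a b B = 0 then 1 else 0)"
    by (rule sum.cong) (auto simp: power_0_left)
  also have "\<dots> = int (card {B \<in> {B. nbc_basis r n a b B}. activity r n a b B = 0})"
    by (simp add: sum.inter_filter[symmetric])
  finally show ?thesis by simp
qed

section \<open>Regions as sign cells\<close>

lemma arr_complement_eq: "arr_complement n a b = pts {} E"
  by (auto simp: arr_complement_def pts_def hyperplane_of_def lval_def)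

definition pos :: "(nat \<Rightarrow> real) \<Rightarrow> gedge set" where
  "pos x = {e \<in> E. 0 < lval x e}"

lemma in_cell_iff: "P \<subseteq> E \<Longrightarrow> x \<in> cell {} E P \<longleftrightarrow> x \<in> pts {} E \<and> pos x = P"
proof
  assume P: "P \<subseteq> E" and x: "x \<in> cell {} E P"
  have s: "if e \<in> P then 0 < lval x e else lval x e < 0" if "e \<in> E" for e
    using x that unfolding cell_def by blast
  have "lval x e \<noteq> 0" if "e \<in> E" for e
    using s[OF that] by (auto split: if_splits)
  moreover have "pos x = P"
    using s P unfolding pos_def by (fastforce split: if_splits)
  moreover have "x \<in> sum_zero_space n"
    using x by (simp add: cell_def)
  ultimately show "x \<in> pts {} E \<and> pos x = P"
    by (simp add: pts_def)
next
  assume "x \<in> pts {} E \<and> pos x = P"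
  then have x: "x \<in> pts {} E" and P: "P = pos x" by auto
  have "if e \<in> P then 0 < lval x e else lval x e < 0" if "e \<in> E" for e
  proof -
    have "lval x e \<noteq> 0" using x that by (simp add: pts_def)
    then show ?thesis using that by (auto simp: P pos_def)
  qed
  then show "x \<in> cell {} E P"
    using x by (simp add: cell_def pts_def)
qed

text \<open>On a connected subset of the complement no functional can change sign without vanishing;
  conversely a segment between two points with equal signs avoids all hyperplanes.\<close>

lemma region_eq_cell:
  assumes x: "x \<in> pts {} E"
  shows "connected_component_set (pts {} E) x = cell {} E (pos x)"
proof (intro equalityI subsetI)
  fix y assume "y \<in> connected_component_set (pts {} E) x"
  then obtain T where T: "connected T" "T \<subseteq> pts {} E" "x \<in> T" "y \<in> T"
    unfolding connected_component_def by auto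
  have same: "0 < lval x e \<longleftrightarrow> 0 < lval y e" if e: "e \<in> E" for e
  proof -
    have "continuous_on T (\<lambda>z. lval z e)"
      unfolding lval_def
      by (intro continuous_intros continuous_on_subset[OF continuous_on_product_coordinates]) auto
    then have con: "connected ((\<lambda>z. lval z e) ` T)"
      using T(1) by (rule connected_continuous_image)
    have ne: "0 \<notin> (\<lambda>z. lval z e) ` T"
      using T(2) e by (auto simp: pts_def)
    have "lval x e \<noteq> 0" "lval y e \<noteq> 0"
      using ne T(3,4) by (metis imageI)+
    moreover have "\<not> (lval u e < 0 \<and> 0 < lval v e)" if "u \<in> T" "v \<in> T" for u v
    proof
      assume "lval u e < 0 \<and> 0 < lval v e"
      then have "0 \<in> {lval u e..lval v e}" by simp
      then have "0 \<in> (\<lambda>z. lval z e) ` T"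
        using connected_contains_Icc[OF con, of "lval u e" "lval v e"] that by blast
      then show False using ne by simp
    qed
    ultimately show ?thesis
      using T(3,4) by (metis linorder_neqE_linordered_idom)
  qed
  have "pos y = pos x" unfolding pos_def using same by blast
  then show "y \<in> cell {} E (pos x)"
    using T(2,4) by (subst in_cell_iff) (auto simp: pos_def)
next
  fix y assume y: "y \<in> cell {} E (pos x)"
  have posE: "pos x \<subseteq> E" by (auto simp: pos_def)
  have xc: "x \<in> cell {} E (pos x)" using in_cell_iff[OF posE] x by simp
  define \<gamma> where "\<gamma> s = (\<lambda>i. (1 - s) * x i + s * y i)" for s :: real
  have "continuous_on {0..1} \<gamma>"
    unfolding \<gamma>_def by (intro continuous_on_coordinatewise_then_product continuous_intros)
  then have "connected (\<gamma> ` {0..1})"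
    by (rule connected_continuous_image) simp
  moreover have "\<gamma> ` {0..1} \<subseteq> pts {} E"
  proof (rule image_subsetI)
    fix s :: real assume s: "s \<in> {0..1}"
    have lv: "lval (\<gamma> s) e = (1 - s) * lval x e + s * lval y e" for e
      by (simp add: lval_def \<gamma>_def algebra_simps)
    have "(\<Sum>i\<in>{1..n}. \<gamma> s i) = (1 - s) * (\<Sum>i\<in>{1..n}. x i) + s * (\<Sum>i\<in>{1..n}. y i)"
      by (simp add: \<gamma>_def sum.distrib sum_distrib_left)
    then have "\<gamma> s \<in> sum_zero_space n"
      using xc y by (auto simp: cell_def sum_zero_space_def \<gamma>_def)
    moreover have "lval (\<gamma> s) e \<noteq> 0" if e: "e \<in> E" for e
    proof (cases "e \<in> pos x")
      case True
      then have "0 < lval x e" "0 < lval y e" using xc y e unfolding cell_def by auto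
      moreover have "0 < 1 - s \<or> 0 < s" "0 \<le> 1 - s" "0 \<le> s" using s by auto
      ultimately have "0 < (1 - s) * lval x e + s * lval y e"
        by (meson add_nonneg_pos add_pos_nonneg less_imp_le mult_nonneg_nonneg mult_pos_pos)
      then show ?thesis unfolding lv by simp
    next
      case False
      then have "0 < - lval x e" "0 < - lval y e" using xc y e unfolding cell_def by auto
      moreover have "0 < 1 - s \<or> 0 < s" "0 \<le> 1 - s" "0 \<le> s" using s by auto
      ultimately have "0 < (1 - s) * - lval x e + s * - lval y e"
        by (meson add_nonneg_pos add_pos_nonneg less_imp_le mult_nonneg_nonneg mult_pos_pos)
      then show ?thesis unfolding lv by simp
    qed
    ultimately show "\<gamma> s \<in> pts {} E" by (simp add: pts_def)
  qed
  moreover have "\<gamma> 0 = x" "\<gamma> 1 = y" by (auto simp: \<gamma>_def)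
  then have "x \<in> \<gamma> ` {0..1}" "y \<in> \<gamma> ` {0..1}"
    by (metis atLeastAtMost_iff imageI order_refl zero_le_one)+
  ultimately show "y \<in> connected_component_set (pts {} E) x"
    unfolding connected_component_def by blast
qed

text \<open>Every pair u < v carries the edge of gain \<open>a\<close>, so bounded functionals bound
  all coordinate differences. With coordinate sum 0, n times x i is the sum of the differences x i -
  x v, which bounds the coordinates themselves.\<close>

lemma bounded_region_iff_bnd:
  assumes R: "R \<subseteq> sum_zero_space n"
  shows "bounded_region n R \<longleftrightarrow> bnd E R"
proof
  assume "bounded_region n R"
  then obtain M where M: "\<And>x i. x \<in> R \<Longrightarrow> i \<in> {1..n} \<Longrightarrow> \<bar>x i\<bar> \<le> M"
    unfolding bounded_region_def by blast
  have "\<bar>lval x e\<bar> \<le> 2 * M + \<bar>real_of_int a\<bar> + \<bar>real_of_int b\<bar>" if "x \<in> R" "e \<in> E" for x e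
  proof -
    obtain i j g where e: "e = (i, j, g)" by (cases e)
    have "\<bar>x i\<bar> \<le> M" "\<bar>x j\<bar> \<le> M" using M[OF that(1)] E_verts[of i j g] that(2) e by auto
    moreover have "a \<le> g" "g \<le> b" using that(2) e by (auto simp: gain_edges_iff)
    then have "real_of_int a \<le> real_of_int g" "real_of_int g \<le> real_of_int b" by simp_all
    ultimately show ?thesis unfolding e lval_def gain_def by simp
  qed
  then show "bnd E R" unfolding bnd_def by blast
next
  assume "bnd E R"
  then obtain M where M: "\<And>x e. x \<in> R \<Longrightarrow> e \<in> E \<Longrightarrow> \<bar>lval x e\<bar> \<le> M"
    unfolding bnd_def by blast
  define c where "c = \<bar>M\<bar> + \<bar>real_of_int a\<bar>"
  have "\<bar>x i\<bar> \<le> c" if x: "x \<in> R" and i: "i \<in> {1..n}" for x i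
  proof -
    have lt: "\<bar>x v - x u\<bar> \<le> c" if "u \<in> {1..n}" "v \<in> {1..n}" "u < v" for u v
    proof -
      have "(u, v, a) \<in> E" using that ab by (auto simp: gain_edges_iff)
      from M[OF x this] show ?thesis unfolding c_def by (simp add: lval_def gain_def)
    qed
    have d: "\<bar>x i - x v\<bar> \<le> c" if v: "v \<in> {1..n}" for v
    proof -
      consider "v < i" | "v = i" | "i < v" by linarith
      then show ?thesis
        using lt[OF v i] lt[OF i v] by cases (auto simp: c_def)
    qed
    have "(\<Sum>v\<in>{1..n}. x v) = 0" using R x by (auto simp: sum_zero_space_def)
    then have "real n * x i = (\<Sum>v\<in>{1..n}. x i - x v)"
      by (simp add: sum_subtractf)
    then have "real n * \<bar>x i\<bar> = \<bar>\<Sum>v\<in>{1..n}. x i - x v\<bar>"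
      by (metis abs_mult abs_of_nat)
    also have "\<dots> \<le> (\<Sum>v\<in>{1..n}. \<bar>x i - x v\<bar>)" by (rule sum_abs)
    also have "\<dots> \<le> (\<Sum>v\<in>{1..n}. c)" by (rule sum_mono) (rule d)
    also have "\<dots> = real n * c" by simp
    finally show ?thesis using n2 by simp
  qed
  then show "bounded_region n R" unfolding bounded_region_def by blast
qed

theorem card_bounded_regions:
  "card {R \<in> regions n a b. bounded_region n R} = card {B. nbc_basis r n a b B \<and> activity r n a b B = 0}"
proof -
  let ?G = "{P \<in> Pow E. good {} E P}"
  have "{R \<in> regions n a b. bounded_region n R} = cell {} E ` ?G"
  proof (intro equalityI subsetI)
    fix R assume "R \<in> {R \<in> regions n a b. bounded_region n R}"
    then obtain x where x: "x \<in> pts {} E" "R = connected_component_set (pts {} E) x" "bounded_region n R"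
      unfolding regions_def arr_complement_eq by auto
    have R: "R = cell {} E (pos x)" using x region_eq_cell by simp
    have posE: "pos x \<subseteq> E" by (auto simp: pos_def)
    have "x \<in> cell {} E (pos x)" using in_cell_iff[OF posE] x(1) by simp
    moreover have "bnd E (cell {} E (pos x))"
      using x(3) unfolding R by (subst bounded_region_iff_bnd[symmetric]) (auto simp: cell_def)
    ultimately have "pos x \<in> ?G" using posE by (auto simp: good_def)
    then show "R \<in> cell {} E ` ?G" using R by blast
  next
    fix R assume "R \<in> cell {} E ` ?G"
    then obtain P where P: "P \<subseteq> E" "good {} E P" "R = cell {} E P" by blast
    then obtain x where "x \<in> cell {} E P" unfolding good_def by blast
    then have x: "x \<in> pts {} E" "pos x = P" using in_cell_iff[OF P(1)] by auto
    have "R = connected_component_set (pts {} E) x"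
      using region_eq_cell[OF x(1)] x(2) P(3) by simp
    then have "R \<in> regions n a b"
      unfolding regions_def arr_complement_eq using x(1) by blast
    moreover have "bounded_region n R"
      using P(2,3) unfolding good_def by (subst bounded_region_iff_bnd) (auto simp: cell_def)
    ultimately show "R \<in> {R \<in> regions n a b. bounded_region n R}" by simp
  qed
  moreover have "inj_on (cell {} E) ?G"
  proof (rule inj_onI)
    fix P Q assume P: "P \<in> ?G" and Q: "Q \<in> ?G" and eq: "cell {} E P = cell {} E Q"
    obtain x where x: "x \<in> cell {} E P" using P unfolding good_def by blast
    have "pos x = P" using in_cell_iff[of P x] x P by simp
    moreover have "pos x = Q" using in_cell_iff[of Q x] x eq Q by simp
    ultimately show "P = Q" by simp
  qed
  ultimately have "card {R \<in> regions n a b. bounded_region n R} = card ?G"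
    by (simp add: card_image)
  moreover have "int (card ?G) = nbounded {} E"
  proof -
    have "nbounded {} E = (\<Sum>P\<in>Pow E. if good {} E P then 1 else 0)"
      by (simp add: nbounded_def of_bool_def)
    also have "\<dots> = (\<Sum>P\<in>?G. 1)"
      by (rule sum.inter_filter[symmetric]) simp
    finally show ?thesis by simp
  qed
  ultimately show ?thesis using nbounded_activity by simp
qed

end

theorem theorem4p3:
  fixes n k1 k2 \<alpha> :: nat and r :: "gedge \<Rightarrow> nat"
  assumes "2 \<le> n" and "1 \<le> k1" and "\<alpha> \<le> n - 1"
    and "inj_on r (gain_edges n (1 - int k2) (int k1 + int k2))"
  shows "card {B. nbc_basis r n (1 - int k2) (int k1 + int k2) B \<and>
                  activity r n (1 - int k2) (int k1 + int k2) B = \<alpha>}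
         = card {T. colored_rooted_tree n (k1 + k2) T \<and> non_increasing k1 T \<and>
                    num_root_edges_col1 n T = \<alpha>}
       \<and> card {R \<in> regions n (1 - int k2) (int k1 + int k2). bounded_region n R}
         = card {T. colored_rooted_tree n (k1 + k2) T \<and> non_increasing k1 T \<and>
                    num_root_edges_col1 n T = 0}"
proof
  interpret gain_graph n "1 - int k2" "int k1 + int k2" r
    using assms by unfold_locales auto
  show "card {B. nbc_basis r n (1 - int k2) (int k1 + int k2) B \<and>
                  activity r n (1 - int k2) (int k1 + int k2) B = \<alpha>}
         = card {T. colored_rooted_tree n (k1 + k2) T \<and> non_increasing k1 T \<and>
                    num_root_edges_col1 n T = \<alpha>}"
    by (rule nbc_bases_trees[OF assms(1,2,4)])
  show "card {R \<in> regions n (1 - int k2) (int k1 + int k2). bounded_region n R}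
         = card {T. colored_rooted_tree n (k1 + k2) T \<and> non_increasing k1 T \<and>
                    num_root_edges_col1 n T = 0}"
    \<comment> \<open>The first claim is used again with activity 0.\<close>
    unfolding card_bounded_regions by (rule nbc_bases_trees[OF assms(1,2,4)])
qed

end
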